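(* Let $n\ge 2$, $p\ge1$ and let $\mathfrak D_n^{(p)}$ be the level-$p$ reduction of $\mathfrak D_n$, with $$\mathcal G_p(\lambda):=\mathcal A^{(0)}+\frac{\mathcal G^{(1)}}{\lambda}+\dots+\frac{\mathcal G^{(p-1)}}{\lambda^{p-1}}+\frac{(\mathcal A^{(0)})^T}{\lambda^p}.$$ With the reduction condition $G^{(k)}_{i,j}=G^{(p-k)}_{j,i}$ imposed, the braid group transformations retain their matrix form with $\mathcal G(\lambda)$ replaced by $\mathcal G_p(\lambda)$: $$\beta_{i,i+1}\mathcal G_p(\lambda)=B_{i,i+1}\mathcal G_p(\lambda)B_{i,i+1}^T\ (1\le i\le n-1),\qquad \beta_{n,1}\mathcal G_p(\lambda)=B_{n,1}(\lambda)\mathcal G_p(\lambda)\bigl(B_{n,1}(\lambda^{-1})\bigr)^T.$$ Moreover, there are exactly $\left[\frac{np}{2}\right]$ algebraically independent central elements in the Poisson algebra $\mathfrak D^{(p)}_n$, and they are generated by $\det\mathcal G_p(\lambda)$ (i.e. they are given by the coefficients of its expansion in powers of $\lambda$).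
   Context: $\mathfrak D_n$: Poisson algebra over $\mathbb C$ on commuting generators $G^{(0)}_{i,j}$ ($i<j$) and $G^{(k)}_{i,j}$ ($k\ge1$, $1\le i,j\le n$), with conventions $G^{(-k)}_{j,i}=G^{(k)}_{i,j}$, $G^{(0)}_{i,i}=2$. Put $\mathcal G^{(k)}=(G^{(k)}_{i,j})_{i,j}$; $\mathcal A^{(0)}$ is the upper triangular matrix with $\mathcal A^{(0)}_{i,j}=G^{(0)}_{i,j}$ for $i<j$ and $1$ on the diagonal; $\mathcal G(\lambda)=\mathcal A^{(0)}+\sum_{k\ge1}\mathcal G^{(k)}\lambda^{-k}$. The bracket is (as an identity of formal series, $\epsilon$ = sign function with $\epsilon(0)=0$) $$\begin{aligned}\{\mathcal G_{j,i}(\lambda),\mathcal G_{p,l}(\mu)\}={}&\Bigl(\epsilon(j-p)-\tfrac{\lambda+\mu}{\lambda-\mu}\Bigr)\mathcal G_{p,i}(\lambda)\mathcal G_{j,l}(\mu)+\Bigl(\epsilon(i-l)+\tfrac{\lambda+\mu}{\lambda-\mu}\Bigr)\mathcal G_{p,i}(\mu)\mathcal G_{j,l}(\lambda)\\&+\Bigl(\epsilon(i-p)-\tfrac{1+\lambda\mu}{1-\lambda\mu}\Bigr)\mathcal G_{j,p}(\lambda)\mathcal G_{i,l}(\mu)+\Bigl(\epsilon(j-l)+\tfrac{1+\lambda\mu}{1-\lambda\mu}\Bigr)\mathcal G_{l,i}(\lambda)\mathcal G_{p,j}(\mu)\end{aligned}$$ (here $p$ is an index). Level-$p$ reduction: impose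 $G^{(k+p)}_{i,j}=G^{(k)}_{i,j}$ for all $k\in\mathbb Z$, equivalently $G^{(k)}_{i,j}=G^{(p-k)}_{j,i}$ for $k=0,\dots,p-1$ together with periodicity. This is compatible with the bracket; the resulting finitely generated polynomial Poisson algebra (generators: the $G^{(k)}_{i,j}$, $0\le k\le p-1$, modulo these identifications and $G^{(0)}_{i,i}=2$) is $\mathfrak D^{(p)}_n$. A central element is one whose bracket with every element vanishes. Braid matrices: $B_{i,i+1}$ is the identity except for the block $\begin{pmatrix}G^{(0)}_{i,i+1}&-1\\1&0\end{pmatrix}$ in rows and columns $i,i+1$; $B_{n,1}(\lambda)$ has entries $(1,n)\mapsto\lambda$, $(n,1)\mapsto-\lambda^{-1}$, $(n,n)\mapsto G^{(1)}_{n,1}$, $(j,j)\mapsto1$ for $1<j<n$, and zeros elsewhere. In $\mathfrak D_n$ the braid group transformations are those given by $\beta_{i,i+1}\mathcal G(\lambda)=B_{i,i+1}\mathcal G(\lambda)B_{i,i+1}^T$ and $\beta_{n,1}\mathcal G(\lambda)=B_{n,1}(\lambda)\mathcal G(\lambda)(B_{n,1}(\lambda^{-1}))^T$, acting on generators coefficientwise. *)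

theory Defs
  imports
    "Jordan_Normal_Form.Determinant"
    "HOL-Library.Poly_Mapping"
    "HOL-Computational_Algebra.Formal_Laurent_Series"
begin

section \<open>Polynomial algebras over the complex numbers\<close>

text \<open>A polynomial is a finitely supported map from monomials to coefficients; a monomial is a
  finitely supported map from variables to exponents.\<close>

type_synonym 'v cpoly = "('v \<Rightarrow>\<^sub>0 nat) \<Rightarrow>\<^sub>0 complex"

definition Cst :: "complex \<Rightarrow> 'v cpoly" where
  "Cst a = Poly_Mapping.single 0 a"

definition Var :: "'v \<Rightarrow> 'v cpoly" where
  "Var x = Poly_Mapping.single (Poly_Mapping.single x 1) 1"

definition vars :: "'v cpoly \<Rightarrow> 'v set" where
  "vars f = (\<Union>m\<in>Poly_Mapping.keys f. Poly_Mapping.keys m)"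

definition poly_alg :: "'v set \<Rightarrow> 'v cpoly set" where
  "poly_alg X = {f. vars f \<subseteq> X}"

definition pdiff :: "'v \<Rightarrow> 'v cpoly \<Rightarrow> 'v cpoly" where
  "pdiff x f = (\<Sum>m\<in>Poly_Mapping.keys f.
     Poly_Mapping.single (m - Poly_Mapping.single x 1)
       (of_nat (Poly_Mapping.lookup m x) * Poly_Mapping.lookup f m))"

definition subst :: "('v \<Rightarrow> 'w cpoly) \<Rightarrow> 'v cpoly \<Rightarrow> 'w cpoly" where
  "subst \<sigma> f = (\<Sum>m\<in>Poly_Mapping.keys f. Cst (Poly_Mapping.lookup f m) *
     (\<Prod>x\<in>Poly_Mapping.keys m. \<sigma> x ^ Poly_Mapping.lookup m x))"

definition alg_hom :: "'v cpoly set \<Rightarrow> 'w cpoly set \<Rightarrow> ('v cpoly \<Rightarrow> 'w cpoly) \<Rightarrow> bool" where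
  "alg_hom A B \<phi> \<longleftrightarrow> \<phi> ` A \<subseteq> B \<and> (\<forall>a. \<phi> (Cst a) = Cst a) \<and>
     (\<forall>f\<in>A. \<forall>g\<in>A. \<phi> (f + g) = \<phi> f + \<phi> g \<and> \<phi> (f * g) = \<phi> f * \<phi> g)"

definition alg_indep :: "('i \<Rightarrow> 'v cpoly) \<Rightarrow> 'i set \<Rightarrow> bool" where
  "alg_indep c I \<longleftrightarrow> (\<forall>P\<in>poly_alg I. subst c P = 0 \<longrightarrow> P = 0)"

text \<open>The biderivation with prescribed values on the variables.\<close>

definition biderivation :: "('v \<Rightarrow> 'v \<Rightarrow> 'v cpoly) \<Rightarrow> 'v cpoly \<Rightarrow> 'v cpoly \<Rightarrow> 'v cpoly" where
  "biderivation \<gamma> f g = (\<Sum>x\<in>vars f. \<Sum>y\<in>vars g. pdiff x f * pdiff y g * \<gamma> x y)"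

definition center :: "('v cpoly \<Rightarrow> 'v cpoly \<Rightarrow> 'v cpoly) \<Rightarrow> 'v cpoly set \<Rightarrow> 'v cpoly set" where
  "center br A = {f\<in>A. \<forall>g\<in>A. br f g = 0}"


section \<open>The Poisson algebra of the series \<open>G(\<lambda>)\<close>\<close>

text \<open>The variable \<open>(k, i, j)\<close> stands for \<open>G\<^sup>(\<^sup>k\<^sup>)\<^sub>i\<^sub>,\<^sub>j\<close>. Matrix indices run over \<open>{0..<n}\<close>, i.e.
  they are shifted by one from the customary \<open>{1..n}\<close>; only their order and adjacency matter.\<close>

type_synonym gen = "nat \<times> nat \<times> nat"

definition gens :: "nat \<Rightarrow> gen set" where
  "gens n = {(0, i, j) | i j. i < j \<and> j < n} \<union> {(k, i, j) | k i j. 1 \<le> k \<and> i < n \<and> j < n}"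

definition D_alg :: "nat \<Rightarrow> gen cpoly set" where
  "D_alg n = poly_alg (gens n)"

definition A0 :: "nat \<Rightarrow> nat \<Rightarrow> gen cpoly" where
  "A0 i j = (if i < j then Var (0, i, j) else if i = j then 1 else 0)"

text \<open>The coefficient of \<open>\<lambda>\<^sup>-\<^sup>k\<close> in \<open>G(\<lambda>)\<^sub>i\<^sub>,\<^sub>j\<close>.\<close>

definition G_coeff :: "nat \<Rightarrow> nat \<Rightarrow> nat \<Rightarrow> gen cpoly" where
  "G_coeff k i j = (if k = 0 then A0 i j else Var (k, i, j))"

text \<open>For the bracket, identities between formal series in \<open>\<lambda>\<close> and \<open>\<mu>\<close> live in the ring of power
  series in \<open>z = \<lambda>\<^sup>-\<^sup>1\<close> over Laurent series in \<open>w = \<mu>\<^sup>-\<^sup>1\<close>. The two kernels are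
  \<open>(\<lambda> + \<mu>) / (\<lambda> - \<mu>) = (w + z) / (w - z) = 1 + 2 (\<Sum>m\<ge>1. z\<^sup>m w\<^sup>-\<^sup>m)\<close> and
  \<open>(1 + \<lambda> \<mu>) / (1 - \<lambda> \<mu>) = (z w + 1) / (z w - 1) = - (1 + 2 (\<Sum>m\<ge>1. z\<^sup>m w\<^sup>m))\<close>.
  In the bracket the first one is multiplied by a series vanishing at \<open>\<lambda> = \<mu>\<close>, so that expanding it
  in powers of \<open>w / z\<close> instead would give the same result.\<close>

definition kernel_minus :: "gen cpoly fls fps" where
  "kernel_minus = Abs_fps (\<lambda>m. if m = 0 then 1 else 2 * fls_X_intpow (- int m))"

definition kernel_prod :: "gen cpoly fls fps" where
  "kernel_prod = - Abs_fps (\<lambda>m. if m = 0 then 1 else 2 * fls_X_intpow (int m))"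

lemma kernel_minus: "(fps_const fls_X - fps_X) * kernel_minus = fps_const fls_X + fps_X"
proof (rule fps_ext)
  fix m
  show "fps_nth ((fps_const fls_X - fps_X) * kernel_minus) m = fps_nth (fps_const fls_X + fps_X) m"
  proof (cases m)
    case (Suc k)
    have "fls_X * (2 * fls_shift (int (Suc k)) 1) = (2 * fls_shift (int k) 1 :: gen cpoly fls)"
      by (simp only: mult_2 distrib_left fls_X_times_conv_shift fls_shift_fls_shift) simp
    then show ?thesis
      by (cases k) (simp_all add: Suc kernel_minus_def left_diff_distrib add.commute)
  qed (simp add: kernel_minus_def left_diff_distrib)
qed

lemma kernel_prod: "(fps_const fls_X * fps_X - 1) * kernel_prod = fps_const fls_X * fps_X + 1"
proof (rule fps_ext)
  fix m
  show "fps_nth ((fps_const fls_X * fps_X - 1) * kernel_prod) m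
      = fps_nth (fps_const fls_X * fps_X + 1) m"
  proof (cases m)
    case (Suc k)
    have "fls_X * (2 * fls_shift (- int k) 1) = (2 * fls_shift (- int (Suc k)) 1 :: gen cpoly fls)"
      by (simp only: mult_2 distrib_left fls_X_times_conv_shift fls_shift_fls_shift) (simp add: algebra_simps)
    then show ?thesis
      by (cases k) (simp_all add: Suc kernel_prod_def left_diff_distrib mult.assoc fls_X_conv_shift_1)
  qed (simp add: kernel_prod_def left_diff_distrib mult.assoc fls_X_conv_shift_1)
qed

definition G_lambda :: "nat \<Rightarrow> nat \<Rightarrow> gen cpoly fls fps" where
  "G_lambda i j = Abs_fps (\<lambda>k. fls_const (G_coeff k i j))"

definition G_mu :: "nat \<Rightarrow> nat \<Rightarrow> gen cpoly fls fps" where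
  "G_mu i j = fps_const (fps_to_fls (Abs_fps (\<lambda>k. G_coeff k i j)))"

definition eps :: "nat \<Rightarrow> nat \<Rightarrow> gen cpoly fls fps" where
  "eps a b = of_int (sgn (int a - int b))"

text \<open>The generating series \<open>{G(\<lambda>)\<^sub>j\<^sub>,\<^sub>i, G(\<mu>)\<^sub>q\<^sub>,\<^sub>l}\<close>.\<close>

definition bracket_series :: "nat \<Rightarrow> nat \<Rightarrow> nat \<Rightarrow> nat \<Rightarrow> gen cpoly fls fps" where
  "bracket_series j i q l =
     (eps j q - kernel_minus) * G_lambda q i * G_mu j l
   + (eps i l + kernel_minus) * G_mu q i * G_lambda j l
   + (eps i q - kernel_prod) * G_lambda j q * G_mu i l
   + (eps j l + kernel_prod) * G_lambda l i * G_mu q j"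

fun gen_bracket :: "gen \<Rightarrow> gen \<Rightarrow> gen cpoly" where
  "gen_bracket (r, j, i) (s, q, l) = fls_nth (fps_nth (bracket_series j i q l) r) (int s)"

definition D_bracket :: "gen cpoly \<Rightarrow> gen cpoly \<Rightarrow> gen cpoly" where
  "D_bracket = biderivation gen_bracket"


section \<open>The level-\<open>p\<close> reduction\<close>

text \<open>The relations \<open>G\<^sup>(\<^sup>k\<^sup>+\<^sup>p\<^sup>)\<^sub>i\<^sub>,\<^sub>j = G\<^sup>(\<^sup>k\<^sup>)\<^sub>i\<^sub>,\<^sub>j\<close>, together with \<open>G\<^sup>(\<^sup>-\<^sup>k\<^sup>)\<^sub>j\<^sub>,\<^sub>i = G\<^sup>(\<^sup>k\<^sup>)\<^sub>i\<^sub>,\<^sub>j\<close>, identify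
  \<open>G\<^sup>(\<^sup>k\<^sup>)\<^sub>i\<^sub>,\<^sub>j\<close> with \<open>G\<^sup>(\<^sup>p\<^sup>-\<^sup>k\<^sup>)\<^sub>j\<^sub>,\<^sub>i\<close>. One generator is kept from each class: the one with
  \<open>k < p - k\<close>, or with \<open>i \<le> j\<close> if \<open>k = p - k\<close>; at level \<open>0\<close>, where \<open>G\<^sup>(\<^sup>0\<^sup>)\<close> is the symmetric matrix
  with \<open>2\<close> on the diagonal, the one with \<open>i < j\<close>.\<close>

definition gens_red :: "nat \<Rightarrow> nat \<Rightarrow> gen set" where
  "gens_red n p = {(0, i, j) | i j. i < j \<and> j < n}
     \<union> {(k, i, j) | k i j. 1 \<le> k \<and> i < n \<and> j < n \<and> (2 * k < p \<or> (2 * k = p \<and> i \<le> j))}"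

definition Dp_alg :: "nat \<Rightarrow> nat \<Rightarrow> gen cpoly set" where
  "Dp_alg n p = poly_alg (gens_red n p)"

fun red_gen :: "nat \<Rightarrow> gen \<Rightarrow> gen cpoly" where
  "red_gen p (k, i, j) = (let r = k mod p in
     if r = 0 then (if i = j then 2 else Var (0, min i j, max i j))
     else if 2 * r < p \<or> (2 * r = p \<and> i \<le> j) then Var (r, i, j)
     else Var (p - r, j, i))"

definition red :: "nat \<Rightarrow> gen cpoly \<Rightarrow> gen cpoly" where
  "red p = subst (red_gen p)"

lemma red_gen_periodic: "red_gen p (k + p, i, j) = red_gen p (k, i, j)"
  by simp

lemma red_gen_transpose:
  assumes "k \<le> p"
  shows "red_gen p (k, i, j) = red_gen p (p - k, j, i)"
proof (cases "k = 0 \<or> k = p")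
  case True
  then show ?thesis by (auto simp: min.commute max.commute)
next
  case False
  with assms have "k mod p = k" "(p - k) mod p = p - k" by auto
  with False assms show ?thesis by (auto simp: Let_def)
qed

lemma gens_red_subset: "gens_red n p \<subseteq> gens n"
  by (auto simp: gens_red_def gens_def)

lemma red_gen_fixes: "x \<in> gens_red n p \<Longrightarrow> red_gen p x = Var x"
  by (auto simp: gens_red_def Let_def)

text \<open>The bracket induced on the reduced algebra: the relations generate a Poisson ideal, so the bracket
  of two generators is the reduction of the bracket of representatives.\<close>

definition Dp_bracket :: "nat \<Rightarrow> gen cpoly \<Rightarrow> gen cpoly \<Rightarrow> gen cpoly" where
  "Dp_bracket p = biderivation (\<lambda>x y. red p (D_bracket (Var x) (Var y)))"


section \<open>Matrices over Laurent series in \<open>\<lambda>\<^sup>-\<^sup>1\<close>\<close>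

text \<open>From here on \<open>fls_X\<close> is \<open>\<lambda>\<^sup>-\<^sup>1\<close> and \<open>fls_X_inv\<close> is \<open>\<lambda>\<close>.\<close>

definition G_mat :: "nat \<Rightarrow> gen cpoly fls mat" where
  "G_mat n = mat n n (\<lambda>(i, j). fps_to_fls (Abs_fps (\<lambda>k. G_coeff k i j)))"

definition Gp_mat :: "nat \<Rightarrow> nat \<Rightarrow> gen cpoly fls mat" where
  "Gp_mat n p = mat n n (\<lambda>(i, j).
     fls_const (A0 i j) + (\<Sum>k=1..<p. fls_const (red p (Var (k, i, j))) * fls_X ^ k)
       + fls_const (A0 j i) * fls_X ^ p)"

text \<open>\<open>braid_mat n i g\<close> is \<open>B\<^sub>i\<^sub>,\<^sub>i\<^sub>+\<^sub>1\<close> with \<open>g\<close> in place of \<open>G\<^sup>(\<^sup>0\<^sup>)\<^sub>i\<^sub>,\<^sub>i\<^sub>+\<^sub>1\<close>, and \<open>braid_mat_last n g l l'\<close> is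
  \<open>B\<^sub>n\<^sub>,\<^sub>1\<close> at the point \<open>l\<close> with inverse \<open>l'\<close>, with \<open>g\<close> in place of \<open>G\<^sup>(\<^sup>1\<^sup>)\<^sub>n\<^sub>,\<^sub>1\<close>.\<close>

definition braid_mat :: "nat \<Rightarrow> nat \<Rightarrow> gen cpoly \<Rightarrow> gen cpoly fls mat" where
  "braid_mat n i g = mat n n (\<lambda>(a, b).
     if a = i \<and> b = i then fls_const g
     else if a = i \<and> b = Suc i then - 1
     else if a = Suc i \<and> b = i then 1
     else if a = Suc i \<and> b = Suc i then 0
     else if a = b then 1 else 0)"

definition braid_mat_last ::
  "nat \<Rightarrow> gen cpoly \<Rightarrow> gen cpoly fls \<Rightarrow> gen cpoly fls \<Rightarrow> gen cpoly fls mat" where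
  "braid_mat_last n g l l' = mat n n (\<lambda>(a, b).
     if a = 0 \<and> b = n - 1 then l
     else if a = n - 1 \<and> b = 0 then - l'
     else if a = n - 1 \<and> b = n - 1 then fls_const g
     else if a = b \<and> 0 < a then 1 else 0)"

text \<open>The algebra endomorphism of \<open>D_alg n\<close> sending each generator to the corresponding coefficient
  of a matrix \<open>M(\<lambda>)\<close>.\<close>

definition coeff_hom :: "gen cpoly fls mat \<Rightarrow> gen cpoly \<Rightarrow> gen cpoly" where
  "coeff_hom M = subst (\<lambda>(k, i, j). fls_nth (index_mat M (i, j)) (int k))"

definition braid :: "nat \<Rightarrow> nat \<Rightarrow> gen cpoly \<Rightarrow> gen cpoly" where
  "braid n i = (let B = braid_mat n i (Var (0, i, Suc i))
     in coeff_hom (B * G_mat n * transpose_mat B))"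

definition braid_last :: "nat \<Rightarrow> gen cpoly \<Rightarrow> gen cpoly" where
  "braid_last n = (let g = Var (1, n - 1, 0)
     in coeff_hom (braid_mat_last n g fls_X_inv fls_X * G_mat n *
          transpose_mat (braid_mat_last n g fls_X fls_X_inv)))"

definition acts_as :: "(gen cpoly \<Rightarrow> gen cpoly) \<Rightarrow> nat \<Rightarrow> gen cpoly fls mat \<Rightarrow> gen cpoly fls mat \<Rightarrow> bool"
  where "acts_as \<phi> n M N \<longleftrightarrow> (\<forall>i<n. \<forall>j<n. \<forall>k.
     \<phi> (fls_nth (index_mat M (i, j)) k) = fls_nth (index_mat N (i, j)) k)"

text \<open>\<open>\<phi>\<close> is the endomorphism of the reduced algebra induced by \<open>\<beta>\<close>.\<close>

definition induced_on_reduction ::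
  "nat \<Rightarrow> nat \<Rightarrow> (gen cpoly \<Rightarrow> gen cpoly) \<Rightarrow> (gen cpoly \<Rightarrow> gen cpoly) \<Rightarrow> bool" where
  "induced_on_reduction n p \<beta> \<phi> \<longleftrightarrow>
     alg_hom (Dp_alg n p) (Dp_alg n p) \<phi> \<and> (\<forall>f\<in>D_alg n. \<phi> (red p f) = red p (\<beta> f))"

text \<open>The coefficient of \<open>\<lambda>\<^sup>-\<^sup>k\<close> in \<open>det G\<^sub>p(\<lambda>)\<close>.\<close>

definition det_coeff :: "nat \<Rightarrow> nat \<Rightarrow> nat \<Rightarrow> gen cpoly" where
  "det_coeff n p k = fls_nth (det (Gp_mat n p)) (int k)"

end

theory Submission
  imports
    Defs
    "HOL-Library.FuncSet"
    "HOL-Computational_Algebra.Fundamental_Theorem_Algebra"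
    "HOL-Computational_Algebra.Polynomial_FPS"
begin

text \<open>\<^bold>\<open>Braid group.\<close> Multiplication by \<open>1 - \<lambda>\<^sup>-\<^sup>p\<close> turns the reduction of \<open>G(\<lambda>)\<close> into \<open>G\<^sub>p(\<lambda>)\<close>, so
  conjugation of the one is conjugation of the other, and the conjugate of \<open>G\<^sub>p\<close> satisfies the
  relations again.

  \<^bold>\<open>Centrality.\<close> The bracket with a fixed generator is a derivation. Applied to the determinant of
  the reduction of \<open>G(\<lambda>)\<close>, the four terms of the bracket contract with the cofactors to multiples of
  the determinant, and these cancel in pairs.

  \<^bold>\<open>Independence.\<close> A matrix that is diagonal (\<open>p\<close> even) or made of \<open>2 \<times> 2\<close> blocks (\<open>p\<close> odd), with
  palindromic polynomials on the diagonal, can be chosen such that the first \<open>\<lfloor>n p / 2\<rfloor>\<close>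
  coefficients of the determinant take arbitrary values.

  \<^bold>\<open>Upper bound.\<close> On the reduced algebra, the generator \<open>G\<^sup>(\<^sup>k\<^sup>)\<^sub>i\<^sub>,\<^sub>j\<close> is a chord from \<open>i\<close> to \<open>j +
  n k\<close> of a circle with \<open>n p\<close> points, and the bracket is quadratic with coefficients that count
  crossings of chords. At a point where exactly the chords joining (almost) antipodal points do not
  vanish, the Poisson tensor is nondegenerate transversally to a coordinate slice of dimension \<open>\<lfloor>n p
  / 2\<rfloor>\<close>. By comparing Taylor coefficients of lowest order, a central element that vanishes on this
  slice is zero, so independent central elements stay independent as polynomials in \<open>\<lfloor>n p / 2\<rfloor>\<close>
  variables.\<close>

section \<open>Polynomials\<close>

text \<open>Lifting \<open>i\<close> at level \<open>k\<close> to the integer \<open>i + n k\<close>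
  turns the generators into a symmetric matrix with 2 on the diagonal. There, the truncation of
  \<open>G(\<lambda>)\<close> to nonnegative levels and the triangular shape of its constant term
  become one and the same Heaviside factor; this is why the four terms of the bracket combine into
  crossing numbers. The parity of \<open>p\<close> is the obstacle. For \<open>p\<close> odd,
  antipodal points have different residues modulo \<open>n\<close>, or do not exist at all, so
  residues are paired as \<open>i\<close>, \<open>i + h\<close> with \<open>h = n div 2\<close>.
  Likewise a palindromic polynomial of odd degree vanishes at -1, so diagonal matrices would only
  give determinants divisible by \<open>(1 + z)^n\<close>; off-diagonal entries remove this
  restriction. The rank is examined at a single point, because the lowest-order Taylor term of a
  central element there sees only the value of the Poisson tensor at that point. The nonzero
  coordinates of the point differ between residues (or pairs of residues), so that two Hamiltonian
  vectors, each mixing a chord with its opposite one, can be combined to separate the two.\<close>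

locale coef_hom =
  fixes h :: "complex \<Rightarrow> 'r :: comm_ring_1"
  assumes h_0: "h 0 = 0" and h_1: "h 1 = 1"
    and h_add: "h (a + b) = h a + h b" and h_mult: "h (a * b) = h a * h b"

text \<open>One evaluation map for several targets: \<open>Cst\<close> gives substitution, the
  identity gives values at points, constant polynomials give restriction to a line.\<close>

definition insertion :: "(complex \<Rightarrow> 'r :: comm_ring_1) \<Rightarrow> ('v \<Rightarrow> 'r) \<Rightarrow> 'v cpoly \<Rightarrow> 'r" where
  "insertion h \<sigma> f = (\<Sum>m\<in>Poly_Mapping.keys f. h (Poly_Mapping.lookup f m) *
     (\<Prod>x\<in>Poly_Mapping.keys m. \<sigma> x ^ Poly_Mapping.lookup m x))"

lemma Cst_simps [simp]:
  "Cst 0 = 0" "Cst 1 = 1" "Cst (a + b) = Cst a + Cst b" "Cst (a * b) = Cst a * Cst b"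
  "Cst (- a) = - Cst a" "Cst (a - b) = Cst a - Cst b"
  by (simp_all add: Cst_def single_add mult_single single_uminus single_diff)

lemma Cst_numeral [simp]: "Cst (numeral w) = numeral w"
  by (simp add: Cst_def)

lemma Cst_of_nat [simp]: "Cst (of_nat k) = of_nat k"
  by (induction k) simp_all

lemma Cst_of_int [simp]: "Cst (of_int k) = of_int k"
  by (cases k) simp_all

interpretation Cst: coef_hom "Cst :: complex \<Rightarrow> 'v cpoly"
  by unfold_locales simp_all

interpretation ident: coef_hom "\<lambda>c::complex. c"
  by unfold_locales simp_all

lemma subst_conv_insertion: "subst = insertion Cst"
  by (intro ext) (simp add: subst_def insertion_def)

context coef_hom begin

lemma insertion_superset:
  assumes "finite A" "Poly_Mapping.keys f \<subseteq> A"
  shows "insertion h \<sigma> f = (\<Sum>m\<in>A. h (Poly_Mapping.lookup f m) *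
     (\<Prod>x\<in>Poly_Mapping.keys m. \<sigma> x ^ Poly_Mapping.lookup m x))"
  unfolding insertion_def using assms
  by (intro sum.mono_neutral_left) (auto simp: h_0 in_keys_iff)

lemma insertion_add: "insertion h \<sigma> (f + g) = insertion h \<sigma> f + insertion h \<sigma> g"
proof -
  let ?A = "Poly_Mapping.keys f \<union> Poly_Mapping.keys g"
  have "Poly_Mapping.keys (f + g) \<subseteq> ?A" by (rule keys_add)
  then show ?thesis
    by (simp add: insertion_superset[of ?A] lookup_add h_add algebra_simps sum.distrib)
qed

lemma insertion_0: "insertion h \<sigma> 0 = 0"
  by (simp add: insertion_def)

lemma insertion_uminus: "insertion h \<sigma> (- f) = - insertion h \<sigma> f"
  using insertion_add[of \<sigma> f "- f"] by (simp add: insertion_0 eq_neg_iff_add_eq_0 add.commute)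

lemma insertion_diff: "insertion h \<sigma> (f - g) = insertion h \<sigma> f - insertion h \<sigma> g"
  using insertion_add[of \<sigma> f "- g"] by (simp add: insertion_uminus)

lemma insertion_sum: "insertion h \<sigma> (sum F A) = (\<Sum>x\<in>A. insertion h \<sigma> (F x))"
  by (induction A rule: infinite_finite_induct) (simp_all add: insertion_0 insertion_add)

lemma insertion_Cst: "insertion h \<sigma> (Cst a) = h a"
  by (cases "a = 0") (simp_all add: insertion_def Cst_def h_0)

lemma insertion_1: "insertion h \<sigma> 1 = 1"
  using insertion_Cst[of \<sigma> 1] by (simp add: h_1)

lemma insertion_Var: "insertion h \<sigma> (Var x) = \<sigma> x"
  by (simp add: insertion_def Var_def h_1)

lemma insertion_single:
  "insertion h \<sigma> (Poly_Mapping.single m a) =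
     h a * (\<Prod>x\<in>Poly_Mapping.keys m. \<sigma> x ^ Poly_Mapping.lookup m x)"
  by (cases "a = 0") (simp_all add: insertion_def h_0)

end

lemma sum_single_keys:
  "(\<Sum>m\<in>Poly_Mapping.keys f. Poly_Mapping.single m (Poly_Mapping.lookup f m)) = f"
  by (rule poly_mapping_eqI)
     (auto simp: lookup_sum lookup_single when_def in_keys_iff sum.If_cases Int_def)

lemma sum_single_induct [case_names zero single add]:
  assumes "P 0" "\<And>m a. P (Poly_Mapping.single m a)" "\<And>f g. P f \<Longrightarrow> P g \<Longrightarrow> P (f + g)"
  shows "P (f :: 'a \<Rightarrow>\<^sub>0 'b :: comm_monoid_add)"
proof -
  have "P (\<Sum>m\<in>A. Poly_Mapping.single m (Poly_Mapping.lookup f m))" for A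
    by (induction A rule: infinite_finite_induct) (auto intro: assms)
  then show ?thesis by (metis sum_single_keys)
qed

lemma prod_pow_superset:
  fixes \<sigma> :: "'v \<Rightarrow> 'r :: comm_monoid_mult"
  assumes "finite A" "Poly_Mapping.keys m \<subseteq> A"
  shows "(\<Prod>x\<in>Poly_Mapping.keys m. \<sigma> x ^ Poly_Mapping.lookup m x) =
     (\<Prod>x\<in>A. \<sigma> x ^ Poly_Mapping.lookup m x)"
  using assms by (intro prod.mono_neutral_left) (auto simp: in_keys_iff)

lemma prod_pow_add:
  fixes \<sigma> :: "'v \<Rightarrow> 'r :: comm_monoid_mult"
  shows "(\<Prod>x\<in>Poly_Mapping.keys (m + m'). \<sigma> x ^ Poly_Mapping.lookup (m + m') x) =
    (\<Prod>x\<in>Poly_Mapping.keys m. \<sigma> x ^ Poly_Mapping.lookup m x) *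
    (\<Prod>x\<in>Poly_Mapping.keys m'. \<sigma> x ^ Poly_Mapping.lookup m' x)"
proof -
  let ?A = "Poly_Mapping.keys m \<union> Poly_Mapping.keys m'"
  have "Poly_Mapping.keys (m + m') \<subseteq> ?A" by (rule keys_add)
  note this [THEN prod_pow_superset [rotated], of \<sigma>]
    and prod_pow_superset[of ?A m \<sigma>] and prod_pow_superset[of ?A m' \<sigma>]
  then show ?thesis by (simp add: lookup_add power_add prod.distrib)
qed

context coef_hom begin

lemma insertion_mult: "insertion h \<sigma> (f * g) = insertion h \<sigma> f * insertion h \<sigma> g"
proof (induction f rule: sum_single_induct)
  case (single m a)
  show ?case
    by (induction g rule: sum_single_induct)
       (simp_all add: insertion_0 insertion_add insertion_single mult_single prod_pow_add
          h_mult distrib_left mult.assoc mult.left_commute)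
qed (simp_all add: insertion_0 insertion_add distrib_right)

lemma insertion_power: "insertion h \<sigma> (f ^ k) = insertion h \<sigma> f ^ k"
  by (induction k) (simp_all add: insertion_1 insertion_mult)

lemmas insertion_simps = insertion_0 insertion_1 insertion_add insertion_uminus insertion_diff
  insertion_mult insertion_Cst insertion_Var insertion_power

end

lemmas insertion_ring_hom [simp] = Cst.insertion_simps ident.insertion_simps

section \<open>Subalgebras of polynomials in given variables\<close>

lemma vars_0 [simp]: "vars 0 = {}" and vars_Cst [simp]: "vars (Cst a) = {}"
  and vars_Var [simp]: "vars (Var x) = {x}"
  by (auto simp: vars_def Cst_def Var_def)

lemma finite_vars [simp]: "finite (vars f)"
  by (simp add: vars_def)

lemma poly_alg_Cst [simp]: "Cst a \<in> poly_alg X"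
  by (simp add: poly_alg_def)

lemma poly_alg_0 [simp]: "0 \<in> poly_alg X"
  by (simp add: poly_alg_def)

lemma poly_alg_1 [simp]: "1 \<in> poly_alg X"
  using poly_alg_Cst[of 1 X] by simp

lemma poly_alg_numeral [simp]: "numeral w \<in> poly_alg X"
  using poly_alg_Cst[of "numeral w" X] by simp

lemma poly_alg_Var [simp]: "Var x \<in> poly_alg X \<longleftrightarrow> x \<in> X"
  by (simp add: poly_alg_def)

lemma poly_alg_iff: "f \<in> poly_alg X \<longleftrightarrow> (\<forall>m\<in>Poly_Mapping.keys f. Poly_Mapping.keys m \<subseteq> X)"
  by (auto simp: poly_alg_def vars_def)

lemma poly_alg_add: "f \<in> poly_alg X \<Longrightarrow> g \<in> poly_alg X \<Longrightarrow> f + g \<in> poly_alg X"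
  using keys_add[of f g] unfolding poly_alg_iff by blast

lemma poly_alg_sum: "(\<And>i. i \<in> I \<Longrightarrow> F i \<in> poly_alg X) \<Longrightarrow> sum F I \<in> poly_alg X"
  by (induction I rule: infinite_finite_induct) (auto intro: poly_alg_add)

lemma poly_alg_mult: "f \<in> poly_alg X \<Longrightarrow> g \<in> poly_alg X \<Longrightarrow> f * g \<in> poly_alg X"
proof -
  assume f: "f \<in> poly_alg X" and g: "g \<in> poly_alg X"
  have "Poly_Mapping.keys m \<subseteq> X" if m: "m \<in> Poly_Mapping.keys (f * g)" for m
  proof -
    obtain a b where ab: "m = a + b" "a \<in> Poly_Mapping.keys f" "b \<in> Poly_Mapping.keys g"
      using m keys_mult[of f g] by blast
    then show ?thesis using f g keys_add[of a b] unfolding poly_alg_iff by blast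
  qed
  then show ?thesis by (simp add: poly_alg_iff)
qed

lemma poly_alg_power: "f \<in> poly_alg X \<Longrightarrow> f ^ k \<in> poly_alg X"
  by (induction k) (auto intro: poly_alg_mult)

lemma poly_alg_prod: "(\<And>i. i \<in> I \<Longrightarrow> F i \<in> poly_alg X) \<Longrightarrow> prod F I \<in> poly_alg X"
  by (induction I rule: infinite_finite_induct) (auto intro: poly_alg_mult)

lemma poly_alg_uminus: "f \<in> poly_alg X \<Longrightarrow> - f \<in> poly_alg X"
  using poly_alg_mult[OF poly_alg_Cst[of "-1" X], of f] by simp

lemma poly_alg_mono: "f \<in> poly_alg X \<Longrightarrow> X \<subseteq> Y \<Longrightarrow> f \<in> poly_alg Y"
  by (auto simp: poly_alg_def)

lemma monomial_conv_prod:
  "Poly_Mapping.single m 1 = (\<Prod>x\<in>Poly_Mapping.keys m. Var x ^ Poly_Mapping.lookup m x)"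
proof (induction m rule: sum_single_induct)
  case (single x k)
  have "Var x ^ k = Poly_Mapping.single (Poly_Mapping.single x k) 1"
    by (induction k) (simp_all add: Var_def mult_single single_add [symmetric])
  then show ?case by (cases "k = 0") simp_all
next
  case (add f g)
  have "Poly_Mapping.single (f + g) (1::complex) = Poly_Mapping.single f 1 * Poly_Mapping.single g 1"
    by (simp add: mult_single)
  then show ?case by (simp only: prod_pow_add add)
qed simp

lemma poly_conv_sum:
  "f = (\<Sum>m\<in>Poly_Mapping.keys f. Cst (Poly_Mapping.lookup f m) *
     (\<Prod>x\<in>Poly_Mapping.keys m. Var x ^ Poly_Mapping.lookup m x))"
  by (simp add: mult_single Cst_def sum_single_keys flip: monomial_conv_prod)

lemma poly_alg_induct [consumes 1, case_names Cst Var add mult]: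
  assumes "f \<in> poly_alg X"
    and Cst: "\<And>a. P (Cst a)" and Var: "\<And>x. x \<in> X \<Longrightarrow> P (Var x)"
    and add: "\<And>f g. f \<in> poly_alg X \<Longrightarrow> g \<in> poly_alg X \<Longrightarrow> P f \<Longrightarrow> P g \<Longrightarrow> P (f + g)"
    and mult: "\<And>f g. f \<in> poly_alg X \<Longrightarrow> g \<in> poly_alg X \<Longrightarrow> P f \<Longrightarrow> P g \<Longrightarrow> P (f * g)"
  shows "P f"
proof -
  define Q where "Q f \<longleftrightarrow> f \<in> poly_alg X \<and> P f" for f
  have Q_mult: "Q (f * g)" if "Q f" "Q g" for f g
    using that mult poly_alg_mult by (auto simp: Q_def)
  have Q_add: "Q (f + g)" if "Q f" "Q g" for f g
    using that add poly_alg_add by (auto simp: Q_def)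
  have Q_Var: "Q (Var x)" if "x \<in> X" for x using that Var by (simp add: Q_def)
  have Q_Cst: "Q (Cst a)" for a using Cst by (simp add: Q_def)
  have Q_pow: "Q (f ^ k)" if "Q f" for f k
    by (induction k) (use Q_Cst[of 1] that in \<open>simp_all add: Q_mult\<close>)
  have Q_prod: "Q (prod F A)" if "\<And>x. x \<in> A \<Longrightarrow> Q (F x)" for F and A :: "'a set"
    using that by (induction A rule: infinite_finite_induct)
      (use Q_Cst[of 1] in \<open>simp_all add: Q_mult\<close>)
  have Q_sum: "Q (sum F A)" if "\<And>x. x \<in> A \<Longrightarrow> Q (F x)" for F and A :: "('a \<Rightarrow>\<^sub>0 nat) set"
    using that by (induction A rule: infinite_finite_induct)
      (use Q_Cst[of 0] in \<open>simp_all add: Q_add\<close>)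
  have "Q f"
    using assms(1)
    by (subst poly_conv_sum, intro Q_sum Q_mult Q_Cst Q_prod Q_pow Q_Var)
       (auto simp: poly_alg_iff)
  then show ?thesis by (simp add: Q_def)
qed

lemma poly_alg_UNIV [simp]: "poly_alg UNIV = UNIV"
  by (simp add: poly_alg_def)

lemmas cpoly_induct [case_names Cst Var add mult] =
  poly_alg_induct [where X = UNIV, simplified]

lemma subst_in_poly_alg:
  assumes "f \<in> poly_alg X" "\<And>x. x \<in> X \<Longrightarrow> \<sigma> x \<in> poly_alg Y"
  shows "subst \<sigma> f \<in> poly_alg Y"
  unfolding subst_conv_insertion using assms(1)
  by (induction rule: poly_alg_induct) (use assms(2) in \<open>auto intro: poly_alg_add poly_alg_mult\<close>)

text \<open>Uniqueness in the universal property of polynomial rings; it serves to compose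
  evaluations with substitutions and other homomorphisms.\<close>

lemma ring_hom_insertion:
  assumes "coef_hom h" "coef_hom h'" "f \<in> poly_alg X"
    and "\<And>f g. \<phi> (f + g) = \<phi> f + \<phi> g" "\<And>f g. \<phi> (f * g) = \<phi> f * \<phi> g"
    and "\<And>c. \<phi> (h c) = h' c" "\<And>x. x \<in> X \<Longrightarrow> \<phi> (\<sigma> x) = \<tau> x"
  shows "\<phi> (insertion h \<sigma> f) = insertion h' \<tau> f"
  using assms(3) by (induction rule: poly_alg_induct)
    (simp_all add: assms coef_hom.insertion_simps[OF assms(1)] coef_hom.insertion_simps[OF assms(2)])

lemma insertion_cong:
  assumes "coef_hom h" "f \<in> poly_alg X" "\<And>x. x \<in> X \<Longrightarrow> \<sigma> x = \<tau> x"
  shows "insertion h \<sigma> f = insertion h \<tau> f"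
  using ring_hom_insertion[OF assms(1,1,2), of "\<lambda>x. x" \<sigma> \<tau>] assms(3) by simp

section \<open>Partial derivatives, derivations and the center\<close>

lemma pdiff_superset:
  assumes "finite A" "Poly_Mapping.keys f \<subseteq> A"
  shows "pdiff x f = (\<Sum>m\<in>A. Poly_Mapping.single (m - Poly_Mapping.single x 1)
       (of_nat (Poly_Mapping.lookup m x) * Poly_Mapping.lookup f m))"
  unfolding pdiff_def using assms
  by (intro sum.mono_neutral_left) (auto simp: in_keys_iff)

lemma pdiff_0 [simp]: "pdiff x 0 = 0"
  by (simp add: pdiff_def)

lemma pdiff_add [simp]: "pdiff x (f + g) = pdiff x f + pdiff x g"
proof -
  let ?A = "Poly_Mapping.keys f \<union> Poly_Mapping.keys g"
  have "Poly_Mapping.keys (f + g) \<subseteq> ?A" by (rule keys_add)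
  then show ?thesis
    by (simp add: pdiff_superset[of ?A] lookup_add distrib_left single_add sum.distrib
        del: One_nat_def)
qed

lemma pdiff_single:
  "pdiff x (Poly_Mapping.single m a) =
     Poly_Mapping.single (m - Poly_Mapping.single x 1) (of_nat (Poly_Mapping.lookup m x) * a)"
  by (cases "a = 0") (simp_all add: pdiff_def)

lemma pdiff_notin: "x \<notin> vars f \<Longrightarrow> pdiff x f = 0"
  unfolding pdiff_def vars_def by (intro sum.neutral) (auto simp: in_keys_iff)

lemma pdiff_Cst [simp]: "pdiff x (Cst a) = 0"
  by (rule pdiff_notin) simp

lemma pdiff_1 [simp]: "pdiff x 1 = 0"
  using pdiff_Cst[of x 1] by simp

lemma pdiff_Var: "pdiff x (Var y) = (if x = y then 1 else 0)"
  by (simp add: Var_def pdiff_single lookup_single when_def)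

lemma pdiff_mult [simp]: "pdiff x (f * g) = pdiff x f * g + f * pdiff x g"
proof (induction f rule: sum_single_induct)
  case (single m a)
  let ?e = "Poly_Mapping.single x (1::nat)"
  have shift: "m + k - ?e = (m - ?e) + k" if "Poly_Mapping.lookup m x \<noteq> 0" for m k
    using that by (intro poly_mapping_eqI) (auto simp: lookup_add lookup_minus lookup_single when_def)
  show ?case
  proof (induction g rule: sum_single_induct)
    case (single k b)
    let ?c = "complex_of_nat (Poly_Mapping.lookup m x)" and ?d = "complex_of_nat (Poly_Mapping.lookup k x)"
    have "Poly_Mapping.single (m + k - ?e) (?c * (a * b)) = Poly_Mapping.single (m - ?e + k) (?c * a * b)"
      using shift[of m k] by (cases "?c = 0") (simp_all add: mult.assoc)
    moreover have "Poly_Mapping.single (m + k - ?e) (?d * (a * b)) = Poly_Mapping.single (m + (k - ?e)) (a * (?d * b))"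
      using shift[of k m] by (cases "?d = 0") (simp_all add: add.commute mult.left_commute)
    ultimately show ?case
      by (simp only: pdiff_single mult_single lookup_add of_nat_add distrib_right single_add)
  qed (simp_all add: distrib_left)
qed (simp_all add: distrib_right)

lemma pdiff_sum [simp]: "pdiff x (sum F A) = (\<Sum>i\<in>A. pdiff x (F i))"
  by (induction A rule: infinite_finite_induct) simp_all

text \<open>For \<open>v x = \<gamma> x y\<close> this is the bracket with the variable
  \<open>y\<close>. Summing over a fixed set \<open>X\<close> instead of \<open>vars f\<close> makes
  it additive without side conditions.\<close>

definition vder :: "'v set \<Rightarrow> ('v \<Rightarrow> 'v cpoly) \<Rightarrow> 'v cpoly \<Rightarrow> 'v cpoly" where
  "vder X v f = (\<Sum>x\<in>X. pdiff x f * v x)"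

lemma vder_add: "vder X v (f + g) = vder X v f + vder X v g"
  by (simp add: vder_def distrib_right sum.distrib)

lemma vder_0 [simp]: "vder X v 0 = 0"
  and vder_1 [simp]: "vder X v 1 = 0"
  and vder_Cst [simp]: "vder X v (Cst a) = 0"
  by (simp_all add: vder_def)

lemma vder_mult: "vder X v (f * g) = vder X v f * g + f * vder X v g"
  by (simp add: vder_def distrib_right distrib_left sum.distrib sum_distrib_left sum_distrib_right
      ac_simps)

lemma vder_Var: "finite X \<Longrightarrow> x \<in> X \<Longrightarrow> vder X v (Var x) = v x"
  by (simp add: vder_def pdiff_Var if_distrib if_distribR cong: if_cong)

lemma biderivation_conv_vder:
  assumes "finite X" "f \<in> poly_alg X" "g \<in> poly_alg X"
  shows "biderivation \<gamma> f g = (\<Sum>y\<in>X. pdiff y g * vder X (\<lambda>x. \<gamma> x y) f)"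
proof -
  have "biderivation \<gamma> f g = (\<Sum>x\<in>vars f. \<Sum>y\<in>X. pdiff x f * pdiff y g * \<gamma> x y)"
    unfolding biderivation_def using assms
    by (intro sum.cong refl sum.mono_neutral_left) (auto simp: poly_alg_def pdiff_notin)
  also have "\<dots> = (\<Sum>x\<in>X. \<Sum>y\<in>X. pdiff x f * pdiff y g * \<gamma> x y)"
    using assms by (intro sum.mono_neutral_left) (auto simp: poly_alg_def pdiff_notin)
  also have "\<dots> = (\<Sum>y\<in>X. \<Sum>x\<in>X. pdiff x f * pdiff y g * \<gamma> x y)"
    by (rule sum.swap)
  also have "\<dots> = (\<Sum>y\<in>X. pdiff y g * vder X (\<lambda>x. \<gamma> x y) f)"
    by (simp add: vder_def sum_distrib_left ac_simps)
  finally show ?thesis .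
qed

text \<open>By the Leibniz rule in the second argument, brackets with the generators decide
  centrality.\<close>

lemma center_biderivation_iff:
  assumes "finite X"
  shows "f \<in> center (biderivation \<gamma>) (poly_alg X) \<longleftrightarrow>
    f \<in> poly_alg X \<and> (\<forall>y\<in>X. vder X (\<lambda>x. \<gamma> x y) f = 0)"
proof (intro iffI conjI ballI)
  fix y assume f: "f \<in> center (biderivation \<gamma>) (poly_alg X)" and y: "y \<in> X"
  then have "biderivation \<gamma> f (Var y) = 0" and fX: "f \<in> poly_alg X" by (auto simp: center_def)
  then show "vder X (\<lambda>x. \<gamma> x y) f = 0"
    using assms y by (simp add: biderivation_conv_vder pdiff_Var if_distrib if_distribR cong: if_cong)
qed (use assms in \<open>auto simp: center_def biderivation_conv_vder\<close>)

lemma center_subst: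
  assumes "finite X" and P: "P \<in> poly_alg I"
    and \<sigma>: "\<And>i. i \<in> I \<Longrightarrow> \<sigma> i \<in> center (biderivation \<gamma>) (poly_alg X)"
  shows "subst \<sigma> P \<in> center (biderivation \<gamma>) (poly_alg X)"
  unfolding subst_conv_insertion using P
  by (induction rule: poly_alg_induct)
     (use \<sigma> assms(1) in \<open>auto simp: center_biderivation_iff vder_add vder_mult
       intro: poly_alg_add poly_alg_mult\<close>)

section \<open>Point evaluation and Taylor coefficients\<close>

abbreviation peval :: "('v \<Rightarrow> complex) \<Rightarrow> 'v cpoly \<Rightarrow> complex" where
  "peval \<equiv> insertion (\<lambda>c. c)"

lemma pdiff_commute: "pdiff x (pdiff y f) = pdiff y (pdiff x f)"
  by (induction f rule: cpoly_induct) (auto simp: pdiff_Var algebra_simps)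

lemma foldr_pdiff_commute: "foldr pdiff xs (pdiff x f) = pdiff x (foldr pdiff xs f)"
  by (induction xs) (simp_all add: pdiff_commute)

lemma foldr_pdiff_add: "foldr pdiff xs (f + g) = foldr pdiff xs f + foldr pdiff xs g"
  by (induction xs) simp_all

lemma foldr_pdiff_0 [simp]: "foldr pdiff xs 0 = 0"
  by (induction xs) simp_all

lemma foldr_pdiff_sum: "foldr pdiff xs (sum F A) = (\<Sum>i\<in>A. foldr pdiff xs (F i))"
  by (induction xs) simp_all

lemma foldr_pdiff_remove1:
  "x \<in> set xs \<Longrightarrow> foldr pdiff xs f = foldr pdiff (remove1 x xs @ [x]) f"
  by (induction xs) (auto simp: foldr_pdiff_commute pdiff_commute)

lemma foldr_pdiff_notin:
  assumes "f \<in> poly_alg X" "x \<in> set xs" "x \<notin> X"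
  shows "foldr pdiff xs f = 0"
proof -
  have "pdiff x f = 0" using assms by (intro pdiff_notin) (auto simp: poly_alg_def)
  then show ?thesis using assms(2) by (subst foldr_pdiff_remove1[of x]) simp_all
qed

lemma lookup_pdiff:
  "Poly_Mapping.lookup (pdiff x f) m =
     of_nat (Suc (Poly_Mapping.lookup m x)) * Poly_Mapping.lookup f (m + Poly_Mapping.single x 1)"
proof (induction f rule: sum_single_induct)
  case (single k b)
  show ?case
  proof (cases "Poly_Mapping.lookup k x")
    case 0
    then have "k \<noteq> m + Poly_Mapping.single x 1" by (auto simp: lookup_add)
    with 0 show ?thesis by (simp add: pdiff_single lookup_single when_def)
  next
    case (Suc j)
    then have "k - Poly_Mapping.single x 1 = m \<longleftrightarrow> k = m + Poly_Mapping.single x 1"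
      by (auto simp: poly_mapping_eq_iff fun_eq_iff lookup_minus lookup_add lookup_single when_def)
    then show ?thesis
      by (auto simp: pdiff_single lookup_single when_def lookup_add)
  qed
qed (simp_all add: lookup_add distrib_left)

definition tdeg_le :: "nat \<Rightarrow> 'v cpoly \<Rightarrow> bool" where
  "tdeg_le d f \<longleftrightarrow> (\<forall>m\<in>Poly_Mapping.keys f. sum (Poly_Mapping.lookup m) (Poly_Mapping.keys m) \<le> d)"

text \<open>Induction on the total degree: every first partial derivative satisfies the hypothesis
  with smaller degree, hence is zero, and what is left is a constant whose value at \<open>a\<close>
  is zero.\<close>

lemma zero_if_derivatives_vanish:
  assumes "\<And>xs. peval a (foldr pdiff xs f) = 0"
  shows "f = 0"
proof -
  have const: "f = Cst (Poly_Mapping.lookup f 0)" if "\<And>m. m \<noteq> 0 \<Longrightarrow> Poly_Mapping.lookup f m = 0"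
    for f :: "'a cpoly"
    by (rule poly_mapping_eqI) (use that in \<open>auto simp: Cst_def lookup_single when_def\<close>)
  have main: "f = 0" if "tdeg_le d f" "\<And>xs. peval a (foldr pdiff xs f) = 0" for d f
    using that
  proof (induction d arbitrary: f)
    case 0
    have "Poly_Mapping.lookup f m = 0" if "m \<noteq> 0" for m
    proof (rule ccontr)
      assume "Poly_Mapping.lookup f m \<noteq> 0"
      then have "sum (Poly_Mapping.lookup m) (Poly_Mapping.keys m) = 0"
        using 0(1) by (auto simp: tdeg_le_def in_keys_iff)
      then have "m = 0" by (intro poly_mapping_eqI) (auto simp: in_keys_iff)
      with that show False by simp
    qed
    then have f: "f = Cst (Poly_Mapping.lookup f 0)" by (rule const)
    have "peval a f = 0" using 0(2)[of "[]"] by simp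
    then show ?case by (metis f ident.insertion_Cst Cst_simps(1))
  next
    case (Suc d)
    have pd: "pdiff x f = 0" for x
    proof (rule Suc.IH)
      show "tdeg_le d (pdiff x f)"
        unfolding tdeg_le_def
      proof
        fix m assume "m \<in> Poly_Mapping.keys (pdiff x f)"
        then have "m + Poly_Mapping.single x 1 \<in> Poly_Mapping.keys f"
          by (auto simp: in_keys_iff lookup_pdiff)
        then have *: "sum (Poly_Mapping.lookup (m + Poly_Mapping.single x 1))
            (Poly_Mapping.keys (m + Poly_Mapping.single x 1)) \<le> Suc d"
          using Suc.prems(1) by (auto simp: tdeg_le_def)
        let ?A = "insert x (Poly_Mapping.keys m)"
        have "sum (Poly_Mapping.lookup (m + Poly_Mapping.single x 1))
            (Poly_Mapping.keys (m + Poly_Mapping.single x 1)) =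
          sum (Poly_Mapping.lookup (m + Poly_Mapping.single x 1)) ?A"
          by (rule sum.mono_neutral_left) (auto simp: in_keys_iff lookup_add lookup_single when_def split: if_splits)
        also have "\<dots> = sum (Poly_Mapping.lookup m) ?A + 1"
          by (simp add: lookup_add sum.distrib lookup_single when_def)
        also have "sum (Poly_Mapping.lookup m) ?A = sum (Poly_Mapping.lookup m) (Poly_Mapping.keys m)"
          by (rule sum.mono_neutral_right) (auto simp: in_keys_iff)
        finally show "sum (Poly_Mapping.lookup m) (Poly_Mapping.keys m) \<le> d" using * by simp
      qed
      show "peval a (foldr pdiff xs (pdiff x f)) = 0" for xs
        using Suc.prems(2)[of "xs @ [x]"] by simp
    qed
    have "Poly_Mapping.lookup f m = 0" if "m \<noteq> 0" for m
    proof -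
      obtain x where x: "Poly_Mapping.lookup m x \<noteq> 0"
        using \<open>m \<noteq> 0\<close> by (metis lookup_zero poly_mapping_eqI)
      let ?k = "m - Poly_Mapping.single x 1"
      have "?k + Poly_Mapping.single x 1 = m"
        using x by (intro poly_mapping_eqI) (auto simp: lookup_add lookup_minus lookup_single when_def)
      then show ?thesis
        using lookup_pdiff[of x f ?k] pd[of x] by (auto simp del: of_nat_Suc)
    qed
    then have f: "f = Cst (Poly_Mapping.lookup f 0)" by (rule const)
    have "peval a f = 0" using Suc.prems(2)[of "[]"] by simp
    then show ?case by (metis f ident.insertion_Cst Cst_simps(1))
  qed
  have "tdeg_le (\<Sum>m\<in>Poly_Mapping.keys f. sum (Poly_Mapping.lookup m) (Poly_Mapping.keys m)) f"
    unfolding tdeg_le_def by (intro ballI member_le_sum) auto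
  from main[OF this assms] show ?thesis .
qed

text \<open>Freezing all variables but \<open>x\<close> leaves a univariate polynomial that has
  every complex number as a root. So its derivative is zero as well, each partial derivative of
  \<open>f\<close> again vanishes everywhere, and all Taylor coefficients are zero.\<close>

lemma zero_if_peval_zero:
  assumes "\<And>a. peval a f = 0"
  shows "f = 0"
proof -
  interpret lin: coef_hom "\<lambda>c::complex. [:c:]" by unfold_locales (simp_all add: one_pCons)
  have diff: "peval a (pdiff x f) = 0" if f: "\<And>a. peval a f = 0" for a x and f :: "'a cpoly"
  proof -
    define \<tau> where "\<tau> z = (if z = x then [:0, 1:] else [:a z:])" for z
    let ?q = "insertion (\<lambda>c. [:c:]) \<tau>"
    have ev: "poly (?q g) t = peval (a(x := t)) g" for g t
      using ring_hom_insertion[OF lin.coef_hom_axioms ident.coef_hom_axioms, of g UNIV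
          "\<lambda>q. poly q t" \<tau> "a(x := t)"] by (simp add: \<tau>_def)
    have "?q f = 0"
      using f by (simp add: ev flip: poly_all_0_iff_0)
    moreover have "pderiv (?q g) = ?q (pdiff x g)" for g
      by (induction g rule: cpoly_induct)
         (simp_all add: lin.insertion_simps pderiv_add pderiv_mult pdiff_Var \<tau>_def pderiv_pCons)
    ultimately have "?q (pdiff x f) = 0" by (metis pderiv_0)
    then have "peval (a(x := a x)) (pdiff x f) = 0" using ev[of "pdiff x f" "a x"] by simp
    then show ?thesis by simp
  qed
  have "peval a (foldr pdiff xs f) = 0" for a xs
    using assms by (induction xs arbitrary: a) (auto intro: diff)
  then show ?thesis by (rule zero_if_derivatives_vanish)
qed

text \<open>A relation vanishes on the image of the map with components \<open>c i\<close>; if this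
  map is onto, the relation vanishes at every point.\<close>

lemma alg_indep_if_surj:
  assumes "\<And>y. \<exists>a. \<forall>i\<in>I. peval a (c i) = y i"
  shows "alg_indep c I"
  unfolding alg_indep_def
proof (intro ballI impI)
  fix P assume P: "P \<in> poly_alg I" and 0: "subst c P = 0"
  show "P = 0"
  proof (rule zero_if_peval_zero)
    fix y
    obtain a where a: "\<forall>i\<in>I. peval a (c i) = y i" using assms by blast
    have "peval a (subst c P) = peval y P"
      unfolding subst_conv_insertion
      by (rule ring_hom_insertion[OF Cst.coef_hom_axioms ident.coef_hom_axioms P]) (use a in auto)
    then show "peval y P = 0" using 0 by simp
  qed
qed

section \<open>Bounding the number of independent central elements\<close>

text \<open>Gaussian elimination: a coordinate on which some vector \<open>a0\<close> is nonzero is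
  cleared from the other vectors by subtracting multiples of \<open>a0\<close>, whose own
  coefficient \<open>s\<close> is recovered at the end.\<close>

lemma exists_linear_dependence:
  fixes v :: "'a \<Rightarrow> 'b \<Rightarrow> 'c :: field"
  assumes "finite B" "finite A" "card B < card A"
  shows "\<exists>\<alpha>. (\<exists>a\<in>A. \<alpha> a \<noteq> 0) \<and> (\<forall>b\<in>B. (\<Sum>a\<in>A. \<alpha> a * v a b) = 0)"
  using assms
proof (induction B arbitrary: A v rule: finite_induct)
  case empty
  then have "A \<noteq> {}" by auto
  then show ?case by (intro exI[of _ "\<lambda>_. 1"]) auto
next
  case (insert b B)
  show ?case
  proof (cases "\<forall>a\<in>A. v a b = 0")
    case True
    then show ?thesis using insert.IH[of A v] insert.prems insert.hyps by auto
  next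
    case False
    then obtain a0 where a0: "a0 \<in> A" "v a0 b \<noteq> 0" by auto
    let ?A = "A - {a0}"
    define w where "w a x = v a x - v a b / v a0 b * v a0 x" for a x
    have "card B < card ?A" using insert.prems insert.hyps a0 by simp
    then obtain \<alpha> where \<alpha>: "\<exists>a\<in>?A. \<alpha> a \<noteq> 0" "\<forall>x\<in>B. (\<Sum>a\<in>?A. \<alpha> a * w a x) = 0"
      using insert.IH[of ?A w] insert.prems by auto
    define s where "s = - (\<Sum>a\<in>?A. \<alpha> a * (v a b / v a0 b))"
    have split: "(\<Sum>a\<in>A. (\<alpha>(a0 := s)) a * v a x) = s * v a0 x + (\<Sum>a\<in>?A. \<alpha> a * v a x)" for x
      using a0 insert.prems by (subst sum.remove[of A a0]) (auto intro!: sum.cong)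
    have eq: "s * v a0 x + (\<Sum>a\<in>?A. \<alpha> a * v a x) = (\<Sum>a\<in>?A. \<alpha> a * w a x)" for x
      by (simp add: s_def w_def sum_distrib_right sum_subtractf right_diff_distrib mult.assoc)
    have "w a b = 0" for a using a0 by (simp add: w_def)
    then have "\<forall>x\<in>insert b B. (\<Sum>a\<in>A. (\<alpha>(a0 := s)) a * v a x) = 0"
      using \<alpha>(2) by (simp only: split eq) auto
    moreover have "\<exists>a\<in>A. (\<alpha>(a0 := s)) a \<noteq> 0" using \<alpha>(1) by auto
    ultimately show ?thesis by blast
  qed
qed

section \<open>Algebraic dependence by counting monomials\<close>

definition exps_le :: "nat \<Rightarrow> 'v cpoly \<Rightarrow> bool" where
  "exps_le d f \<longleftrightarrow> (\<forall>m\<in>Poly_Mapping.keys f. \<forall>x. Poly_Mapping.lookup m x \<le> d)"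

lemma exps_le_1 [simp]: "exps_le d 1"
  by (simp add: exps_le_def)

lemma exps_le_mono: "exps_le d f \<Longrightarrow> d \<le> e \<Longrightarrow> exps_le e f"
  by (auto simp: exps_le_def intro: order_trans)

lemma exps_le_mult:
  assumes "exps_le d f" "exps_le e g"
  shows "exps_le (d + e) (f * g)"
  unfolding exps_le_def
proof (intro ballI allI)
  fix m x assume "m \<in> Poly_Mapping.keys (f * g)"
  then obtain k l where "m = k + l" "k \<in> Poly_Mapping.keys f" "l \<in> Poly_Mapping.keys g"
    using keys_mult[of f g] by blast
  then show "Poly_Mapping.lookup m x \<le> d + e"
    using assms by (auto simp: exps_le_def lookup_add intro!: add_mono)
qed

lemma exps_le_power: "exps_le d f \<Longrightarrow> exps_le (k * d) (f ^ k)"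
  by (induction k) (auto intro: exps_le_mult)

lemma exps_le_prod:
  "(\<And>i. i \<in> I \<Longrightarrow> exps_le d (F i)) \<Longrightarrow> exps_le (card I * d) (prod F I)"
  by (induction I rule: infinite_finite_induct) (auto intro: exps_le_mult)

lemma exps_le_exists: "\<exists>d. exps_le d f"
proof -
  have "Poly_Mapping.lookup m x \<le>
      (\<Sum>m\<in>Poly_Mapping.keys f. \<Sum>x\<in>Poly_Mapping.keys m. Poly_Mapping.lookup m x)"
    if m: "m \<in> Poly_Mapping.keys f" for m x
  proof (cases "x \<in> Poly_Mapping.keys m")
    case True
    then have "Poly_Mapping.lookup m x \<le> (\<Sum>x\<in>Poly_Mapping.keys m. Poly_Mapping.lookup m x)"
      by (intro member_le_sum) auto
    also have "\<dots> \<le> (\<Sum>m\<in>Poly_Mapping.keys f. \<Sum>x\<in>Poly_Mapping.keys m. Poly_Mapping.lookup m x)"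
      by (rule member_le_sum[OF m]) auto
    finally show ?thesis .
  qed (simp add: in_keys_iff)
  then show ?thesis unfolding exps_le_def by blast
qed

definition mono_of :: "'v set \<Rightarrow> ('v \<Rightarrow> nat) \<Rightarrow> 'v \<Rightarrow>\<^sub>0 nat" where
  "mono_of X g = (\<Sum>x\<in>X. Poly_Mapping.single x (g x))"

lemma lookup_mono_of: "finite X \<Longrightarrow> Poly_Mapping.lookup (mono_of X g) x = (if x \<in> X then g x else 0)"
  by (simp add: mono_of_def lookup_sum lookup_single when_def)

lemma mono_of_surj:
  assumes "finite X" "Poly_Mapping.keys m \<subseteq> X" "\<And>x. Poly_Mapping.lookup m x \<le> d"
  shows "\<exists>g \<in> X \<rightarrow>\<^sub>E {..d}. m = mono_of X g"
proof
  show "m = mono_of X (restrict (Poly_Mapping.lookup m) X)"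
    using assms by (intro poly_mapping_eqI) (auto simp: lookup_mono_of in_keys_iff)
qed (use assms in auto)

lemma mono_of_inj:
  assumes "finite X"
  shows "inj_on (mono_of X) (X \<rightarrow>\<^sub>E A)"
proof (rule inj_onI, rule PiE_ext)
  fix g h x assume "mono_of X g = mono_of X h" "x \<in> X"
  then show "g x = h x" using lookup_mono_of[OF assms, of _ x] by metis
qed

text \<open>There are \<open>(d + 1)^|I|\<close> products of powers of the \<open>\<sigma> i\<close>
  with exponents up to \<open>d\<close>, and they live in a space of dimension
  \<open>(e + 1)^|L|\<close> with \<open>e\<close> linear in \<open>d\<close>. As
  \<open>|L| < |I|\<close>, the first number wins for large \<open>d\<close>, and a linear
  dependence between the products is an algebraic relation.\<close>

lemma exists_algebraic_dependence:
  assumes fin: "finite L" "finite I" and card: "card L < card I"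
    and \<sigma>: "\<And>i. i \<in> I \<Longrightarrow> \<sigma> i \<in> poly_alg L"
  shows "\<exists>P\<in>poly_alg I. P \<noteq> 0 \<and> subst \<sigma> P = 0"
proof -
  obtain D where D: "\<And>i. exps_le (D i) (\<sigma> i)"
    using choice[of "\<lambda>i d. exps_le d (\<sigma> i)"] exps_le_exists by blast
  define E where "E = sum D I"
  have E: "exps_le E (\<sigma> i)" if "i \<in> I" for i
    using D[of i] by (rule exps_le_mono) (use that fin in \<open>simp add: E_def member_le_sum\<close>)
  define K where "K = card I * E + 1"
  \<comment> \<open>Since \<open>e + 1 \<le> K * (d + 1)\<close>, this choice absorbs the factor
    \<open>K^|L|\<close>: the dimension is at most \<open>d * (d + 1)^|L|\<close>, just below
    \<open>(d + 1)^(|L| + 1)\<close>.\<close>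
  define d where "d = K ^ card L"
  define e where "e = card I * (d * E)"
  let ?A = "I \<rightarrow>\<^sub>E {..d}" and ?B = "L \<rightarrow>\<^sub>E {..e}"
  define M where "M g = (\<Prod>i\<in>I. \<sigma> i ^ g i)" for g
  have "e + 1 \<le> K * (d + 1)" by (simp add: e_def K_def algebra_simps)
  then have "card ?B \<le> (K * (d + 1)) ^ card L"
    using fin by (simp add: card_PiE power_mono)
  also have "\<dots> = d * (d + 1) ^ card L" by (simp only: d_def power_mult_distrib)
  also have "\<dots> < (d + 1) ^ Suc (card L)" by simp
  also have "\<dots> \<le> (d + 1) ^ card I" using card by (intro power_increasing) auto
  also have "\<dots> = card ?A" using fin by (simp add: card_PiE)
  finally have "card ?B < card ?A" .
  then obtain \<alpha> where \<alpha>: "\<exists>g\<in>?A. \<alpha> g \<noteq> 0"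
    "\<forall>h\<in>?B. (\<Sum>g\<in>?A. \<alpha> g * Poly_Mapping.lookup (M g) (mono_of L h)) = 0"
    using exists_linear_dependence[of ?B ?A "\<lambda>g h. Poly_Mapping.lookup (M g) (mono_of L h)"] fin
    by (auto simp: finite_PiE)
  define P where "P = (\<Sum>g\<in>?A. Poly_Mapping.single (mono_of I g) (\<alpha> g))"
  have MX: "M g \<in> poly_alg L" for g
    unfolding M_def by (intro poly_alg_prod poly_alg_power \<sigma>)
  have Me: "exps_le e (M g)" if "g \<in> ?A" for g
    unfolding M_def e_def
  proof (rule exps_le_prod)
    fix i assume i: "i \<in> I"
    have "exps_le (g i * E) (\<sigma> i ^ g i)" by (intro exps_le_power E i)
    then show "exps_le (d * E) (\<sigma> i ^ g i)"
      by (rule exps_le_mono) (use that i in \<open>auto simp: PiE_iff\<close>)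
  qed
  have subst_mono: "subst \<sigma> (Poly_Mapping.single (mono_of I g) c) = Cst c * M g" for g c
    using fin unfolding subst_conv_insertion Cst.insertion_single M_def
    by (subst prod_pow_superset[of I]) (auto simp: lookup_mono_of in_keys_iff split: if_splits)
  have lookP: "Poly_Mapping.lookup P (mono_of I g) = \<alpha> g" if "g \<in> ?A" for g
  proof -
    have "mono_of I g' = mono_of I g \<longleftrightarrow> g' = g" if "g' \<in> ?A" for g'
      using mono_of_inj[OF fin(2)] that \<open>g \<in> ?A\<close> by (auto dest: inj_onD)
    then have "Poly_Mapping.lookup P (mono_of I g) = (\<Sum>g'\<in>?A. if g' = g then \<alpha> g' else 0)"
      unfolding P_def lookup_sum by (intro sum.cong) (auto simp: lookup_single when_def)
    also have "\<dots> = \<alpha> g" using that fin by (simp add: finite_PiE)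
    finally show ?thesis .
  qed
  show ?thesis
  proof (intro bexI conjI)
    show "P \<noteq> 0" using lookP \<alpha>(1) by (metis lookup_zero)
    show "P \<in> poly_alg I"
      unfolding P_def using fin
      by (intro poly_alg_sum) (auto simp: poly_alg_iff in_keys_iff lookup_mono_of lookup_single when_def
          split: if_splits)
    have *: "subst \<sigma> P = (\<Sum>g\<in>?A. Cst (\<alpha> g) * M g)"
      unfolding P_def subst_mono [symmetric] by (simp only: subst_conv_insertion Cst.insertion_sum)
    have lookC: "Poly_Mapping.lookup (Cst c * f) m = c * Poly_Mapping.lookup f m" for c and f :: "'a cpoly" and m
      by (induction f rule: sum_single_induct)
         (simp_all add: Cst_def mult_single lookup_single when_def lookup_add distrib_left)
    show "subst \<sigma> P = 0"
    proof (rule poly_mapping_eqI)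
      fix m
      show "Poly_Mapping.lookup (subst \<sigma> P) m = Poly_Mapping.lookup 0 m"
      proof (cases "\<exists>h\<in>?B. m = mono_of L h")
        case True
        then show ?thesis using \<alpha>(2) by (auto simp: * lookup_sum lookC)
      next
        case False
        have "Poly_Mapping.lookup (M g) m = 0" if "g \<in> ?A" for g
        proof (rule ccontr)
          assume "Poly_Mapping.lookup (M g) m \<noteq> 0"
          then have "m \<in> Poly_Mapping.keys (M g)" by (simp add: in_keys_iff)
          then have "Poly_Mapping.keys m \<subseteq> L" "\<And>x. Poly_Mapping.lookup m x \<le> e"
            using MX[of g] Me[OF that] by (auto simp: poly_alg_iff exps_le_def)
          with mono_of_surj[OF fin(1)] False show False by blast
        qed
        then show ?thesis by (simp add: * lookup_sum lookC)
      qed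
    qed
  qed
qed

section \<open>Restricting central elements to an affine slice\<close>

definition slice :: "'v set \<Rightarrow> ('v \<Rightarrow> complex) \<Rightarrow> 'v \<Rightarrow> 'v cpoly" where
  "slice L a x = (if x \<in> L then Var x else Cst (a x))"

text \<open>Each term of the Leibniz expansion that differentiates \<open>w\<close> contains too few
  derivatives of \<open>g\<close>, so at lowest order only the value of \<open>w\<close> at
  \<open>a\<close> counts.\<close>

lemma peval_Leibniz:
  assumes "\<And>zs. length zs < length xs \<Longrightarrow> peval a (foldr pdiff zs g) = 0"
  shows "peval a (foldr pdiff xs (g * w)) = peval a (foldr pdiff xs g) * peval a w"
  using assms
proof (induction xs arbitrary: g w rule: rev_induct)
  case (snoc x xs)
  have "peval a (foldr pdiff xs (pdiff x g * w)) = peval a (foldr pdiff xs (pdiff x g)) * peval a w"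
  proof (rule snoc.IH)
    fix zs assume "length (zs :: 'a list) < length xs"
    then show "peval a (foldr pdiff zs (pdiff x g)) = 0" using snoc.prems[of "zs @ [x]"] by simp
  qed
  moreover have "peval a (foldr pdiff xs (g * pdiff x w)) = peval a (foldr pdiff xs g) * peval a (pdiff x w)"
    by (rule snoc.IH) (use snoc.prems in auto)
  moreover have "peval a (foldr pdiff xs g) = 0" using snoc.prems[of xs] by simp
  ultimately show ?case by (simp add: foldr_pdiff_add)
qed simp

text \<open>All Taylor coefficients of \<open>f\<close> at \<open>a\<close> vanish: at lowest order, \<open>f\<close> is invariant under the
  vectors of the Poisson tensor at \<open>a\<close>, and these span a complement of the slice.\<close>

lemma zero_if_zero_on_slice:
  assumes X: "finite X" "L \<subseteq> X" and f: "f \<in> poly_alg X"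
    and central: "\<And>y. y \<in> X \<Longrightarrow> vder X (\<lambda>x. \<gamma> x y) f = 0"
    and transversal: "\<And>x0. x0 \<in> X - L \<Longrightarrow> \<exists>c. \<forall>x\<in>X - L.
          (\<Sum>y\<in>X. c y * peval a (\<gamma> x y)) = (if x = x0 then 1 else 0)"
    and zero: "subst (slice L a) f = 0"
  shows "f = 0"
proof (rule zero_if_derivatives_vanish)
  have slice_only: "peval a (foldr pdiff xs f) = 0" if "set xs \<subseteq> L" for xs
  proof -
    have comm: "subst (slice L a) (pdiff x g) = pdiff x (subst (slice L a) g)" if "x \<in> L" for x g
      unfolding subst_conv_insertion using that
      by (induction g rule: cpoly_induct) (auto simp: pdiff_Var slice_def)
    have "subst (slice L a) (foldr pdiff xs f) = foldr pdiff xs (subst (slice L a) f)"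
      using that by (induction xs) (auto simp: comm)
    then have "peval a (subst (slice L a) (foldr pdiff xs f)) = 0" by (simp add: zero)
    moreover have "peval a (subst (slice L a) g) = peval a g" for g
      unfolding subst_conv_insertion
      by (rule ring_hom_insertion[OF Cst.coef_hom_axioms ident.coef_hom_axioms, of _ UNIV])
         (auto simp: slice_def)
    ultimately show ?thesis by simp
  qed
  \<comment> \<open>Outer induction on the order of the derivative, inner induction on the number of
    its directions outside \<open>L\<close>.\<close>
  have all: "peval a (foldr pdiff xs f) = 0" if "set xs \<subseteq> X" "length xs = d" for xs d
    using that
  proof (induction d arbitrary: xs rule: less_induct)
    case (less d)
    have shorter: "peval a (foldr pdiff zs f) = 0" if "length zs < d" for zs
    proof (cases "set zs \<subseteq> X")
      case False
      then obtain x where "x \<in> set zs" "x \<notin> X" by blast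
      then show ?thesis by (simp add: foldr_pdiff_notin[OF f])
    qed (use less.IH that in blast)
    have "peval a (foldr pdiff xs f) = 0"
      if "set xs \<subseteq> X" "length xs = d" "length (filter (\<lambda>x. x \<notin> L) xs) = k" for k xs
      using that
    proof (induction k arbitrary: xs)
      case 0
      then show ?case by (intro slice_only) (auto simp: filter_empty_conv)
    next
      case (Suc k)
      then obtain x0 where x0: "x0 \<in> set xs" "x0 \<notin> L"
        by (metis filter_empty_conv length_0_conv nat.distinct(1))
      define ys where "ys = remove1 x0 xs"
      have len_ys: "Suc (length ys) = d"
        using length_pos_if_in_set[OF x0(1)] x0 Suc.prems(2) by (simp add: ys_def length_remove1)
      have ys_X: "set ys \<subseteq> X" using Suc.prems(1) set_remove1_subset[of x0 xs] by (auto simp: ys_def)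
      have ys_k: "length (filter (\<lambda>x. x \<notin> L) ys) = k"
        using x0 Suc.prems(3) by (simp add: ys_def filter_remove1 length_remove1)
      obtain c where c: "\<And>x. x \<in> X - L \<Longrightarrow>
          (\<Sum>y\<in>X. c y * peval a (\<gamma> x y)) = (if x = x0 then 1 else 0)"
        using transversal[of x0] x0 Suc.prems(1) by auto
      \<comment> \<open>A combination of Hamiltonian vector fields that at \<open>a\<close> is the
        direction of \<open>x0\<close> plus directions in \<open>L\<close>. It kills
        \<open>f\<close> by centrality, so the derivative along \<open>x0\<close> is traded for
        derivatives along \<open>L\<close>, to which the inner induction applies.\<close>
      define w where "w x = (\<Sum>y\<in>X. Cst (c y) * \<gamma> x y)" for x
      have w: "peval a (w x) = (\<Sum>y\<in>X. c y * peval a (\<gamma> x y))" for x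
        by (simp add: w_def ident.insertion_sum)
      have "(\<Sum>x\<in>X. pdiff x f * w x) = (\<Sum>x\<in>X. \<Sum>y\<in>X. Cst (c y) * (pdiff x f * \<gamma> x y))"
        by (simp add: w_def sum_distrib_left ac_simps)
      also have "\<dots> = (\<Sum>y\<in>X. Cst (c y) * vder X (\<lambda>x. \<gamma> x y) f)"
        by (subst sum.swap) (simp add: vder_def sum_distrib_left)
      also have "\<dots> = 0" by (simp add: central)
      finally have "0 = peval a (foldr pdiff ys (\<Sum>x\<in>X. pdiff x f * w x))" by simp
      also have "\<dots> = (\<Sum>x\<in>X. peval a (foldr pdiff ys (pdiff x f * w x)))"
        by (simp add: foldr_pdiff_sum ident.insertion_sum)
      also have "\<dots> = (\<Sum>x\<in>X. peval a (foldr pdiff ys (pdiff x f)) * peval a (w x))"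
      proof (intro sum.cong refl peval_Leibniz)
        fix x zs assume "length (zs :: 'a list) < length ys"
        then show "peval a (foldr pdiff zs (pdiff x f)) = 0"
          using shorter[of "zs @ [x]"] len_ys by simp
      qed
      also have "\<dots> = (\<Sum>x\<in>X. if x = x0 then peval a (foldr pdiff ys (pdiff x f)) else 0)"
      proof (intro sum.cong refl)
        fix x assume x: "x \<in> X"
        show "peval a (foldr pdiff ys (pdiff x f)) * peval a (w x) =
          (if x = x0 then peval a (foldr pdiff ys (pdiff x f)) else 0)"
        proof (cases "x \<in> L")
          case True
          have "peval a (foldr pdiff (ys @ [x]) f) = 0"
            using True x ys_X ys_k len_ys by (intro Suc.IH) auto
          then show ?thesis using True x0 by auto
        qed (use x c in \<open>auto simp: w\<close>)
      qed
      also have "\<dots> = peval a (foldr pdiff ys (pdiff x0 f))"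
        using x0 Suc.prems(1) X(1) by (simp add: subset_iff)
      finally show ?case
        using foldr_pdiff_remove1[OF x0(1), of f] by (simp add: ys_def)
    qed
    then show ?case using less.prems by blast
  qed
  show "peval a (foldr pdiff xs f) = 0" for xs
  proof (cases "set xs \<subseteq> X")
    case False
    then obtain x where "x \<in> set xs" "x \<notin> X" by blast
    then show ?thesis by (simp add: foldr_pdiff_notin[OF f])
  qed (use all in blast)
qed

text \<open>One element more than the dimension of the slice must become dependent after
  restriction. The resulting relation, applied to the unrestricted elements, is central and vanishes
  on the slice, hence is zero, against independence.\<close>

lemma card_alg_indep_center_le:
  assumes X: "finite X" "L \<subseteq> X"
    and transversal: "\<And>x0. x0 \<in> X - L \<Longrightarrow> \<exists>c. \<forall>x\<in>X - L.
          (\<Sum>y\<in>X. c y * peval a (\<gamma> x y)) = (if x = x0 then 1 else 0)"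
    and S: "S \<subseteq> center (biderivation \<gamma>) (poly_alg X)" "alg_indep (\<lambda>f. f) S"
  shows "finite S \<and> card S \<le> card L"
proof (rule ccontr)
  assume "\<not> (finite S \<and> card S \<le> card L)"
  obtain T where T: "T \<subseteq> S" "finite T" "card T = Suc (card L)"
  proof (cases "finite S")
    case True
    with \<open>\<not> _\<close> have "Suc (card L) \<le> card S" by simp
    from obtain_subset_with_card_n[OF this] show ?thesis using that by blast
  next
    case False
    from infinite_arbitrarily_large[OF this, of "Suc (card L)"] show ?thesis using that by blast
  qed
  have fL: "finite L" using X finite_subset by blast
  let ?\<tau> = "slice L a"
  have "\<exists>P\<in>poly_alg T. P \<noteq> 0 \<and> subst (\<lambda>f. subst ?\<tau> f) P = 0"
    using T fL by (intro exists_algebraic_dependence[of L])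
      (auto intro!: subst_in_poly_alg[of _ UNIV] simp: slice_def)
  then obtain P where P: "P \<in> poly_alg T" "P \<noteq> 0" "subst (\<lambda>f. subst ?\<tau> f) P = 0" by blast
  define F where "F = subst (\<lambda>f. f) P"
  have "F \<in> center (biderivation \<gamma>) (poly_alg X)"
    unfolding F_def using T S by (intro center_subst[OF X(1) P(1)]) auto
  moreover have "subst ?\<tau> F = subst (\<lambda>f. subst ?\<tau> f) P"
    unfolding F_def subst_conv_insertion
    by (rule ring_hom_insertion[OF Cst.coef_hom_axioms Cst.coef_hom_axioms P(1)]) auto
  ultimately have F: "F \<in> poly_alg X" "\<And>y. y \<in> X \<Longrightarrow> vder X (\<lambda>x. \<gamma> x y) F = 0" "subst ?\<tau> F = 0"
    using P(3) by (simp_all add: center_biderivation_iff[OF X(1)])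
  have "F = 0"
    by (rule zero_if_zero_on_slice[OF X F(1,2) transversal F(3)])
  then show False
    using P(1,2) S(2) T(1) poly_alg_mono[of P T S] by (auto simp: alg_indep_def F_def)
qed

section \<open>The reduced bracket\<close>

declare red_gen.simps [simp del]

text \<open>Extended by zero to negative \<open>k\<close>, the series \<open>G(\<mu>)\<close> can be shifted without conditions on indices.\<close>

definition G_int :: "int \<Rightarrow> nat \<Rightarrow> nat \<Rightarrow> gen cpoly" where
  "G_int k i j = (if k < 0 then 0 else G_coeff (nat k) i j)"

lemma of_int_fls_const: "(of_int k :: 'a :: comm_ring_1 fls) = fls_const (of_int k)"
  by (simp add: fls_of_int)

text \<open>A prefactor whose coefficient of \<open>z^m\<close> is a multiple of
  \<open>w^(\<sigma> m)\<close> convolves the levels in \<open>z\<close> but only shifts those in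
  \<open>w\<close>. The shift may lead below 0, where \<open>G_int\<close> takes over.\<close>

lemma nth_kernel_product:
  assumes K: "\<And>m. fps_nth K m = fls_const (\<kappa> m) * fls_X_intpow (\<sigma> * int m)"
  shows "fls_nth (fps_nth (K * G_lambda a b * G_mu c d) r) s =
    (\<Sum>m\<le>r. \<kappa> m * G_coeff (r - m) a b * G_int (s - \<sigma> * int m) c d)"
proof -
  let ?M = "fps_to_fls (Abs_fps (\<lambda>k. G_coeff k c d))"
  have "fps_nth (K * G_lambda a b * G_mu c d) r = fps_nth (K * G_lambda a b) r * ?M"
    by (simp add: G_mu_def)
  also have "fps_nth (K * G_lambda a b) r =
      (\<Sum>m\<le>r. fls_const (\<kappa> m) * fls_X_intpow (\<sigma> * int m) * fls_const (G_coeff (r - m) a b))"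
    by (simp only: fps_mult_nth K atLeast0AtMost G_lambda_def fps_nth_Abs_fps)
  also have "\<dots> * ?M =
      (\<Sum>m\<le>r. fls_const (\<kappa> m * G_coeff (r - m) a b) * (fls_X_intpow (\<sigma> * int m) * ?M))"
    unfolding sum_distrib_right
    by (intro sum.cong refl) (simp only: fls_const_mult_const[symmetric] ac_simps)
  also have "fls_nth \<dots> s = (\<Sum>m\<le>r. \<kappa> m * G_coeff (r - m) a b * G_int (s - \<sigma> * int m) c d)"
    unfolding fls_nth_sum
    by (simp add: fls_X_intpow_times_conv_shift) (simp add: G_int_def cong: if_cong)
  finally show ?thesis .
qed

text \<open>The coefficient of \<open>z^m\<close>, up to a power of \<open>w\<close>, in
  \<open>e + c (1 + 2 (\<Sum>m\<ge>1. ...))\<close>, the common form of the four prefactors of the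
  bracket.\<close>

definition br_coef :: "int \<Rightarrow> int \<Rightarrow> nat \<Rightarrow> gen cpoly" where
  "br_coef e c m = (if m = 0 then of_int (e + c) else of_int (2 * c))"

lemma gen_bracket_expand:
  "gen_bracket (r, j, i) (s, q, l) =
     (\<Sum>m\<le>r. br_coef (sgn (int j - int q)) (-1) m * G_coeff (r - m) q i * G_int (int s + int m) j l)
   + (\<Sum>m\<le>r. br_coef (sgn (int i - int l)) 1 m * G_coeff (r - m) j l * G_int (int s + int m) q i)
   + (\<Sum>m\<le>r. br_coef (sgn (int i - int q)) 1 m * G_coeff (r - m) j q * G_int (int s - int m) i l)
   + (\<Sum>m\<le>r. br_coef (sgn (int j - int l)) (-1) m * G_coeff (r - m) l i * G_int (int s - int m) q j)"
proof -
  have one: "(1 :: gen cpoly fls) = fls_const 1" by simp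
  have two: "(2 :: gen cpoly fls) = fls_const 2" by simp
  have e: "fps_nth (eps a b) m = (if m = 0 then fls_const (of_int (sgn (int a - int b))) else 0)" for a b m
    by (simp add: eps_def fps_of_int fps_nth_of_int of_int_fls_const)
  have 1: "fps_nth (eps j q - kernel_minus) m =
      fls_const (br_coef (sgn (int j - int q)) (-1) m) * fls_X_intpow (- 1 * int m)" for m
    by (simp add: e kernel_minus_def br_coef_def two one fls_plus_const fls_minus_const
        del: fls_const_numeral fls_const_1)
  have 2: "fps_nth (eps i l + kernel_minus) m =
      fls_const (br_coef (sgn (int i - int l)) 1 m) * fls_X_intpow (- 1 * int m)" for m
    by (simp add: e kernel_minus_def br_coef_def two one fls_plus_const fls_minus_const
        del: fls_const_numeral fls_const_1)
  \<comment> \<open>\<open>kernel_prod\<close> is itself minus a series with leading term 1, so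
    subtracting it gives \<open>c = 1\<close> and adding it \<open>c = -1\<close>, opposite to
    \<open>kernel_minus\<close>.\<close>
  have 3: "fps_nth (eps i q - kernel_prod) m =
      fls_const (br_coef (sgn (int i - int q)) 1 m) * fls_X_intpow (1 * int m)" for m
    by (simp add: e kernel_prod_def br_coef_def two one fls_plus_const fls_minus_const
        del: fls_const_numeral fls_const_1)
  have 4: "fps_nth (eps j l + kernel_prod) m =
      fls_const (br_coef (sgn (int j - int l)) (-1) m) * fls_X_intpow (1 * int m)" for m
    by (simp add: e kernel_prod_def br_coef_def two one fls_plus_const fls_minus_const
        del: fls_const_numeral fls_const_1)
  have "bracket_series j i q l =
     (eps j q - kernel_minus) * G_lambda q i * G_mu j l
   + (eps i l + kernel_minus) * G_lambda j l * G_mu q i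
   + (eps i q - kernel_prod) * G_lambda j q * G_mu i l
   + (eps j l + kernel_prod) * G_lambda l i * G_mu q j"
    by (simp add: bracket_series_def ac_simps)
  then show ?thesis
    by (simp only: gen_bracket.simps fps_add_nth fls_plus_nth nth_kernel_product[OF 1]
        nth_kernel_product[OF 2] nth_kernel_product[OF 3] nth_kernel_product[OF 4]) simp
qed

lemma red_simps [simp]:
  "red p 0 = 0" "red p 1 = 1" "red p (f + g) = red p f + red p g" "red p (- f) = - red p f"
  "red p (f - g) = red p f - red p g" "red p (f * g) = red p f * red p g" "red p (Cst c) = Cst c"
  "red p (Var x) = red_gen p x" "red p (f ^ k) = red p f ^ k"
  by (simp_all add: red_def subst_conv_insertion)

lemma red_sum: "red p (sum F A) = (\<Sum>x\<in>A. red p (F x))"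
  by (simp add: red_def subst_conv_insertion Cst.insertion_sum)

lemma red_of_int [simp]: "red p (of_int k) = of_int k"
  using red_simps(7)[of p "of_int k"] by (simp del: red_simps)

lemma red_gen_mod: "red_gen p (k mod p, i, j) = red_gen p (k, i, j)"
  by (simp add: red_gen.simps)

text \<open>The chord joining the points \<open>I\<close> and \<open>J\<close> of the circle of integers modulo \<open>n p\<close>. The identifications of the
  reduction say that chords are unoriented and invariant under rotation by \<open>n\<close>.\<close>

definition sym_gen :: "nat \<Rightarrow> nat \<Rightarrow> int \<Rightarrow> int \<Rightarrow> gen cpoly" where
  "sym_gen n p I J = red_gen p (nat ((J div int n - I div int n) mod int p),
     nat (I mod int n), nat (J mod int n))"

context
  fixes n p :: nat
  assumes n: "0 < n" and p: "0 < p"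
begin

text \<open>Reversal negates the level modulo \<open>p\<close> and transposes the indices, which is
  the relation \<open>red_gen_transpose\<close>.\<close>

lemma sym_gen_commute: "sym_gen n p I J = sym_gen n p J I"
proof -
  define k where "k = nat ((J div int n - I div int n) mod int p)"
  have k: "k < p" "int k = (J div int n - I div int n) mod int p"
    using p by (simp_all add: k_def nat_less_iff)
  have "int ((p - k) mod p) = (int p - int k) mod int p"
    using k(1) by (simp only: zmod_int of_nat_diff less_imp_le)
  also have "\<dots> = (int p - (J div int n - I div int n)) mod int p"
    unfolding k(2) by (rule mod_diff_right_eq)
  also have "int p - (J div int n - I div int n) = (I div int n - J div int n) + int p" by simp
  also have "\<dots> mod int p = (I div int n - J div int n) mod int p" by (rule mod_add_self2)
  finally have "(I div int n - J div int n) mod int p = int ((p - k) mod p)" by simp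
  then have "nat ((I div int n - J div int n) mod int p) = (p - k) mod p" by simp
  then have "sym_gen n p J I = red_gen p ((p - k) mod p, nat (J mod int n), nat (I mod int n))"
    by (simp add: sym_gen_def)
  also have "\<dots> = red_gen p (p - k, nat (J mod int n), nat (I mod int n))"
    by (rule red_gen_mod)
  also have "\<dots> = sym_gen n p I J"
    using red_gen_transpose[of k p] k(1) by (simp only: sym_gen_def k_def[symmetric])
  finally show ?thesis by simp
qed

lemma sym_gen_shift: "sym_gen n p (I + int n * t) (J + int n * t) = sym_gen n p I J"
  using n by (simp add: sym_gen_def div_mult_self2 [where b = "int n"] algebra_simps)

lemma sym_gen_period: "sym_gen n p I (J + int n * (int p * w)) = sym_gen n p I J"
proof -
  have "(J + int n * (int p * w)) div int n = J div int n + int p * w"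
    using n by simp
  then have "(J + int n * (int p * w)) div int n - I div int n = J div int n - I div int n + int p * w"
    by simp
  then show ?thesis unfolding sym_gen_def by (simp only: mod_mult_self2)
qed

lemma sym_gen_eval:
  assumes "i < n" "j < n"
  shows "sym_gen n p (int i + int n * k) (int j + int n * l) = red_gen p (nat ((l - k) mod int p), i, j)"
  using assms by (simp add: sym_gen_def)

text \<open>Half of \<open>1 + sgn\<close> is a Heaviside function with value 1/2 at zero. It
  encodes at once that levels are nonnegative, that the constant term is upper triangular, and that
  its diagonal entries are 1, half of the diagonal value 2 of \<open>sym_gen\<close>.\<close>

lemma red_G_int:
  assumes "i < n" "j < n" "l - k = d"
  shows "red p (G_int d i j) = Cst (of_int (1 + sgn (int j + int n * l - (int i + int n * k))) / 2) *
     sym_gen n p (int i + int n * k) (int j + int n * l)"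
proof -
  have D: "int j + int n * l - (int i + int n * k) = int j - int i + int n * d"
    using assms(3) by (auto simp: algebra_simps)
  consider "d < 0" | "d = 0" | "d > 0" by linarith
  then show ?thesis
  proof cases
    case 1
    have "int n * d \<le> int n * (- 1)" using 1 by (intro mult_left_mono) auto
    then have "sgn (int j - int i + int n * d) = -1" using assms(1,2) by simp
    then show ?thesis using 1 by (simp add: G_int_def D)
  next
    case 2
    have "Cst (1 / 2) * (2 :: gen cpoly) = 1"
      using Cst_simps(4)[of "1/2" 2] by (simp del: Cst_simps(4))
    then show ?thesis unfolding sym_gen_eval[OF assms(1,2)] D
      using 2 assms(3) by (auto simp: G_int_def G_coeff_def A0_def sgn_if Let_def red_gen.simps)
  next
    case 3
    have "int n * 1 \<le> int n * d" using 3 by (intro mult_left_mono) auto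
    then have "0 < int j - int i + int n * d" using assms(1,2) by linarith
    then have s: "sgn (int j - int i + int n * d) = 1" by simp
    have "red_gen p (nat d, i, j) = red_gen p (nat (d mod int p), i, j)"
      using 3 by (simp add: nat_mod_distrib red_gen.simps)
    then show ?thesis unfolding sym_gen_eval[OF assms(1,2)] D s
      using 3 assms(3) by (simp add: G_int_def G_coeff_def)
  qed
qed

end

text \<open>For \<open>I < J\<close> and \<open>K < L\<close> this is 2 or -2 if the two intervals
  interleave, 1 or -1 if they share exactly one endpoint, and 0 otherwise.\<close>

definition chord_sgn :: "int \<Rightarrow> int \<Rightarrow> int \<Rightarrow> int \<Rightarrow> int" where
  "chord_sgn I J K L = sgn (I - K) + sgn (J - L) + sgn (K - J) + sgn (L - I)"

text \<open>The first sum collects the sign and Heaviside factors of the first two terms of the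
  bracket, the second sum those of the last two; within each pair the quadratic monomial is the
  same. Only the relative order of the four points matters, so finitely many cases remain.\<close>

lemma chord_sgn_identities:
  assumes "I < J" "K < (L :: int)"
  shows "(sgn (I - K) - 1) * (1 + sgn (J - K)) * (1 + sgn (L - I)) +
      (sgn (J - L) + 1) * (1 + sgn (J - K)) * (1 + sgn (L - I)) = 4 * chord_sgn I J K L"
    and "(sgn (J - K) + 1) * (1 + sgn (K - I)) * (1 + sgn (L - J)) +
      (sgn (I - L) - 1) * (1 + sgn (J - L)) * (1 + sgn (I - K)) = - 4 * chord_sgn I J K L"
  using assms unfolding chord_sgn_def
  by (cases I K rule: linorder_cases; cases J L rule: linorder_cases;
      cases J K rule: linorder_cases; cases L I rule: linorder_cases; simp)+

lemma sum_reindex_neutral: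
  assumes "inj_on \<phi> A" "\<phi> ` A \<subseteq> T" "finite T"
    and "\<And>m. m \<in> A \<Longrightarrow> f m = g (\<phi> m)" and "\<And>t. t \<in> T - \<phi> ` A \<Longrightarrow> g t = 0"
  shows "sum f A = sum g T"
proof -
  have "sum f A = sum g (\<phi> ` A)" using assms by (simp add: sum.reindex cong: sum.cong)
  also have "\<dots> = sum g T" using assms by (intro sum.mono_neutral_left) auto
  finally show ?thesis .
qed

section \<open>The bracket as a sum over translates of a chord on the line\<close>

context
  fixes n p :: nat
  assumes n: "0 < n" and p: "0 < p"
begin

text \<open>Each of the four sums over \<open>m\<close> is renumbered by the translation
  \<open>t\<close> of the second chord. Outside the original range of \<open>m\<close> a sign factor
  or a Heaviside factor is zero, so all four extend to the same set \<open>T\<close> and can be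
  added term by term.\<close>

lemma red_gen_bracket_line:
  fixes r j i s q l :: nat and T :: "int set"
  assumes idx: "j < n" "i < n" "q < n" "l < n"
    and T: "finite T" "{- int s - int r..int r + int s} \<subseteq> T"
    and lt: "r = 0 \<Longrightarrow> j < i" "s = 0 \<Longrightarrow> q < l"
  defines "I \<equiv> int j" and "J \<equiv> int i + int n * int r"
  defines "K \<equiv> \<lambda>t. int q + int n * t" and "L \<equiv> \<lambda>t. int l + int n * (int s + t)"
  shows "red p (gen_bracket (r, j, i) (s, q, l)) =
    (\<Sum>t\<in>T. of_int (chord_sgn I J (K t) (L t)) * (sym_gen n p J (K t) * sym_gen n p I (L t) - sym_gen n p I (K t) * sym_gen n p J (L t)))"
proof -
  \<comment> \<open>The quarter stems from the two Heaviside functions of a quadratic term.\<close>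
  define c where "c x = (Cst (of_int x / 4) :: gen cpoly)" for x :: int
  define th where "th x = (1 + sgn x :: int)" for x :: int
  have IJ: "I < J"
  proof (cases "r = 0")
    case False
    then have "int n * 1 \<le> int n * int r" by (intro mult_left_mono) auto
    then show ?thesis unfolding I_def J_def using idx by linarith
  qed (use lt in \<open>simp add: I_def J_def\<close>)
  have KL: "K t < L t" for t
  proof (cases "s = 0")
    case False
    then have "int n * 1 \<le> int n * int s" by (intro mult_left_mono) auto
    then show ?thesis unfolding K_def L_def distrib_left using idx by linarith
  qed (use lt in \<open>simp add: K_def L_def\<close>)
  have sg: "sgn (x + int n * k) = (if k = 0 then sgn x else sgn k)" if "\<bar>x\<bar> < int n" for x k
  proof (cases k "0::int" rule: linorder_cases)
    case less
    then have "int n * k \<le> int n * (- 1)" by (intro mult_left_mono) auto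
    then have "x + int n * k < 0" using that by linarith
    with less show ?thesis by simp
  next
    case greater
    then have "int n * 1 \<le> int n * k" by (intro mult_left_mono) auto
    then have "x + int n * k > 0" using that by linarith
    with greater show ?thesis by simp
  qed simp
  have G: "G_coeff k x y = G_int (int k) x y" for k x y by (simp add: G_int_def)
  have summand: "red p (br_coef e d m * G_coeff k x y * G_int k' x' y') =
      c ((e' + d) * th u * th v) * (sym_gen n p X Y * sym_gen n p X' Y')"
    if "br_coef e d m = of_int (e' + d)"
      "red p (G_int (int k) x y) = Cst (of_int (th u) / 2) * sym_gen n p X Y"
      "red p (G_int k' x' y') = Cst (of_int (th v) / 2) * sym_gen n p X' Y'" for e d m k x y k' x' y' e' u v X Y X' Y'
  proof -
    have "Cst (of_int (e' + d)) * Cst (of_int (th u) / 2) * Cst (of_int (th v) / 2) = c ((e' + d) * th u * th v)"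
      by (simp add: c_def del: Cst_simps flip: Cst_simps(4))
    moreover have "x * (y * u) * (z * w) = (x * y * z) * (u * w)" for x y z u w :: "gen cpoly"
      by (simp only: ac_simps)
    ultimately show ?thesis unfolding red_simps G that red_of_int Cst_of_int[symmetric] by metis
  qed
  have thI: "th (x + int n * k) = 0" if "\<bar>x\<bar> < int n" "k < 0" for x k
    using sg[OF that(1), of k] that(2) by (simp add: th_def)
  \<comment> \<open>For \<open>m > 0\<close> the translation dominates and the sign is
    \<open>d\<close>, giving \<open>2 d\<close>; for \<open>m = 0\<close> the sign of
    \<open>x\<close> survives. The prefactor thus depends on the lifted points alone.\<close>
  have brc: "br_coef (sgn x) d m = of_int (sgn (x + int n * (d * int m)) + d)"
    if "\<bar>x\<bar> < int n" "d = 1 \<or> d = -1" for x d m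
    using that sg[OF that(1), of "d * int m"] by (auto simp: br_coef_def sgn_mult)
  define P where "P t = sym_gen n p J (K t) * sym_gen n p I (L t)" for t
  define Q where "Q t = sym_gen n p I (K t) * sym_gen n p J (L t)" for t
  note gi = red_G_int[OF n p]
  have ra: "red p (G_int d q i) = Cst (of_int (th (J - K t)) / 2) * sym_gen n p J (K t)" if "int r - t = d" for t d
    using gi[OF idx(3,2) that] by (simp add: th_def J_def K_def sym_gen_commute[OF n p])
  have rb: "red p (G_int d j l) = Cst (of_int (th (L t - I)) / 2) * sym_gen n p I (L t)" if "int s + t = d" for t d
    using gi[OF idx(1,4), of "int s + t" 0 d] that by (simp add: th_def I_def L_def)
  have rc: "red p (G_int d j q) = Cst (of_int (th (K t - I)) / 2) * sym_gen n p I (K t)" if "t = d" for t d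
    using gi[OF idx(1,3), of t 0 d] that by (simp add: th_def I_def K_def)
  have rd: "red p (G_int d i l) = Cst (of_int (th (L t - J)) / 2) * sym_gen n p J (L t)" if "int s + t - int r = d" for t d
    using gi[OF idx(2,4) that] by (simp add: th_def J_def L_def)
  have re: "red p (G_int d l i) = Cst (of_int (th (J - L t)) / 2) * sym_gen n p J (L t)" if "int r - (int s + t) = d" for t d
    using gi[OF idx(4,2) that] by (simp add: th_def J_def L_def sym_gen_commute[OF n p])
  have rf: "red p (G_int d q j) = Cst (of_int (th (I - K t)) / 2) * sym_gen n p I (K t)" if "- t = d" for t d
    using gi[OF idx(3,1), of 0 t d] that by (simp add: th_def I_def K_def sym_gen_commute[OF n p])
  have IK: "I - K t = int j - int q + int n * (- t)" and JL: "J - L t = int i - int l + int n * (int r - int s - t)"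
    and JK: "J - K t = int i - int q + int n * (int r - t)" and IL: "I - L t = int j - int l + int n * (- (int s + t))"
    and KI: "K t - I = int q - int j + int n * t" and LI: "L t - I = int l - int j + int n * (int s + t)" for t
    by (simp_all add: I_def J_def K_def L_def algebra_simps)
  have abs: "\<bar>int x - int y\<bar> < int n" if "x < n" "y < n" for x y
    using that by linarith
  have 1: "red p (\<Sum>m\<le>r. br_coef (sgn (int j - int q)) (-1) m * G_coeff (r - m) q i * G_int (int s + int m) j l)
      = (\<Sum>t\<in>T. c ((sgn (I - K t) - 1) * th (J - K t) * th (L t - I)) * P t)"
    unfolding red_sum
  proof (rule sum_reindex_neutral[where \<phi> = int])
    fix m assume m: "m \<in> {..r}"
    show "red p (br_coef (sgn (int j - int q)) (-1) m * G_coeff (r - m) q i * G_int (int s + int m) j l) =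
        c ((sgn (I - K (int m)) - 1) * th (J - K (int m)) * th (L (int m) - I)) * P (int m)"
      unfolding P_def using m
      by (subst summand[where e' = "sgn (I - K (int m))" and d = "-1", OF _ ra rb])
         (auto simp: IK brc[OF abs] idx)
  next
    fix t assume "t \<in> T - int ` {..r}"
    then have "t < 0 \<or> t > int r" by (auto simp: image_iff) (metis atMost_iff int_nat_eq not_less nat_le_iff)
    \<comment> \<open>Before the range the sign factor is zero, after it the Heaviside factor. The
      other three sums are treated alike.\<close>
    then have "sgn (I - K t) = 1 \<or> th (J - K t) = 0"
      using sg[OF abs[OF idx(1,3)], of "- t"] thI[OF abs[OF idx(2,3)], of "int r - t"]
      by (auto simp: IK JK)
    then show "c ((sgn (I - K t) - 1) * th (J - K t) * th (L t - I)) * P t = 0"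
      by (auto simp: c_def)
  qed (use T in auto)
  have 2: "red p (\<Sum>m\<le>r. br_coef (sgn (int i - int l)) 1 m * G_coeff (r - m) j l * G_int (int s + int m) q i)
      = (\<Sum>t\<in>T. c ((sgn (J - L t) + 1) * th (J - K t) * th (L t - I)) * P t)"
    unfolding red_sum
  proof (rule sum_reindex_neutral[where \<phi> = "\<lambda>m. int r - int s - int m"])
    fix m assume m: "m \<in> {..r}"
    let ?t = "int r - int s - int m"
    show "red p (br_coef (sgn (int i - int l)) 1 m * G_coeff (r - m) j l * G_int (int s + int m) q i) =
        c ((sgn (J - L ?t) + 1) * th (J - K ?t) * th (L ?t - I)) * P ?t"
      unfolding P_def using m
      by (subst summand[where e' = "sgn (J - L ?t)" and d = 1, OF _ rb[where t = ?t] ra[where t = ?t]])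
         (auto simp: JL brc[OF abs] idx mult_ac)
  next
    fix t assume t: "t \<in> T - (\<lambda>m. int r - int s - int m) ` {..r}"
    have "t < - int s \<or> t > int r - int s"
    proof (rule ccontr)
      assume "\<not> ?thesis"
      then have "t = int r - int s - int (nat (int r - int s - t))" "nat (int r - int s - t) \<in> {..r}" by auto
      with t show False by blast
    qed
    then have "sgn (J - L t) = -1 \<or> th (L t - I) = 0"
      using sg[OF abs[OF idx(2,4)], of "int r - int s - t"] thI[OF abs[OF idx(4,1)], of "int s + t"]
      by (auto simp: JL LI)
    then show "c ((sgn (J - L t) + 1) * th (J - K t) * th (L t - I)) * P t = 0"
      by (auto simp: c_def)
  qed (use T in \<open>auto intro: inj_onI\<close>)
  have 3: "red p (\<Sum>m\<le>r. br_coef (sgn (int i - int q)) 1 m * G_coeff (r - m) j q * G_int (int s - int m) i l)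
      = (\<Sum>t\<in>T. c ((sgn (J - K t) + 1) * th (K t - I) * th (L t - J)) * Q t)"
    unfolding red_sum
  proof (rule sum_reindex_neutral[where \<phi> = "\<lambda>m. int r - int m"])
    fix m assume m: "m \<in> {..r}"
    let ?t = "int r - int m"
    show "red p (br_coef (sgn (int i - int q)) 1 m * G_coeff (r - m) j q * G_int (int s - int m) i l) =
        c ((sgn (J - K ?t) + 1) * th (K ?t - I) * th (L ?t - J)) * Q ?t"
      unfolding Q_def using m
      by (subst summand[where e' = "sgn (J - K ?t)" and d = 1, OF _ rc[where t = ?t] rd[where t = ?t]])
         (auto simp: JK brc[OF abs] idx of_nat_diff)
  next
    fix t assume t: "t \<in> T - (\<lambda>m. int r - int m) ` {..r}"
    have "t < 0 \<or> t > int r"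
    proof (rule ccontr)
      assume "\<not> ?thesis"
      then have "t = int r - int (nat (int r - t))" "nat (int r - t) \<in> {..r}" by auto
      with t show False by blast
    qed
    then have "sgn (J - K t) = -1 \<or> th (K t - I) = 0"
      using sg[OF abs[OF idx(2,3)], of "int r - t"] thI[OF abs[OF idx(3,1)], of "t"]
      by (auto simp: JK KI)
    then show "c ((sgn (J - K t) + 1) * th (K t - I) * th (L t - J)) * Q t = 0"
      by (auto simp: c_def)
  qed (use T in \<open>auto intro: inj_onI\<close>)
  have 4: "red p (\<Sum>m\<le>r. br_coef (sgn (int j - int l)) (-1) m * G_coeff (r - m) l i * G_int (int s - int m) q j)
      = (\<Sum>t\<in>T. c ((sgn (I - L t) - 1) * th (J - L t) * th (I - K t)) * Q t)"
    unfolding red_sum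
  proof (rule sum_reindex_neutral[where \<phi> = "\<lambda>m. int m - int s"])
    fix m assume m: "m \<in> {..r}"
    let ?t = "int m - int s"
    show "red p (br_coef (sgn (int j - int l)) (-1) m * G_coeff (r - m) l i * G_int (int s - int m) q j) =
        c ((sgn (I - L ?t) - 1) * th (J - L ?t) * th (I - K ?t)) * Q ?t"
      unfolding Q_def using m
      by (subst summand[where e' = "sgn (I - L ?t)" and d = "-1", OF _ re[where t = ?t] rf[where t = ?t]])
         (auto simp: IL brc[OF abs] idx of_nat_diff mult_ac)
  next
    fix t assume t: "t \<in> T - (\<lambda>m. int m - int s) ` {..r}"
    have "t < - int s \<or> t > int r - int s"
    proof (rule ccontr)
      assume "\<not> ?thesis"
      then have "t = int (nat (t + int s)) - int s" "nat (t + int s) \<in> {..r}" by auto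
      with t show False by blast
    qed
    then have "sgn (I - L t) = 1 \<or> th (J - L t) = 0"
      using sg[OF abs[OF idx(1,4)], of "- (int s + t)"] thI[OF abs[OF idx(2,4)], of "int r - int s - t"]
      by (auto simp: JL IL)
    then show "c ((sgn (I - L t) - 1) * th (J - L t) * th (I - K t)) * Q t = 0"
      by (auto simp: c_def)
  qed (use T in \<open>auto intro: inj_onI\<close>)
  have c_add: "c x * z + c y * z = c (x + y) * z" for x y z
    by (simp add: c_def add_divide_distrib distrib_right)
  have c4: "c (4 * x) = of_int x" for x
    unfolding c_def by (simp only: of_int_mult of_int_numeral nonzero_mult_div_cancel_left
        zero_neq_numeral[symmetric] not_False_eq_True Cst_of_int)
  have "red p (gen_bracket (r, j, i) (s, q, l)) =
      (\<Sum>t\<in>T. c (4 * chord_sgn I J (K t) (L t)) * P t + c (- 4 * chord_sgn I J (K t) (L t)) * Q t)"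
    unfolding gen_bracket_expand red_simps(3) 1 2 3 4
    by (simp only: chord_sgn_identities[OF IJ KL, symmetric] th_def c_add[symmetric] sum.distrib add.assoc)
  also have "\<dots> = (\<Sum>t\<in>T. of_int (chord_sgn I J (K t) (L t)) * (P t - Q t))"
  proof (intro sum.cong refl)
    fix t
    have "c (- 4 * x) = - c (4 * x)" for x by (simp add: c_def)
    then show "c (4 * chord_sgn I J (K t) (L t)) * P t + c (- 4 * chord_sgn I J (K t) (L t)) * Q t =
        of_int (chord_sgn I J (K t) (L t)) * (P t - Q t)"
      by (simp only: c4 right_diff_distrib) simp
  qed
  finally show ?thesis unfolding P_def Q_def .
qed

end

text \<open>The regularised sum of \<open>sgn (x - N w)\<close> over all integers \<open>w\<close>; it turns the crossing numbers of chords on the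
  line into those on the circle.\<close>

definition stairs :: "int \<Rightarrow> int \<Rightarrow> int" where
  "stairs N x = x div N - (- x) div N"

lemma stairs_add_mult: "N > 0 \<Longrightarrow> stairs N (x + N * w) = stairs N x + 2 * w"
  using div_mult_self2[of N x w] div_mult_self2[of N "- x" "- w"] by (simp add: stairs_def)

lemma stairs_0 [simp]: "stairs N 0 = 0"
  by (simp add: stairs_def)

lemma stairs_uminus: "stairs N (- x) = - stairs N x"
  by (simp add: stairs_def)

lemma stairs_pos: "0 < x \<Longrightarrow> x < N \<Longrightarrow> stairs N x = 1"
  by (simp add: stairs_def zdiv_zminus1_eq_if)

lemma div_less_int_iff:
  fixes x N w :: int
  assumes "N > 0"
  shows "x div N < w \<longleftrightarrow> x < N * w"
proof
  assume "x div N < w"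
  then have "N * (x div N + 1) \<le> N * w" using assms by (intro mult_left_mono) auto
  moreover have "x < N * (x div N + 1)"
    using mult_div_mod_eq[of N x] pos_mod_bound[OF assms, of x]
    unfolding distrib_left mult_1_right by linarith
  ultimately show "x < N * w" by simp
next
  assume *: "x < N * w"
  show "x div N < w"
  proof (rule ccontr)
    assume "\<not> x div N < w"
    then have "N * w \<le> N * (x div N)" using assms by (intro mult_left_mono) auto
    then show False using * mult_div_mod_eq[of N x] pos_mod_sign[OF assms, of x] by linarith
  qed
qed

text \<open>\<open>stairs\<close> is the floor plus the ceiling of \<open>y / N\<close>, so it
  counts translates below and above \<open>y\<close>. The extra 1 comes from the half-open window,
  in which \<open>w = - W\<close> has no partner; it cancels in crossing numbers, where two signs
  enter positively and two negatively.\<close>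

lemma sum_sgn_conv_stairs:
  assumes "N > 0" "- (N * W) \<le> y" "y < N * W"
  shows "(\<Sum>w\<in>{-W..<W}. sgn (y - N * w)) = stairs N y + 1"
proof -
  define c where "c = - ((- y) div N)"
  define b where "b = y div N"
  have b: "- W \<le> b" "b < W"
    using assms div_less_int_iff[of N y "- W"] div_less_int_iff[of N y W]
    by (simp_all add: b_def)
  have "- y \<le> N * W" using assms by simp
  then have "(- y) div N \<le> W" using zdiv_mono1[of "- y" "N * W" N] assms(1) by simp
  moreover have "- W \<le> (- y) div N"
    using div_less_int_iff[of N "- y" "- W"] assms by simp
  ultimately have c: "- W \<le> c" "c \<le> W" by (auto simp: c_def)
  have 1: "N * w < y \<longleftrightarrow> w < c" for w
  proof -
    have "w < c \<longleftrightarrow> (- y) div N < - w" by (auto simp: c_def)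
    also have "\<dots> \<longleftrightarrow> - y < N * (- w)" using assms(1) by (rule div_less_int_iff)
    finally show ?thesis by auto
  qed
  have 2: "y < N * w \<longleftrightarrow> b < w" for w
    using div_less_int_iff[OF assms(1), of y w] by (simp add: b_def)
  have "sgn (y - N * w) = (if w < c then 1 else 0) - (if b < w then 1 else 0)" for w
    using 1[of w] 2[of w] by (auto simp: sgn_if)
  then have "(\<Sum>w\<in>{-W..<W}. sgn (y - N * w)) =
      int (card {w \<in> {-W..<W}. w < c}) - int (card {w \<in> {-W..<W}. b < w})"
    by (simp add: sum_subtractf sum.If_cases Int_def)
  also have "{w \<in> {-W..<W}. w < c} = {-W..<c}" using c by auto
  also have "{w \<in> {-W..<W}. b < w} = {b+1..<W}" using b by auto
  finally show ?thesis using b c by (simp add: stairs_def b_def c_def)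
qed

section \<open>Folding sums over the line onto the circle\<close>

lemma periodic_sum_shift:
  fixes f :: "int \<Rightarrow> 'a :: comm_monoid_add"
  assumes "p > 0" "\<And>t w. f (t + p * w) = f t"
  shows "(\<Sum>t\<in>{0..<p}. f (t + u)) = (\<Sum>t\<in>{0..<p}. f t)"
proof -
  have "f (t mod p) = f t" for t
    using assms(2)[of "t mod p" "t div p"] by simp
  then show ?thesis
    using assms(1)
    by (intro sum.reindex_bij_witness[where i = "\<lambda>t. (t - u) mod p" and j = "\<lambda>t. (t + u) mod p"])
       (auto simp: mod_diff_left_eq mod_add_left_eq)
qed

lemma sum_interval_mod:
  fixes f :: "int \<Rightarrow> 'a :: comm_monoid_add"
  assumes "p > 0"
  shows "(\<Sum>t\<in>{-(W * p)..<W * p}. f t) = (\<Sum>t\<in>{0..<p}. \<Sum>w\<in>{-W..<W}. f (t + p * w))"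
proof -
  have 1: "- W \<le> t div p" "t div p < W" if "- (W * p) \<le> t" "t < W * p" for t
    using that assms div_less_int_iff[of p t "- W"] div_less_int_iff[of p t W]
    by (simp_all add: mult.commute)
  have 2: "- (W * p) \<le> t + p * w" "t + p * w < W * p" if "0 \<le> t" "t < p" "- W \<le> w" "w < W" for t w
  proof -
    have "p * (- W) \<le> p * w" using that assms by (intro mult_left_mono) auto
    then show "- (W * p) \<le> t + p * w" using that by (simp add: mult.commute)
    have "p * (w + 1) \<le> p * W" using that assms by (intro mult_left_mono) auto
    then show "t + p * w < W * p" using that by (simp add: mult.commute distrib_left)
  qed
  show ?thesis
    unfolding sum.cartesian_product using assms
    by (intro sum.reindex_bij_witness[where i = "\<lambda>(t, w). t + p * w" and j = "\<lambda>t. (t mod p, t div p)"])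
       (auto simp: 1 2)
qed

text \<open>\<open>chord_sgn\<close> with \<open>sgn\<close> replaced by its periodised
  form.\<close>

definition cyc :: "int \<Rightarrow> int \<Rightarrow> int \<Rightarrow> int \<Rightarrow> int \<Rightarrow> int" where
  "cyc N I J K L = stairs N (I - K) - stairs N (J - K) + stairs N (J - L) - stairs N (I - L)"

text \<open>Defined for arbitrary pairs of integers, so that invariance under reversal, rotation and
  periods can be proved before representatives in \<open>gens_red\<close> are chosen.\<close>

definition cyc_bracket :: "nat \<Rightarrow> nat \<Rightarrow> int \<Rightarrow> int \<Rightarrow> int \<Rightarrow> int \<Rightarrow> gen cpoly" where
  "cyc_bracket n p I J K L = (\<Sum>t\<in>{0..<int p}.
     of_int (cyc (int n * int p) I J (K + int n * t) (L + int n * t)) *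
     (sym_gen n p J (K + int n * t) * sym_gen n p I (L + int n * t)
      - sym_gen n p I (K + int n * t) * sym_gen n p J (L + int n * t)))"

definition label :: "nat \<Rightarrow> gen \<Rightarrow> int \<times> int" where
  "label n x = (case x of (k, i, j) \<Rightarrow> (int i, int j + int n * int k))"

context
  fixes n p :: nat
  assumes n: "0 < n" and p: "0 < p"
begin

lemma N_pos: "0 < (int n * int p)" using n p by simp

lemma sym_gen_periodic: "sym_gen n p I (J + (int n * int p) * w) = sym_gen n p I J" "sym_gen n p (I + (int n * int p) * w) J = sym_gen n p I J"
  using sym_gen_period[OF n p, of I J w] sym_gen_period[OF n p, of J I w]
    sym_gen_commute[OF n p, of I J] sym_gen_commute[OF n p, of "I + int n * (int p * w)" J]
  by (simp_all add: mult.assoc)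

lemma cyc_shift: "cyc (int n * int p) (I + x) (J + x) (K + x) (L + x) = cyc (int n * int p) I J K L"
  by (simp add: cyc_def)

lemma cyc_period:
  "cyc (int n * int p) (I + (int n * int p) * w) J K L = cyc (int n * int p) I J K L" "cyc (int n * int p) I (J + (int n * int p) * w) K L = cyc (int n * int p) I J K L"
  "cyc (int n * int p) I J (K + (int n * int p) * w) L = cyc (int n * int p) I J K L" "cyc (int n * int p) I J K (L + (int n * int p) * w) = cyc (int n * int p) I J K L"
proof -
  have "stairs (int n * int p) (x + (int n * int p) * w - y) = stairs (int n * int p) (x - y) + 2 * w"
    "stairs (int n * int p) (y - (x + (int n * int p) * w)) = stairs (int n * int p) (y - x) - 2 * w" for x y
    using stairs_add_mult[OF N_pos, of "x - y" w] stairs_add_mult[OF N_pos, of "y - x" "- w"]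
    by (simp_all add: algebra_simps)
  then show "cyc (int n * int p) (I + (int n * int p) * w) J K L = cyc (int n * int p) I J K L" "cyc (int n * int p) I (J + (int n * int p) * w) K L = cyc (int n * int p) I J K L"
  "cyc (int n * int p) I J (K + (int n * int p) * w) L = cyc (int n * int p) I J K L" "cyc (int n * int p) I J K (L + (int n * int p) * w) = cyc (int n * int p) I J K L"
    by (simp_all add: cyc_def)
qed

lemma cyc_swap: "cyc (int n * int p) J I K L = - cyc (int n * int p) I J K L"
  by (simp add: cyc_def)

lemma cyc_bracket_swap: "cyc_bracket n p J I K L = cyc_bracket n p I J K L"
  unfolding cyc_bracket_def by (intro sum.cong refl) (simp add: cyc_swap[of J I] algebra_simps)

lemma cyc_bracket_period: "cyc_bracket n p I (J + (int n * int p) * w) K L = cyc_bracket n p I J K L"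
  by (simp add: cyc_bracket_def sym_gen_periodic cyc_period)

text \<open>Moving the first chord forwards amounts to moving the second one backwards, which only
  renumbers a periodic sum.\<close>

lemma cyc_bracket_shift:
  "cyc_bracket n p (I + int n * u) (J + int n * u) K L = cyc_bracket n p I J K L"
proof -
  define f where "f t = of_int (cyc (int n * int p) I J (K + int n * t) (L + int n * t)) *
     (sym_gen n p J (K + int n * t) * sym_gen n p I (L + int n * t) - sym_gen n p I (K + int n * t) * sym_gen n p J (L + int n * t))" for t
  have per: "f (t + int p * w) = f t" for t w
  proof -
    have "x + int n * (t + int p * w) = (x + int n * t) + (int n * int p) * w" for x
      by (simp add: algebra_simps)
    then show ?thesis unfolding f_def by (simp only: sym_gen_periodic cyc_period)
  qed
  have sh: "x + int n * (t + - u) + int n * u = x + int n * t" for x t by (simp add: algebra_simps)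
  have "cyc_bracket n p (I + int n * u) (J + int n * u) K L = (\<Sum>t\<in>{0..<int p}. f (t + - u))"
    unfolding cyc_bracket_def f_def
  proof (intro sum.cong refl)
    fix t
    have c: "cyc (int n * int p) (I + int n * u) (J + int n * u) (K + int n * t) (L + int n * t) =
        cyc (int n * int p) I J (K + int n * (t + - u)) (L + int n * (t + - u))"
      using cyc_shift[of I "int n * u" J "K + int n * (t + - u)" "L + int n * (t + - u)"]
      by (simp only: sh)
    have s: "sym_gen n p (x + int n * u) (y + int n * t) = sym_gen n p x (y + int n * (t + - u))" for x y
      using sym_gen_shift[OF n p, of x u "y + int n * (t + - u)"] by (simp only: sh)
    show "of_int (cyc (int n * int p) (I + int n * u) (J + int n * u) (K + int n * t) (L + int n * t)) *
      (sym_gen n p (J + int n * u) (K + int n * t) * sym_gen n p (I + int n * u) (L + int n * t) -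
       sym_gen n p (I + int n * u) (K + int n * t) * sym_gen n p (J + int n * u) (L + int n * t)) =
      of_int (cyc (int n * int p) I J (K + int n * (t + - u)) (L + int n * (t + - u))) *
      (sym_gen n p J (K + int n * (t + - u)) * sym_gen n p I (L + int n * (t + - u)) -
       sym_gen n p I (K + int n * (t + - u)) * sym_gen n p J (L + int n * (t + - u)))"
      by (simp only: c s)
  qed
  also have "\<dots> = (\<Sum>t\<in>{0..<int p}. f t)"
    by (rule periodic_sum_shift) (use p per in auto)
  finally show ?thesis unfolding f_def cyc_bracket_def .
qed

lemma cyc_bracket_diag: "cyc_bracket n p I (I + (int n * int p) * w) K L = 0"
  unfolding cyc_bracket_period by (simp add: cyc_bracket_def cyc_def)

text \<open>The translation \<open>t\<close> is split into a residue and a multiple of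
  \<open>p\<close>. The quadratic terms depend on the residue only, and the signs add up over the
  multiples to the crossing number on the circle.\<close>

lemma red_gen_bracket:
  assumes xy: "(r, j, i) \<in> gens n" "(s, q, l) \<in> gens n"
  shows "red p (gen_bracket (r, j, i) (s, q, l)) =
    cyc_bracket n p (int j) (int i + int n * int r) (int q) (int l + int n * int s)"
proof -
  have idx: "j < n" "i < n" "q < n" "l < n" and lt: "r = 0 \<Longrightarrow> j < i" "s = 0 \<Longrightarrow> q < l"
    using xy by (auto simp: gens_def)
  \<comment> \<open>Large enough for the window to contain the interval that
    \<open>red_gen_bracket_line\<close> asks for, and for all differences of endpoints to satisfy
    the bounds of \<open>sum_sgn_conv_stairs\<close>.\<close>
  define W where "W = int r + int s + int p + 2"
  define I where "I = int j"
  define J where "J = int i + int n * int r"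
  define K where "K t = int q + int n * t" for t
  define L where "L t = int l + int n * (int s + t)" for t
  have W: "0 < W" by (simp add: W_def)
  have ge: "W \<le> W * int p" using p W by (simp add: mult_le_cancel_left1)
  have sub: "{- int s - int r..int r + int s} \<subseteq> {-(W * int p)..<W * int p}"
  proof -
    have "int r + int s < W" by (simp add: W_def)
    then show ?thesis using ge unfolding subset_iff atLeastAtMost_iff atLeastLessThan_iff by linarith
  qed
  have KN: "K (t + int p * w) = K t + (int n * int p) * w" and LN: "L (t + int p * w) = L t + (int n * int p) * w" for t w
    by (simp_all add: K_def L_def algebra_simps)
  define f where "f t = (sym_gen n p J (K t) * sym_gen n p I (L t) - sym_gen n p I (K t) * sym_gen n p J (L t))" for t
  have f: "f (t + int p * w) = f t" for t w
    by (simp add: f_def KN LN sym_gen_periodic)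
  have bound: "- ((int n * int p) * W) \<le> x - y + int n * k \<and> x - y + int n * k < (int n * int p) * W"
    if "0 \<le> x" "x < int n" "0 \<le> y" "y < int n" "\<bar>k\<bar> < W" for x y k
  proof -
    have "int n * (k + 1) \<le> int n * W" using that by (intro mult_left_mono) auto
    moreover have "int n * (- W) \<le> int n * (k - 1)" using that by (intro mult_left_mono) auto
    moreover have "int n * W \<le> int n * (W * int p)" using ge by (intro mult_left_mono) auto
    ultimately show ?thesis using that by (simp add: algebra_simps)
  qed
  have ch: "(\<Sum>w\<in>{-W..<W}. chord_sgn I J (K (t + int p * w)) (L (t + int p * w))) = cyc (int n * int p) I J (K t) (L t)"
    if t: "0 \<le> t" "t < int p" for t
  proof -
    have "chord_sgn I J (K (t + int p * w)) (L (t + int p * w)) =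
        sgn ((I - K t) - (int n * int p) * w) + sgn ((J - L t) - (int n * int p) * w) - sgn ((J - K t) - (int n * int p) * w) - sgn ((I - L t) - (int n * int p) * w)" for w
    proof -
      have "sgn (x - y) = - sgn (y - x)" for x y :: int by (simp add: sgn_if)
      from this[of "K t + (int n * int p) * w" J] this[of "L t + (int n * int p) * w" I] show ?thesis
        unfolding chord_sgn_def KN LN by (simp add: algebra_simps)
    qed
    then have "(\<Sum>w\<in>{-W..<W}. chord_sgn I J (K (t + int p * w)) (L (t + int p * w))) =
       (\<Sum>w\<in>{-W..<W}. sgn ((I - K t) - (int n * int p) * w)) + (\<Sum>w\<in>{-W..<W}. sgn ((J - L t) - (int n * int p) * w))
       - (\<Sum>w\<in>{-W..<W}. sgn ((J - K t) - (int n * int p) * w)) - (\<Sum>w\<in>{-W..<W}. sgn ((I - L t) - (int n * int p) * w))"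
      by (simp add: sum.distrib sum_subtractf)
    also have "\<dots> = cyc (int n * int p) I J (K t) (L t)"
    proof -
      have "- ((int n * int p) * W) \<le> I - K t \<and> I - K t < (int n * int p) * W" using bound[of "int j" "int q" "- t"] idx t
        by (simp add: I_def K_def W_def algebra_simps)
      moreover have "- ((int n * int p) * W) \<le> J - K t \<and> J - K t < (int n * int p) * W" using bound[of "int i" "int q" "int r - t"] idx t
        by (simp add: J_def K_def W_def algebra_simps)
      moreover have "- ((int n * int p) * W) \<le> I - L t \<and> I - L t < (int n * int p) * W" using bound[of "int j" "int l" "- int s - t"] idx t
        by (simp add: I_def L_def W_def algebra_simps)
      moreover have "- ((int n * int p) * W) \<le> J - L t \<and> J - L t < (int n * int p) * W" using bound[of "int i" "int l" "int r - int s - t"] idx t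
        by (simp add: J_def L_def W_def algebra_simps)
      ultimately show ?thesis by (simp add: sum_sgn_conv_stairs[OF N_pos] cyc_def)
    qed
    finally show ?thesis .
  qed
  have "red p (gen_bracket (r, j, i) (s, q, l)) =
      (\<Sum>t\<in>{-(W * int p)..<W * int p}. of_int (chord_sgn I J (K t) (L t)) * f t)"
    unfolding f_def I_def J_def K_def L_def
    by (rule red_gen_bracket_line[OF n p idx _ sub lt]) auto
  also have "\<dots> = (\<Sum>t\<in>{0..<int p}. \<Sum>w\<in>{-W..<W}.
      of_int (chord_sgn I J (K (t + int p * w)) (L (t + int p * w))) * f (t + int p * w))"
    using p by (subst sum_interval_mod) auto
  also have "\<dots> = (\<Sum>t\<in>{0..<int p}. of_int (cyc (int n * int p) I J (K t) (L t)) * f t)"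
    by (intro sum.cong refl) (simp add: f flip: ch sum_distrib_right)
  also have "\<dots> = cyc_bracket n p I J (int q) (int l + int n * int s)"
    by (simp add: cyc_bracket_def f_def K_def L_def distrib_left add.assoc)
  finally show ?thesis by (simp add: I_def J_def)
qed

text \<open>The heart of the compatibility of bracket and relations: generators that are identified
  have the same chord up to reversal, rotation and periods, hence the same brackets. The constant 2
  belongs to degenerate chords, whose brackets vanish by \<open>cyc_bracket_diag\<close>.\<close>

lemma red_gen_cases:
  assumes "(r, j, i) \<in> gens n"
  shows "red_gen p (r, j, i) = 2 \<and> i = j \<and> p dvd r \<or>
    (\<exists>r' j' i'. (r', j', i') \<in> gens_red n p \<and> red_gen p (r, j, i) = Var (r', j', i') \<and>
      (\<forall>K L. cyc_bracket n p (int j') (int i' + int n * int r') K L =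
             cyc_bracket n p (int j) (int i + int n * int r) K L))"
proof -
  have idx: "j < n" "i < n" using assms by (auto simp: gens_def)
  define r0 where "r0 = r mod p"
  have r0: "r0 < p" using p by (simp add: r0_def)
  have "int r = int r0 + int p * int (r div p)"
    by (metis mod_mult_div_eq of_nat_add of_nat_mult r0_def)
  then have "int i + int n * int r = (int i + int n * int r0) + (int n * int p) * int (r div p)"
    by (simp add: algebra_simps)
  then have B: "cyc_bracket n p (int j) (int i + int n * int r) K L =
      cyc_bracket n p (int j) (int i + int n * int r0) K L" for K L
    by (simp only: cyc_bracket_period)
  have Bt: "cyc_bracket n p (int i) (int j + int n * int (p - r0)) K L =
      cyc_bracket n p (int j) (int i + int n * int r0) K L" for K L
  proof -
    have "int j + int n * int (p - r0) = int j + int n * (- int r0) + (int n * int p) * 1"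
      using r0 by (simp add: of_nat_diff algebra_simps)
    then have "cyc_bracket n p (int i) (int j + int n * int (p - r0)) K L =
        cyc_bracket n p (int i) (int j + int n * (- int r0)) K L"
      by (simp only: cyc_bracket_period)
    also have "\<dots> = cyc_bracket n p (int i + int n * int r0) (int j) K L"
      using cyc_bracket_shift[of "int i" "int r0" "int j + int n * (- int r0)"]
      by (simp add: algebra_simps)
    finally show ?thesis by (simp only: cyc_bracket_swap[of "int j"])
  qed
  consider "r0 = 0" "i = j" | "r0 = 0" "i \<noteq> j" | "r0 > 0" "2 * r0 < p \<or> (2 * r0 = p \<and> j \<le> i)"
    | "r0 > 0" "\<not> (2 * r0 < p \<or> (2 * r0 = p \<and> j \<le> i))" by linarith
  then show ?thesis
  proof cases
    case 1
    then show ?thesis by (auto simp: r0_def red_gen.simps Let_def)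
  next
    case 2
    have mm: "cyc_bracket n p (int (min j i)) (int (max j i)) K L = cyc_bracket n p (int j) (int i) K L" for K L
      by (cases "j \<le> i") (simp_all add: min_def max_def cyc_bracket_swap)
    show ?thesis
      by (rule disjI2, rule exI[of _ 0], rule exI[of _ "min j i"], rule exI[of _ "max j i"])
         (use mm 2 idx in \<open>auto simp: B r0_def[symmetric] red_gen.simps Let_def gens_red_def\<close>)
  next
    case 3
    show ?thesis
      by (rule disjI2, rule exI[of _ r0], rule exI[of _ j], rule exI[of _ i])
         (use 3 idx in \<open>auto simp: B r0_def[symmetric] red_gen.simps Let_def gens_red_def\<close>)
  next
    case 4
    show ?thesis
      by (rule disjI2, rule exI[of _ "p - r0"], rule exI[of _ i], rule exI[of _ j])
         (use 4 idx r0 in \<open>auto simp: B Bt Bt[unfolded of_nat_diff[OF less_imp_le[OF r0]]] r0_def[symmetric] red_gen.simps Let_def gens_red_def\<close>)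
  qed
qed

end

lemma finite_gens_red: "finite (gens_red n p)"
proof (rule finite_subset)
  show "gens_red n p \<subseteq> {..p} \<times> {..<n} \<times> {..<n}" by (auto simp: gens_red_def)
qed auto

lemma D_bracket_Var: "D_bracket (Var x) (Var y) = gen_bracket x y"
  by (simp add: D_bracket_def biderivation_def pdiff_Var)

text \<open>Bracketing with a retained generator commutes with the reduction, so brackets may be
  computed with the full series \<open>G(\<lambda>)\<close> and reduced afterwards.\<close>

lemma vder_red_gen:
  assumes "0 < n" "0 < p" and x: "x \<in> gens n" and y: "y \<in> gens_red n p"
  shows "vder (gens_red n p) (\<lambda>x. red p (D_bracket (Var x) (Var y))) (red_gen p x) =
     red p (gen_bracket x y)"
proof -
  obtain r j i where xe: "x = (r, j, i)" by (cases x)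
  obtain s q l where ye: "y = (s, q, l)" by (cases y)
  have yg: "(s, q, l) \<in> gens n" using y gens_red_subset by (auto simp: ye)
  have two: "vder X v 2 = 0" for X :: "gen set" and v
    using vder_Cst[of X v 2] by simp
  from red_gen_cases[OF assms(1,2) x[unfolded xe]] show ?thesis
  proof (elim disjE exE conjE)
    assume "red_gen p (r, j, i) = 2" "i = j" "p dvd r"
    moreover from this obtain w where "int r = int p * int w" by (metis dvdE of_nat_mult)
    ultimately show ?thesis
      using cyc_bracket_diag[OF assms(1,2), of "int j" "int w"] red_gen_bracket[OF assms(1,2) x[unfolded xe] yg]
      by (simp add: xe ye two mult.assoc)
  next
    fix r' j' i'
    assume x': "(r', j', i') \<in> gens_red n p" "red_gen p (r, j, i) = Var (r', j', i')"
      and eq: "\<forall>K L. cyc_bracket n p (int j') (int i' + int n * int r') K L =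
             cyc_bracket n p (int j) (int i + int n * int r) K L"
    have "(r', j', i') \<in> gens n" using x'(1) gens_red_subset by blast
    then show ?thesis
      using red_gen_bracket[OF assms(1,2) _ yg, of r' j' i'] red_gen_bracket[OF assms(1,2) x[unfolded xe] yg] eq
      by (simp add: xe x' vder_Var finite_gens_red D_bracket_Var ye del: gen_bracket.simps)
  qed
qed

section \<open>Central determinants\<close>

lemma red_numeral [simp]: "red p (numeral w) = numeral w"
  using red_simps(7)[of p "numeral w"] by (simp del: red_simps)

locale derivation =
  fixes D :: "'a :: comm_ring_1 \<Rightarrow> 'a"
  assumes add: "D (x + y) = D x + D y" and mult: "D (x * y) = D x * y + x * D y"
begin

lemma zero [simp]: "D 0 = 0"
  using add[of 0 0] by simp

lemma one [simp]: "D 1 = 0"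
  using mult[of 1 1] by simp

lemma uminus: "D (- x) = - D x"
  using add[of x "- x"] by (simp add: eq_neg_iff_add_eq_0 add.commute)

lemma sum: "D (sum f A) = (\<Sum>x\<in>A. D (f x))"
  by (induction A rule: infinite_finite_induct) (simp_all add: add)

lemma prod:
  assumes "finite A"
  shows "D (prod f A) = (\<Sum>x\<in>A. D (f x) * prod f (A - {x}))"
  using assms
proof (induction A rule: finite_induct)
  case (insert a A)
  have "D (f x) * prod f (insert a A - {x}) = f a * (D (f x) * prod f (A - {x}))" if "x \<in> A" for x
  proof -
    have "insert a A - {x} = insert a (A - {x})" using insert that by auto
    then show ?thesis using insert by (simp add: ac_simps)
  qed
  then show ?case using insert by (simp add: mult sum_distrib_left)
qed simp

lemma power_eq_0: "D x = 0 \<Longrightarrow> D (x ^ k) = 0"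
  by (induction k) (simp_all add: mult)

text \<open>Jacobi's formula. A derivation acts on one row at a time, and each summand is expanded
  along the differentiated row, whose cofactors do not involve that row.\<close>

lemma det:
  assumes A: "A \<in> carrier_mat n n"
  shows "D (det A) = (\<Sum>i<n. \<Sum>j<n. D (A $$ (i, j)) * cofactor A i j)"
proof -
  define B where "B i = mat n n (\<lambda>(k, j). if k = i then D (A $$ (i, j)) else A $$ (k, j))" for i
  have B: "B i \<in> carrier_mat n n" for i by (simp add: B_def)
  let ?S = "{\<pi>. \<pi> permutes {0..<n}}"
  have sgn: "D (signof \<pi> * x) = signof \<pi> * D x" for \<pi> :: "nat \<Rightarrow> nat" and x
    by (cases "signof \<pi> = (1 :: 'a)") (auto simp: sign_def uminus)
  have row: "det (B i) = (\<Sum>\<pi>\<in>?S. signof \<pi> *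
      (D (A $$ (i, \<pi> i)) * (\<Prod>k\<in>{0..<n} - {i}. A $$ (k, \<pi> k))))" if i: "i < n" for i
    unfolding det_def'[OF B]
  proof (intro sum.cong refl arg_cong2[where f = times])
    fix \<pi> assume "\<pi> \<in> ?S"
    then have \<pi>: "\<pi> k < n" if "k < n" for k using that permutes_in_image[of \<pi> "{0..<n}" k] by simp
    have "(\<Prod>k = 0..<n. B i $$ (k, \<pi> k)) = B i $$ (i, \<pi> i) * (\<Prod>k\<in>{0..<n} - {i}. B i $$ (k, \<pi> k))"
      using i by (subst prod.remove[of _ i]) auto
    also have "B i $$ (i, \<pi> i) = D (A $$ (i, \<pi> i))" using \<pi> i by (simp add: B_def)
    also have "(\<Prod>k\<in>{0..<n} - {i}. B i $$ (k, \<pi> k)) = (\<Prod>k\<in>{0..<n} - {i}. A $$ (k, \<pi> k))"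
      using \<pi> by (intro prod.cong) (auto simp: B_def)
    finally show "(\<Prod>k = 0..<n. B i $$ (k, \<pi> k)) =
        D (A $$ (i, \<pi> i)) * (\<Prod>k\<in>{0..<n} - {i}. A $$ (k, \<pi> k))" .
  qed
  have "D (det A) = (\<Sum>\<pi>\<in>?S. \<Sum>i<n. signof \<pi> *
      (D (A $$ (i, \<pi> i)) * (\<Prod>k\<in>{0..<n} - {i}. A $$ (k, \<pi> k))))"
    unfolding det_def'[OF A] by (simp add: sum sgn prod sum_distrib_left atLeast0LessThan)
  also have "\<dots> = (\<Sum>i<n. det (B i))"
    by (subst sum.swap) (simp add: row)
  also have "\<dots> = (\<Sum>i<n. \<Sum>j<n. D (A $$ (i, j)) * cofactor A i j)"
  proof (intro sum.cong refl)
    fix i assume i: "i \<in> {..<n}"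
    have "cofactor (B i) i j = cofactor A i j" for j
    proof -
      have "mat_delete (B i) i j = mat_delete A i j"
        using A i by (intro eq_matI) (auto simp: mat_delete_def B_def)
      then show ?thesis by (simp add: cofactor_def)
    qed
    then show "det (B i) = (\<Sum>j<n. D (A $$ (i, j)) * cofactor A i j)"
      using i laplace_expansion_row[OF B, of i] by (simp add: B_def)
  qed
  finally show ?thesis .
qed

end

lemma cofactor_row:
  assumes A: "A \<in> carrier_mat n n" and ij: "i < n" "k < n"
  shows "(\<Sum>j<n. A $$ (k, j) * cofactor A i j) = (if k = i then det A else 0)"
proof -
  have "(A * adj_mat A) $$ (k, i) = (\<Sum>j<n. A $$ (k, j) * cofactor A i j)"
    using A ij by (simp add: adj_mat_def scalar_prod_def atLeast0LessThan)
  then show ?thesis using adj_mat(2)[OF A] ij by auto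
qed

lemma cofactor_col:
  assumes A: "A \<in> carrier_mat n n" and ij: "i < n" "k < n"
  shows "(\<Sum>j<n. A $$ (j, k) * cofactor A j i) = (if k = i then det A else 0)"
proof -
  have "(adj_mat A * A) $$ (i, k) = (\<Sum>j<n. A $$ (j, k) * cofactor A j i)"
    using A ij by (simp add: adj_mat_def scalar_prod_def atLeast0LessThan mult.commute)
  then show ?thesis using adj_mat(3)[OF A] ij by auto
qed

lemma derivation_fps:
  assumes "derivation D"
  shows "derivation (\<lambda>f. Abs_fps (\<lambda>k. D (fps_nth f k)))"
proof -
  interpret derivation D by fact
  show ?thesis
    by unfold_locales
       (auto intro!: fps_ext simp: add fps_mult_nth sum mult sum.distrib)
qed

lemma derivation_vder: "derivation (vder X v)"
  by unfold_locales (simp_all add: vder_add vder_mult)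

section \<open>The matrix \<open>G\<^sub>p\<close> over power series\<close>

definition gp_coeff :: "nat \<Rightarrow> nat \<Rightarrow> nat \<Rightarrow> nat \<Rightarrow> gen cpoly" where
  "gp_coeff p k i j = (if k = 0 then A0 i j else if k < p then red_gen p (k, i, j)
     else if k = p then A0 j i else 0)"

definition Gp_fps :: "nat \<Rightarrow> nat \<Rightarrow> gen cpoly fps mat" where
  "Gp_fps n p = mat n n (\<lambda>(i, j). Abs_fps (\<lambda>k. gp_coeff p k i j))"

definition G_red_fps :: "nat \<Rightarrow> nat \<Rightarrow> gen cpoly fps mat" where
  "G_red_fps n p = mat n n (\<lambda>(i, j). Abs_fps (\<lambda>k. red p (G_coeff k i j)))"

lemma fps_to_fls_hom: "comm_ring_hom (fps_to_fls :: 'a :: comm_ring_1 fps \<Rightarrow> _)"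
  by unfold_locales (simp_all add: fls_times_fps_to_fls)

lemma red_A0 [simp]: "red p (A0 i j) = A0 i j"
  by (simp add: A0_def red_gen.simps)

lemma red_gen_sum_A0: "red_gen p (0, i, j) = A0 i j + A0 j i"
  by (auto simp: red_gen.simps A0_def)

lemma nth_fls_const_X_pow: "fls_nth (fls_const c * fls_X ^ k) m = (if m = int k then c else 0)"
  by (simp add: fls_X_power_conv_shift_1)

lemma Gp_mat_conv_fps: "1 \<le> p \<Longrightarrow> Gp_mat n p = map_mat fps_to_fls (Gp_fps n p)"
proof (rule eq_matI)
  fix i j assume p: "1 \<le> p" and "i < dim_row (map_mat fps_to_fls (Gp_fps n p))"
    "j < dim_col (map_mat fps_to_fls (Gp_fps n p))"
  then have ij: "i < n" "j < n" by (simp_all add: Gp_fps_def)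
  have "fls_nth (Gp_mat n p $$ (i, j)) m = fls_nth (map_mat fps_to_fls (Gp_fps n p) $$ (i, j)) m" for m
  proof -
    have "fls_nth (Gp_mat n p $$ (i, j)) m = (if m = 0 then A0 i j else 0)
      + (\<Sum>k=1..<p. if m = int k then red_gen p (k, i, j) else 0) + (if m = int p then A0 j i else 0)"
      using ij by (simp add: Gp_mat_def fls_nth_sum nth_fls_const_X_pow del: fls_mult_const_nth)
    also have "(\<Sum>k=1..<p. if m = int k then red_gen p (k, i, j) else 0) =
       (if 1 \<le> m \<and> m < int p then red_gen p (nat m, i, j) else 0)"
    proof (cases "1 \<le> m \<and> m < int p")
      case True
      then have "(\<Sum>k=1..<p. if m = int k then red_gen p (k, i, j) else 0) =
          (\<Sum>k=1..<p. if k = nat m then red_gen p (nat m, i, j) else 0)"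
        by (intro sum.cong) auto
      then show ?thesis using True by auto
    qed (auto intro!: sum.neutral)
    finally show ?thesis using ij p by (auto simp: Gp_fps_def gp_coeff_def nat_eq_iff)
  qed
  then show "Gp_mat n p $$ (i, j) = map_mat fps_to_fls (Gp_fps n p) $$ (i, j)" by (rule fls_eqI)
qed (simp_all add: Gp_mat_def Gp_fps_def)

lemma det_coeff_conv_fps: "1 \<le> p \<Longrightarrow> det_coeff n p k = fps_nth (det (Gp_fps n p)) k"
  unfolding det_coeff_def Gp_mat_conv_fps comm_ring_hom.hom_det[OF fps_to_fls_hom] by simp

text \<open>By periodicity the coefficients at \<open>k\<close> and \<open>k - p\<close> cancel
  beyond \<open>p\<close>. At \<open>k = p\<close>, subtracting the triangular constant term from
  the symmetric matrix of level 0 leaves its transpose.\<close>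

lemma gp_coeff_conv_diff:
  assumes "1 \<le> p"
  shows "gp_coeff p k i j = red p (G_coeff k i j) - (if k < p then 0 else red p (G_coeff (k - p) i j))"
  using assms red_gen_mod[of p k i j] red_gen_mod[of p p i j] red_gen_mod[of p "k - p" i j]
    red_gen_sum_A0[of p i j] le_mod_geq[of p k]
  by (auto simp: gp_coeff_def G_coeff_def eq_diff_eq add.commute)

lemma Gp_fps_conv_G_red:
  assumes p: "1 \<le> p"
  shows "Gp_fps n p = (1 - fps_X ^ p) \<cdot>\<^sub>m G_red_fps n p"
proof (rule eq_matI)
  fix i j assume "i < dim_row ((1 - fps_X ^ p) \<cdot>\<^sub>m G_red_fps n p)"
    "j < dim_col ((1 - fps_X ^ p) \<cdot>\<^sub>m G_red_fps n p)"
  then have ij: "i < n" "j < n" by (simp_all add: G_red_fps_def)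
  then show "Gp_fps n p $$ (i, j) = ((1 - fps_X ^ p) \<cdot>\<^sub>m G_red_fps n p) $$ (i, j)"
    by (intro fps_ext) (simp add: gp_coeff_conv_diff[OF p] Gp_fps_def G_red_fps_def left_diff_distrib fps_X_power_mult_nth)
qed (simp_all add: Gp_fps_def G_red_fps_def)

text \<open>The bracket formula also gives 0 where the entry of \<open>G(\<lambda>)\<close> is a
  constant 0 or 1, so the determinant can be differentiated without treating these entries
  separately.\<close>

lemma gen_bracket_const:
  assumes "i \<le> j"
  shows "gen_bracket (0, j, i) (s, q, l) = 0"
  using assms unfolding gen_bracket_expand
  by (auto simp: br_coef_def G_coeff_def A0_def G_int_def sgn_if)

lemma vder_red_G_coeff:
  assumes "0 < n" "0 < p" "i < n" "j < n" and y: "y \<in> gens_red n p"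
  shows "vder (gens_red n p) (\<lambda>x. red p (D_bracket (Var x) (Var y))) (red p (G_coeff r j i)) =
     red p (gen_bracket (r, j, i) y)"
proof (cases "r = 0 \<and> i \<le> j")
  case True
  obtain s q l where "y = (s, q, l)" by (cases y)
  then show ?thesis using True by (auto simp: G_coeff_def A0_def gen_bracket_const simp del: gen_bracket.simps)
next
  case False
  then have "(r, j, i) \<in> gens n" and "G_coeff r j i = Var (r, j, i)"
    using assms by (auto simp: gens_def G_coeff_def A0_def)
  then show ?thesis using vder_red_gen[OF assms(1,2) _ y] by simp
qed

lemma red_G_coeff_in_Dp_alg:
  assumes "0 < p" "i < n" "j < n"
  shows "red p (G_coeff k i j) \<in> Dp_alg n p"
proof -
  have "red_gen p (k, i, j) \<in> poly_alg (gens_red n p)" if "0 < n" "(k, i, j) \<in> gens n"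
    using red_gen_cases[OF that(1) assms(1) that(2)] by auto
  moreover have "0 < n" using assms by simp
  ultimately show ?thesis
    using assms by (auto simp: Dp_alg_def G_coeff_def A0_def gens_def)
qed

lemma red_gen_in_Dp_alg:
  assumes "0 < p" "x \<in> gens n"
  shows "red_gen p x \<in> Dp_alg n p"
proof -
  obtain k i j where x: "x = (k, i, j)" by (cases x)
  have "i < n" "j < n" "G_coeff k i j = Var x" using assms(2) by (auto simp: x gens_def G_coeff_def A0_def)
  then show ?thesis using red_G_coeff_in_Dp_alg[OF assms(1), of i n j k] by simp
qed

lemma gp_coeff_in_Dp_alg:
  assumes "0 < p" "i < n" "j < n"
  shows "gp_coeff p k i j \<in> Dp_alg n p"
  using red_G_coeff_in_Dp_alg[OF assms, of k] red_G_coeff_in_Dp_alg[OF assms, of 0]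
    red_G_coeff_in_Dp_alg[OF assms(1,3,2), of 0]
  by (auto simp: gp_coeff_def G_coeff_def Dp_alg_def split: if_splits)

lemma fps_det_nth_in_poly_alg:
  assumes A: "A \<in> carrier_mat n n" and "\<And>i j k. i < n \<Longrightarrow> j < n \<Longrightarrow> fps_nth (A $$ (i, j)) k \<in> poly_alg X"
  shows "fps_nth (det A) k \<in> poly_alg X"
proof -
  define R where "R = {f :: 'a cpoly fps. \<forall>k. fps_nth f k \<in> poly_alg X}"
  have R_mult: "f * g \<in> R" if "f \<in> R" "g \<in> R" for f g
    using that by (auto simp: R_def fps_mult_nth intro!: poly_alg_sum poly_alg_mult)
  have R_1: "1 \<in> R" by (simp add: R_def)
  have R_sum: "sum F I \<in> R" if "\<And>i. i \<in> I \<Longrightarrow> F i \<in> R" for F and I :: "(nat \<Rightarrow> nat) set"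
    using that by (auto simp: R_def fps_sum_nth intro!: poly_alg_sum)
  have R_prod: "prod F I \<in> R" if "\<And>i. i \<in> I \<Longrightarrow> F i \<in> R" for F and I :: "nat set"
    using that by (induction I rule: infinite_finite_induct) (auto intro: R_mult R_1)
  have R_sgn: "signof \<pi> \<in> R" for \<pi> :: "nat \<Rightarrow> nat"
    using R_1 by (auto simp: sign_def R_def intro!: poly_alg_uminus)
  have "det A \<in> R"
    unfolding det_def'[OF A]
  proof (intro R_sum R_mult R_sgn R_prod)
    fix \<pi> i assume "\<pi> \<in> {\<pi>. \<pi> permutes {0..<n}}" "i \<in> {0..<n}"
    then have "i < n" "\<pi> i < n" using permutes_in_image[of \<pi> "{0..<n}" i] by auto
    then show "A $$ (i, \<pi> i) \<in> R" using assms(2) by (simp add: R_def)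
  qed
  then show ?thesis by (simp add: R_def)
qed

lemma det_coeff_central:
  assumes n: "0 < n" and p: "1 \<le> p"
  shows "det_coeff n p k \<in> center (Dp_bracket p) (Dp_alg n p)"
proof -
  have p0: "0 < p" using p by simp
  let ?X = "gens_red n p"
  have G: "G_red_fps n p \<in> carrier_mat n n" by (simp add: G_red_fps_def)
  have "vder ?X (\<lambda>x. red p (D_bracket (Var x) (Var y))) (det_coeff n p k) = 0" if y: "y \<in> ?X" for y
  proof -
    obtain s q l where ye: "y = (s, q, l)" by (cases y)
    have ql: "q < n" "l < n" using y by (auto simp: ye gens_red_def)
    define d where "d = vder ?X (\<lambda>x. red p (D_bracket (Var x) (Var y)))"
    define D where "D f = Abs_fps (\<lambda>k. d (fps_nth f k))" for f
    interpret d: derivation d unfolding d_def by (rule derivation_vder)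
    interpret derivation D unfolding D_def by (intro derivation_fps d.derivation_axioms)
    let ?G = "G_red_fps n p"
    let ?C = "cofactor ?G"
    \<comment> \<open>The prefactor times the \<open>\<mu>\<close>-dependent entry, at the fixed
      level \<open>s\<close>; what remains is a series in \<open>\<lambda>\<close> alone.\<close>
    define U where "U e c \<sigma> i j = Abs_fps (\<lambda>m. br_coef (sgn e) c m * red p (G_int (int s + \<sigma> * int m) i j))"
      for e c \<sigma> i j
    have red_br: "red p (br_coef e c m) = br_coef e c m" for e c m by (simp add: br_coef_def)
    have UG: "fps_nth (U e c \<sigma> i j * ?G $$ (a, b)) r =
        (\<Sum>m\<le>r. br_coef (sgn e) c m * red p (G_coeff (r - m) a b) * red p (G_int (int s + \<sigma> * int m) i j))"
      if "a < n" "b < n" for e c \<sigma> i j a b r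
      using that by (simp add: fps_mult_nth U_def G_red_fps_def atLeast0AtMost mult.assoc mult.commute[of "red p (G_int _ _ _)"])
    have DG: "D (?G $$ (j, i)) =
        U (int j - int q) (-1) 1 j l * ?G $$ (q, i) + U (int i - int l) 1 1 q i * ?G $$ (j, l)
        + U (int i - int q) 1 (-1) i l * ?G $$ (j, q) + U (int j - int l) (-1) (-1) q j * ?G $$ (l, i)"
      if "i < n" "j < n" for i j
    proof (rule fps_ext)
      fix r
      have "fps_nth (D (?G $$ (j, i))) r = red p (gen_bracket (r, j, i) (s, q, l))"
        using vder_red_G_coeff[OF n p0 that y] that by (simp add: D_def d_def G_red_fps_def ye del: gen_bracket.simps)
      also have "\<dots> = fps_nth (U (int j - int q) (-1) 1 j l * ?G $$ (q, i) + U (int i - int l) 1 1 q i * ?G $$ (j, l)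
        + U (int i - int q) 1 (-1) i l * ?G $$ (j, q) + U (int j - int l) (-1) (-1) q j * ?G $$ (l, i)) r"
        unfolding gen_bracket_expand using that ql
        by (simp add: UG red_sum red_br)
      finally show "fps_nth (D (?G $$ (j, i))) r = \<dots>" .
    qed
    \<comment> \<open>With sign argument 0 the prefactor is odd in \<open>c\<close>. This makes the
      first two contracted terms cancel, and likewise the last two.\<close>
    have U_neg: "U 0 (-1) \<sigma> q l = - U 0 1 \<sigma> q l" for \<sigma>
      by (rule fps_ext) (simp add: U_def br_coef_def)
    have "D (det ?G) = (\<Sum>j<n. \<Sum>i<n. D (?G $$ (j, i)) * ?C j i)"
      by (rule det[OF G])
    also have "\<dots> = (\<Sum>j<n. \<Sum>i<n. U (int j - int q) (-1) 1 j l * (?G $$ (q, i) * ?C j i))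
        + (\<Sum>j<n. \<Sum>i<n. U (int i - int l) 1 1 q i * (?G $$ (j, l) * ?C j i))
        + (\<Sum>j<n. \<Sum>i<n. U (int i - int q) 1 (-1) i l * (?G $$ (j, q) * ?C j i))
        + (\<Sum>j<n. \<Sum>i<n. U (int j - int l) (-1) (-1) q j * (?G $$ (l, i) * ?C j i))"
      by (simp add: DG distrib_right sum.distrib mult.assoc)
    \<comment> \<open>Row \<open>q\<close> paired with the cofactors of row \<open>j\<close> leaves
      only \<open>j = q\<close>. The other three terms contract along a row or a column in the same
      way, always leaving the indices \<open>q\<close>, \<open>l\<close> and sign argument
      0.\<close>
    also have "(\<Sum>j<n. \<Sum>i<n. U (int j - int q) (-1) 1 j l * (?G $$ (q, i) * ?C j i)) =
        U 0 (-1) 1 q l * det ?G"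
      using ql by (simp add: cofactor_row[OF G] if_distrib flip: sum_distrib_left cong: if_cong)
    also have "(\<Sum>j<n. \<Sum>i<n. U (int i - int l) 1 1 q i * (?G $$ (j, l) * ?C j i)) =
        U 0 1 1 q l * det ?G"
      using ql by (subst sum.swap) (simp add: cofactor_col[OF G] if_distrib flip: sum_distrib_left cong: if_cong)
    also have "(\<Sum>j<n. \<Sum>i<n. U (int i - int q) 1 (-1) i l * (?G $$ (j, q) * ?C j i)) =
        U 0 1 (-1) q l * det ?G"
      using ql by (subst sum.swap) (simp add: cofactor_col[OF G] if_distrib flip: sum_distrib_left cong: if_cong)
    also have "(\<Sum>j<n. \<Sum>i<n. U (int j - int l) (-1) (-1) q j * (?G $$ (l, i) * ?C j i)) =
        U 0 (-1) (-1) q l * det ?G"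
      using ql by (simp add: cofactor_row[OF G] if_distrib flip: sum_distrib_left cong: if_cong)
    finally have "D (det ?G) = 0" by (simp add: U_neg)
    moreover have "D (1 - fps_X ^ p) = 0"
    proof (rule fps_ext)
      fix k
      have "fps_nth (1 - fps_X ^ p :: gen cpoly fps) k \<in> {0, 1, -1}"
        by (auto simp: fps_X_power_nth split: if_splits)
      then show "fps_nth (D (1 - fps_X ^ p)) k = fps_nth 0 k" by (auto simp: D_def d.uminus)
    qed
    ultimately have "D (det (Gp_fps n p)) = 0"
      by (simp add: Gp_fps_conv_G_red[OF p] mult power_eq_0)
    then have "d (fps_nth (det (Gp_fps n p)) k) = 0"
      by (metis D_def fps_nth_Abs_fps fps_zero_nth)
    then show ?thesis by (simp add: d_def det_coeff_conv_fps[OF p])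
  qed
  moreover have "det_coeff n p k \<in> poly_alg ?X"
    unfolding det_coeff_conv_fps[OF p]
    by (rule fps_det_nth_in_poly_alg[of _ n])
       (use gp_coeff_in_Dp_alg[OF p0] in \<open>auto simp: Gp_fps_def Dp_alg_def\<close>)
  ultimately show ?thesis
    unfolding Dp_bracket_def Dp_alg_def center_biderivation_iff[OF finite_gens_red] by blast
qed

section \<open>A point of maximal rank\<close>

lemma stairs_range:
  assumes "0 < N" "N * w < x" "x < N * (w + 1)"
  shows "stairs N x = 2 * w + 1"
  using stairs_pos[of "x - N * w" N] stairs_add_mult[of N "x - N * w" w] assms
  by (simp add: algebra_simps)

lemma stairs_nondvd:
  assumes "0 < N" "\<not> N dvd x"
  obtains w where "N * w < x" "x < N * (w + 1)" "stairs N x = 2 * w + 1"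
proof -
  have "0 < x mod N" "x mod N < N" using assms by (simp_all add: order.not_eq_order_implies_strict mod_eq_0_iff_dvd)
  moreover have "x = N * (x div N) + x mod N" by simp
  ultimately have "N * (x div N) < x" "x < N * (x div N + 1)"
    unfolding distrib_left mult_1_right by linarith+
  then show thesis using stairs_range[OF assms(1)] that by blast
qed

text \<open>Up to a sign, this is the cyclic orientation of three distinct points modulo \<open>N\<close>.\<close>

lemma stairs_triangle:
  assumes "0 < N" "\<not> N dvd x" "\<not> N dvd y" "\<not> N dvd z" "x + y + z = 0"
  shows "stairs N x + stairs N y + stairs N z \<in> {1, -1}"
proof -
  obtain a where a: "N * a < x" "x < N * (a + 1)" "stairs N x = 2 * a + 1" using stairs_nondvd assms by metis
  obtain b where b: "N * b < y" "y < N * (b + 1)" "stairs N y = 2 * b + 1" using stairs_nondvd assms by metis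
  obtain c where c: "N * c < z" "z < N * (c + 1)" "stairs N z = 2 * c + 1" using stairs_nondvd assms by metis
  have "N * (a + b + c) < 0" using a b c assms(5) by (simp add: algebra_simps)
  moreover have "0 < N * (a + b + c + 3)" using a b c assms(5) by (simp add: algebra_simps)
  ultimately have "a + b + c < 0" "0 < a + b + c + 3"
    using assms(1) by (simp_all add: mult_less_0_iff zero_less_mult_iff)
  then have "a + b + c = -1 \<or> a + b + c = -2" by linarith
  then show ?thesis using a(3) b(3) c(3) by auto
qed

text \<open>Chords joining almost antipodal points always cross.\<close>

lemma stairs_antipodal:
  assumes d: "0 < d" and N: "N = 2 * d \<or> N = 2 * d + 1"
    and z: "\<not> N dvd z" "\<not> N dvd (z - d)" "\<not> N dvd (z + d)"
  shows "stairs N (z - d) + stairs N (- z - d) = - 2"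
proof -
  have N0: "0 < N" using d N by auto
  define w where "w = z mod N"
  have zw: "z = w + N * (z div N)" by (simp add: w_def)
  have w: "0 < w" "w < N" using z(1) N0 by (simp_all add: w_def order.not_eq_order_implies_strict mod_eq_0_iff_dvd)
  have "w \<noteq> d"
  proof
    assume "w = d"
    then have "z - d = N * (z div N)" using zw by simp
    then show False using z(2) by simp
  qed
  have "w + d \<noteq> N"
  proof
    assume "w + d = N"
    then have "z + d = N * (z div N + 1)" using zw by (simp add: algebra_simps)
    then show False using z(3) by simp
  qed
  have "z - d = (w - d) + N * (z div N)" "- z - d = (- w - d) + N * (- (z div N))"
    using zw by (simp_all add: algebra_simps)
  then have "stairs N (z - d) = stairs N (w - d) + 2 * (z div N)"
    and "stairs N (- z - d) = stairs N (- w - d) + 2 * (- (z div N))"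
    using stairs_add_mult[OF N0] by metis+
  moreover have "stairs N (w - d) + stairs N (- w - d) = - 2"
  proof (cases "w < d")
    case True
    then have "stairs N (w - d) = -1" "stairs N (- w - d) = -1"
      using stairs_range[OF N0, of "-1" "w - d"] stairs_range[OF N0, of "-1" "- w - d"] w N by auto
    then show ?thesis by simp
  next
    case False
    then have "stairs N (w - d) = 1" "stairs N (- w - d) = -3"
      using stairs_range[OF N0, of 0 "w - d"] stairs_range[OF N0, of "-2" "- w - d"] w N
        \<open>w \<noteq> d\<close> \<open>w + d \<noteq> N\<close> d by auto
    then show ?thesis by simp
  qed
  ultimately show ?thesis by simp
qed

text \<open>A point modulo \<open>n p\<close> is a residue modulo \<open>n\<close> together with a
  level modulo \<open>p\<close>.\<close>

lemma dvd_div_mod_iff: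
  fixes n p i j k :: int
  assumes "0 < n" "0 \<le> i" "i < n" "0 \<le> j" "j < n"
  shows "n * p dvd j - i + n * k \<longleftrightarrow> j = i \<and> p dvd k"
proof
  assume *: "n * p dvd j - i + n * k"
  then have "n dvd j - i" by (meson dvd_add_left_iff dvd_mult_left dvd_triv_left)
  then have "j - i = 0"
    using dvd_imp_le_int[of "j - i" n] assms by fastforce
  then show "j = i \<and> p dvd k" using * assms(1) by simp
qed auto

text \<open>If \<open>n p\<close> is even, \<open>star n p\<close> is the antipodal map. Otherwise there are no antipodes, and \<open>star n p\<close> is an
  involution that still commutes with rotations by \<open>n\<close> and moves all points to almost opposite ones, except those
  congruent to \<open>n - 1\<close>, which it fixes. The weight is the value of the base point at the chord from a point to its image.\<close>

definition star :: "nat \<Rightarrow> nat \<Rightarrow> int \<Rightarrow> int" where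
  "star n p I = (let i = nat (I mod int n); h = n div 2; d = int n * int (p div 2) + int h in
     if even p then I + int n * int (p div 2)
     else if i < h then I + d else if i < 2 * h then I - d else I)"

definition weight :: "nat \<Rightarrow> nat \<Rightarrow> int \<Rightarrow> nat" where
  "weight n p I = (let i = nat (I mod int n); h = n div 2 in
     if even p \<or> i < h then Suc i else if i < 2 * h then Suc (i - h) else 0)"

text \<open>Level \<open>p / 2\<close>, or \<open>(p - 1) / 2\<close> for odd \<open>p\<close>, is
  that of the chords from a point to its \<open>star\<close>. The values grow with the residue so
  that different residues, or pairs of residues, carry different weights; \<open>transversal\<close>
  depends on this.\<close>

definition base_point :: "nat \<Rightarrow> nat \<Rightarrow> gen \<Rightarrow> complex" where
  "base_point n p x = (case x of (k, i, j) \<Rightarrow>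
     if (if even p then 2 * k = p \<and> i = j
         else Suc (2 * k) = p \<and> i < n div 2 \<and> j = i + n div 2) then of_nat (Suc i) else 0)"

text \<open>Even \<open>p\<close>: all chords between equal residues. Odd \<open>p\<close>: among
  the chords within a pair \<open>i\<close>, \<open>i + h\<close>, those whose label starts at the
  smaller residue, which are \<open>(p - 1) / 2 + (p + 1) / 2 = p\<close> in number, and for odd
  \<open>n\<close> the \<open>(p - 1) / 2\<close> chords of the unpaired residue.\<close>

definition slice_gens :: "nat \<Rightarrow> nat \<Rightarrow> gen set" where
  "slice_gens n p = {(k, i, j) \<in> gens_red n p. i = j \<and> (even p \<or> \<not> (n div 2 \<le> i \<and> i < 2 * (n div 2)))
     \<or> odd p \<and> i < n div 2 \<and> j = i + n div 2}"

lemma card_slice_gens: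
  "card (slice_gens n p) = n * p div 2"
proof (cases "even p")
  case True
  then obtain m where m: "p = 2 * m" by auto
  have "slice_gens n p = (\<lambda>(k, i). (k, i, i)) ` ({1..m} \<times> {..<n})"
    using True by (auto simp: slice_gens_def gens_red_def m image_iff)
  moreover have "inj_on (\<lambda>(k, i). (k, i, i)) ({1..m} \<times> {..<n})" by (auto intro: inj_onI)
  ultimately show ?thesis by (simp add: card_image m)
next
  case False
  then obtain m where m: "p = 2 * m + 1" by (auto elim: oddE)
  define h where "h = n div 2"
  have h: "n = 2 * h \<or> n = 2 * h + 1" by (auto simp: h_def)
  let ?A = "(\<lambda>(k, i). (k, i, i)) ` ({1..m} \<times> ({..<n} - {h..<2*h}))"
  let ?B = "(\<lambda>(k, i). (k, i, i + h)) ` ({..m} \<times> {..<h})"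
  have "slice_gens n p = ?A \<union> ?B"
    using False h by (auto simp: slice_gens_def gens_red_def m h_def[symmetric] image_iff)
  moreover have "?A \<inter> ?B = {}" by auto
  moreover have "card ?A = m * (n - h)"
  proof (subst card_image)
    have "{h..<2*h} \<subseteq> {..<n}" using h by auto
    then show "card ({1..m} \<times> ({..<n} - {h..<2*h})) = m * (n - h)" by (simp add: card_Diff_subset)
  qed (auto intro: inj_onI)
  moreover have "card ?B = (m + 1) * h" by (subst card_image) (auto intro: inj_onI)
  ultimately have "card (slice_gens n p) = m * (n - h) + (m + 1) * h"
    by (simp add: card_Un_disjoint)
  then show ?thesis using h by (auto simp: m algebra_simps)
qed

definition congr_ind :: "nat \<Rightarrow> nat \<Rightarrow> int \<Rightarrow> int \<Rightarrow> complex" where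
  "congr_ind n p A B = (if int n * int p dvd B - A then 1 else 0)"

context
  fixes n p :: nat
  assumes n: "2 \<le> n" and p: "0 < p"
begin

lemma star_shift: "star n p (I + int n * t) = star n p I + int n * t"
  by (simp add: star_def Let_def)

lemma weight_shift: "weight n p (I + int n * t) = weight n p I"
  by (simp add: weight_def Let_def)

lemma star_cong:
  assumes "int n * int p dvd B - A"
  shows "int n * int p dvd star n p B - star n p A"
proof -
  obtain w where "B - A = int n * int p * w" using assms by (auto elim: dvdE)
  then have "B = A + int n * (int p * w)" by (simp add: algebra_simps)
  then show ?thesis using star_shift[of A "int p * w"] by simp
qed

lemma star_mod:
  "star n p I mod int n = (let i = nat (I mod int n); h = n div 2 in
     if even p then I mod int n else if i < h then I mod int n + int h
     else if i < 2 * h then I mod int n - int h else I mod int n)"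
proof -
  define i where "i = I mod int n"
  define h where "h = n div 2"
  have i: "0 \<le> i" "i < int n" using n by (simp_all add: i_def)
  have I: "I = i + int n * (I div int n)" by (simp add: i_def)
  have "(I + int n * int (p div 2) + int h) mod int n = i + int h" if "i < int h"
  proof -
    have "I + int n * int (p div 2) + int h = (i + int h) + int n * (I div int n + int (p div 2))"
      using I by (simp add: algebra_simps)
    then have "(I + int n * int (p div 2) + int h) mod int n = (i + int h) mod int n"
      by (simp only: mod_mult_self2)
    then show ?thesis using i that by (simp add: h_def)
  qed
  moreover have "(I - (int n * int (p div 2) + int h)) mod int n = i - int h" if "int h \<le> i"
  proof -
    have "I - (int n * int (p div 2) + int h) = (i - int h) + int n * (I div int n - int (p div 2))"
      using I by (simp add: algebra_simps)
    then have "(I - (int n * int (p div 2) + int h)) mod int n = (i - int h) mod int n"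
      by (simp only: mod_mult_self2)
    also have "\<dots> = i - int h" using i that by (intro mod_pos_pos_trivial) auto
    finally show ?thesis .
  qed
  ultimately show ?thesis using i
    by (auto simp: star_def Let_def i_def[symmetric] h_def[symmetric] nat_less_iff add.assoc)
qed

lemma weight_star: "weight n p (star n p I) = weight n p I"
proof -
  have "0 \<le> I mod int n" using n by simp
  then show ?thesis
    by (auto simp: weight_def Let_def star_mod nat_less_iff nat_add_distrib nat_diff_distrib split: if_splits)
qed

lemma star_star: "int n * int p dvd star n p (star n p I) - I"
proof (cases "even p")
  case True
  then obtain m where "p = 2 * m" by auto
  then show ?thesis by (simp add: star_def algebra_simps)
next
  case False
  have *: "star n p I mod int n = (if nat (I mod int n) < n div 2 then I mod int n + int (n div 2)
     else if nat (I mod int n) < 2 * (n div 2) then I mod int n - int (n div 2) else I mod int n)"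
    using False by (simp add: star_mod Let_def)
  have "star n p (star n p I) = I"
  proof -
    consider "nat (I mod int n) < n div 2" | "n div 2 \<le> nat (I mod int n)" "nat (I mod int n) < 2 * (n div 2)"
      | "2 * (n div 2) \<le> nat (I mod int n)" by linarith
    then show ?thesis
    proof cases
      case 1
      then have r: "nat (star n p I mod int n) = nat (I mod int n) + n div 2" using n by (simp add: * nat_add_distrib)
      have "star n p I = I + (int n * int (p div 2) + int (n div 2))"
        using 1 False by (simp add: star_def Let_def)
      moreover have "star n p (star n p I) = star n p I - (int n * int (p div 2) + int (n div 2))"
        using 1 False by (simp only: star_def[of n p "star n p I"] Let_def r) simp
      ultimately show ?thesis by simp
    next
      case 2
      then have r: "nat (star n p I mod int n) = nat (I mod int n) - n div 2" using n by (simp add: * nat_diff_distrib)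
      have lt: "nat (I mod int n) - n div 2 < n div 2" using 2 by linarith
      have "star n p I = I - (int n * int (p div 2) + int (n div 2))"
        using 2 False by (simp add: star_def Let_def)
      moreover have "star n p (star n p I) = star n p I + (int n * int (p div 2) + int (n div 2))"
        using lt False by (simp only: star_def[of n p "star n p I"] Let_def r) simp
      ultimately show ?thesis by simp
    next
      case 3
      with False show ?thesis by (simp add: star_def)
    qed
  qed
  then show ?thesis by simp
qed

lemma star_cases:
  assumes "weight n p I \<noteq> 0"
  obtains (up) "star n p I = I + (int n * int (p div 2) + (if even p then 0 else int (n div 2)))"
    | (down) "odd p" "star n p I = I - (int n * int (p div 2) + (if even p then 0 else int (n div 2)))"
  using assms by (auto simp: star_def weight_def Let_def split: if_splits)

lemma antipodal_distance:
  defines "d \<equiv> int n * int (p div 2) + (if even p then 0 else int (n div 2))"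
  shows "0 < d" "int n * int p = 2 * d \<or> int n * int p = 2 * d + 1"
proof -
  show "0 < d"
  proof (cases "even p")
    case True
    then have "0 < p div 2" using p by auto
    then show ?thesis using n True by (simp add: d_def)
  next
    case False
    have "0 < int (n div 2)" using n by simp
    moreover have "0 \<le> int n * int (p div 2)" by simp
    ultimately show ?thesis using False by (simp only: d_def if_False add_nonneg_pos)
  qed
  show "int n * int p = 2 * d \<or> int n * int p = 2 * d + 1"
  proof (cases "even p")
    case False
    then have "int p = 2 * int (p div 2) + 1" by presburger
    then have "int n * int p = 2 * (int n * int (p div 2)) + int n" by (simp add: algebra_simps)
    moreover have "int n = 2 * int (n div 2) \<or> int n = 2 * int (n div 2) + 1" by linarith
    moreover have "d = int n * int (p div 2) + int (n div 2)" using False by (simp add: d_def)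
    ultimately show ?thesis by linarith
  next
    case True
    then have "int p = 2 * int (p div 2)" by presburger
    then have "int n * int p = 2 * (int n * int (p div 2))" by simp
    then show ?thesis using True by (simp add: d_def)
  qed
qed

lemma star_not_cong:
  assumes "weight n p I \<noteq> 0"
  shows "\<not> int n * int p dvd star n p I - I"
proof -
  define d where "d = int n * int (p div 2) + (if even p then 0 else int (n div 2))"
  have d: "0 < d" "int n * int p = 2 * d \<or> int n * int p = 2 * d + 1"
    using antipodal_distance by (simp_all add: d_def)
  have "\<not> int n * int p dvd d" using d zdvd_not_zless[of d "int n * int p"] by auto
  moreover from assms have "star n p I = I + d \<or> star n p I = I - d"
    by (cases rule: star_cases) (auto simp: d_def)
  ultimately show ?thesis by auto
qed

text \<open>The chord from \<open>star J\<close> to \<open>star I\<close> lies opposite to the one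
  from \<open>I\<close> to \<open>J\<close> and does not cross it, so terms quadratic in the weights
  disappear. If both points are moved in the same direction this is \<open>stairs_antipodal\<close>;
  otherwise antisymmetry of \<open>stairs\<close> is enough.\<close>

lemma same_side:
  assumes w: "weight n p I \<noteq> 0" "weight n p J \<noteq> 0"
    and IJ: "\<not> int n * int p dvd J - I" "\<not> int n * int p dvd J - star n p I"
  defines "F \<equiv> stairs (int n * int p)"
  shows "F (I - star n p J) - F (J - star n p J) + F (J - star n p I) - F (I - star n p I) = 0"
proof -
  let ?N = "int n * int p"
  define d where "d = int n * int (p div 2) + (if even p then 0 else int (n div 2))"
  have d: "0 < d" "?N = 2 * d \<or> ?N = 2 * d + 1"
    using antipodal_distance by (simp_all add: d_def)
  have Fd: "F d = 1" "F (- d) = - 1" using d stairs_pos[of d ?N] stairs_uminus[of ?N d] by (auto simp: F_def)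
  have JI: "\<not> ?N dvd I - star n p J"
  proof -
    have "?N dvd J - star n p I" if "?N dvd I - star n p J"
    proof -
      have "?N dvd star n p I - star n p (star n p J)" by (rule star_cong[OF that])
      then have "?N dvd star n p (star n p J) - star n p I" by (simp add: dvd_diff_commute)
      moreover have "?N dvd J - star n p (star n p J)" using star_star[of J] by (simp add: dvd_diff_commute)
      ultimately have "?N dvd (star n p (star n p J) - star n p I) + (J - star n p (star n p J))" by (rule dvd_add)
      then show ?thesis by simp
    qed
    then show ?thesis using IJ by blast
  qed
  have JI': "\<not> ?N dvd I - J" "\<not> ?N dvd star n p I - J" "\<not> ?N dvd star n p J - I"
    using IJ JI by (simp_all add: dvd_diff_commute)
  have anti: "F (x + d) + F (- x - d) = 0" "F (x - d) + F (- x + d) = 0" for x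
    using stairs_uminus[of ?N "x + d"] stairs_uminus[of ?N "x - d"] by (simp_all add: F_def)
  from w(1) show ?thesis
  proof (cases rule: star_cases)
    case up
    note u = up[folded d_def]
    from w(2) show ?thesis
    proof (cases rule: star_cases)
      case up
      note v = up[folded d_def]
      have "F ((I - J) - d) + F (- (I - J) - d) = - 2"
        unfolding F_def using JI JI' u v by (intro stairs_antipodal d) (simp_all add: algebra_simps)
      then show ?thesis using Fd by (simp add: u v algebra_simps)
    next
      case down
      note v = down(2)[folded d_def]
      show ?thesis using anti(1)[of "I - J"] Fd by (simp add: u v algebra_simps)
    qed
  next
    case down
    note u = down(2)[folded d_def]
    from w(2) show ?thesis
    proof (cases rule: star_cases)
      case up
      note v = up[folded d_def]
      show ?thesis using anti(2)[of "I - J"] Fd by (simp add: u v algebra_simps)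
    next
      case down
      note v = down(2)[folded d_def]
      have "F ((J - I) - d) + F (- (J - I) - d) = - 2"
        unfolding F_def using JI JI' IJ u v by (intro stairs_antipodal d) (simp_all add: algebra_simps)
      then show ?thesis using anti(1)[of "I - J"] anti(2)[of "I - J"] Fd
        by (simp add: u v algebra_simps)
    qed
  qed
qed

text \<open>At the base point the symmetric matrix of all chords is twice the identity plus the
  permutation matrix of \<open>star\<close> with weights, the weight being 0 at the fixed points of
  \<open>star\<close>.\<close>

lemma peval_base_point:
  "peval (base_point n p) (sym_gen n p I J) = 2 * congr_ind n p I J + of_nat (weight n p I) * congr_ind n p (star n p I) J"
proof -
  let ?N = "int n * int p"
  define i where "i = nat (I mod int n)"
  define j where "j = nat (J mod int n)"
  define e where "e = J div int n - I div int n"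
  define k where "k = nat (e mod int p)"
  define h where "h = n div 2"
  define m where "m = p div 2"
  have ij: "i < n" "j < n" and k: "k < p" "int k = e mod int p"
    using n p by (simp_all add: i_def j_def k_def nat_less_iff)
  have IJ: "I = int i + int n * (I div int n)" "J = int j + int n * (J div int n)"
    using n by (simp_all add: i_def j_def)
  have cong: "?N dvd J - (int c + int n * (I div int n + u)) \<longleftrightarrow> j = c \<and> int k = u mod int p" if "c < n" for c u
  proof -
    have e1: "J - (int c + int n * (I div int n + u)) = int j - int c + int n * (e - u)"
      using IJ(2) by (simp add: e_def algebra_simps)
    have e2: "?N dvd int j - int c + int n * (e - u) \<longleftrightarrow> int j = int c \<and> int p dvd e - u"
      using ij that n by (intro dvd_div_mod_iff) auto
    show ?thesis unfolding e1 e2 by (simp add: k mod_eq_dvd_iff)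
  qed
  have 1: "congr_ind n p I J = (if j = i \<and> k = 0 then 1 else 0)"
    using cong[of i 0] ij IJ(1) by (simp add: congr_ind_def)
  have L: "peval (base_point n p) (sym_gen n p I J) = peval (base_point n p) (red_gen p (k, i, j))"
    by (simp add: sym_gen_def i_def j_def k_def e_def)
  have two: "peval f 2 = 2" for f :: "gen \<Rightarrow> complex" using ident.insertion_Cst[of f 2] by simp
  show ?thesis
  proof (cases "even p")
    case True
    then have pm: "p = 2 * m" "0 < m" using p by (auto simp: m_def)
    have s1: "star n p I = int i + int n * (I div int n + int m)"
      using True IJ(1) by (simp add: star_def m_def algebra_simps)
    then have 2: "congr_ind n p (star n p I) J = (if j = i \<and> k = m then 1 else 0)"
      unfolding congr_ind_def s1 cong[OF ij(1)] using pm by simp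
    have "weight n p I = Suc i" using True by (simp add: weight_def i_def)
    then show ?thesis
      using pm k(1) unfolding L 1 2 by (auto simp: red_gen.simps Let_def base_point_def two)
  next
    case False
    then have pm: "p = 2 * m + 1" by (simp add: m_def)
    consider "i < h" | "h \<le> i" "i < 2 * h" | "2 * h \<le> i" by linarith
    then show ?thesis
    proof cases
      case 1
      have s1: "star n p I = int (i + h) + int n * (I div int n + int m)"
        using False 1 IJ(1) by (simp add: star_def Let_def i_def[symmetric] h_def[symmetric] m_def algebra_simps)
      then have 2: "congr_ind n p (star n p I) J = (if j = i + h \<and> k = m then 1 else 0)"
      proof -
        have "i + h < n" using 1 by (simp add: h_def)
        then show ?thesis unfolding congr_ind_def s1 using cong[of "i + h" "int m"] pm by simp
      qed
      have "weight n p I = Suc i" using False 1 by (simp add: weight_def i_def h_def)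
      then show ?thesis
        using pm k(1) 1 unfolding L \<open>congr_ind n p I J = _\<close> 2
        by (auto simp: red_gen.simps Let_def base_point_def two h_def[symmetric] min_def max_def)
    next
      case 2
      have s1: "star n p I = int (i - h) + int n * (I div int n + - int m)"
        using False 2 IJ(1) by (simp add: star_def Let_def i_def[symmetric] h_def[symmetric] m_def algebra_simps of_nat_diff)
      have mm: "(- int m) mod int p = int ((m + 1) mod p)"
      proof -
        have "(- int m) mod int p = (- int m + int p) mod int p" by simp
        also have "- int m + int p = int (m + 1)" using pm by simp
        finally show ?thesis by (simp only: zmod_int)
      qed
      have 3: "congr_ind n p (star n p I) J = (if j = i - h \<and> k = (m + 1) mod p then 1 else 0)"
      proof -
        have "i - h < n" using ij by simp
        then show ?thesis unfolding congr_ind_def s1 using cong[of "i - h" "- int m"] by (simp only: mm) simp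
      qed
      have "weight n p I = Suc (i - h)" using False 2 by (simp add: weight_def i_def[symmetric] h_def[symmetric])
      then show ?thesis
        using pm k(1) 2 unfolding L \<open>congr_ind n p I J = _\<close> 3
        by (cases "m = 0") (auto simp: red_gen.simps Let_def base_point_def two h_def[symmetric] min_def max_def)
    next
      case 3
      have "weight n p I = 0" using False 3 by (simp add: weight_def i_def[symmetric] h_def[symmetric])
      then show ?thesis
        using pm k(1) 3 ij unfolding L \<open>congr_ind n p I J = _\<close>
        by (auto simp: red_gen.simps Let_def base_point_def two h_def[symmetric] min_def max_def)
    qed
  qed
qed

end

text \<open>Nonzero if and only if the ordered chords \<open>(A, B)\<close> and \<open>(C, D)\<close> agree up to a rotation by a multiple of \<open>n\<close>.\<close>

definition matches :: "nat \<Rightarrow> nat \<Rightarrow> int \<Rightarrow> int \<Rightarrow> int \<Rightarrow> int \<Rightarrow> complex" where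
  "matches n p A B C D =
     (\<Sum>t\<in>{0..<int p}. congr_ind n p A (C + int n * t) * congr_ind n p B (D + int n * t))"

context
  fixes n p :: nat
  assumes n: "2 \<le> n" and p: "0 < p"
begin

lemma matches_nonzeroD:
  assumes "matches n p A B C D \<noteq> 0"
  shows "\<exists>t. int n * int p dvd C + int n * t - A \<and> int n * int p dvd D + int n * t - B"
proof (rule ccontr)
  assume "\<not> ?thesis"
  then have "matches n p A B C D = 0" unfolding matches_def by (intro sum.neutral) (auto simp: congr_ind_def)
  with assms show False by simp
qed

lemma matches_refl_nonzero: "matches n p A B A B \<noteq> 0"
proof -
  have "matches n p A B A B = of_nat (card {t \<in> {0..<int p}. int n * int p dvd int n * t})"
  proof -
    have "matches n p A B A B = (\<Sum>t\<in>{0..<int p}. if int n * int p dvd int n * t then 1 else 0)"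
      unfolding matches_def by (intro sum.cong refl) (simp add: congr_ind_def)
    then show ?thesis by (simp add: sum.If_cases Int_def)
  qed
  moreover have "finite {t \<in> {0..<int p}. int n * int p dvd int n * t}"
    by (rule finite_subset[of _ "{0..<int p}"]) auto
  moreover have "0 \<in> {t \<in> {0..<int p}. int n * int p dvd int n * t}" using p by simp
  ultimately show ?thesis by (metis card_0_eq empty_iff of_nat_eq_0_iff)
qed

lemma congr_ind_cong_right: "int n * int p dvd B - B' \<Longrightarrow> congr_ind n p A B = congr_ind n p A B'"
proof -
  assume "int n * int p dvd B - B'"
  then have "int n * int p dvd (B - B') + (B' - A) \<longleftrightarrow> int n * int p dvd B' - A" by (rule dvd_add_right_iff)
  then show ?thesis by (simp add: congr_ind_def)
qed

lemma congr_ind_cong_left: "int n * int p dvd A - A' \<Longrightarrow> congr_ind n p A B = congr_ind n p A' B"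
proof -
  assume "int n * int p dvd A - A'"
  then have "int n * int p dvd (B - A) + (A - A') \<longleftrightarrow> int n * int p dvd B - A" by (rule dvd_add_left_iff)
  then show ?thesis by (simp add: congr_ind_def)
qed

lemma star_cong_iff: "int n * int p dvd star n p B - star n p A \<longleftrightarrow> int n * int p dvd B - A"
proof
  let ?N = "int n * int p"
  assume "?N dvd star n p B - star n p A"
  then have "?N dvd star n p (star n p B) - star n p (star n p A)" by (rule star_cong[OF n p])
  from dvd_add[OF dvd_diff[OF this star_star[OF n p, of B]] star_star[OF n p, of A]]
  show "?N dvd B - A" by simp
qed (rule star_cong[OF n p])

lemma congr_ind_star: "congr_ind n p (star n p A) (star n p C + int n * t) = congr_ind n p A (C + int n * t)"
  using star_cong_iff[of "C + int n * t" A] by (simp add: congr_ind_def star_shift[OF n p])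

lemma congr_ind_star_right: "congr_ind n p A (star n p C + int n * t) = congr_ind n p (star n p A) (C + int n * t)"
proof -
  have "congr_ind n p (star n p A) (C + int n * t) = congr_ind n p (star n p A) (star n p (star n p C) + int n * t)"
    using star_star[OF n p, of C] by (intro congr_ind_cong_right) (simp add: dvd_diff_commute)
  then show ?thesis by (simp add: congr_ind_star)
qed

lemma congr_ind_star_star: "congr_ind n p (star n p (star n p A)) B = congr_ind n p A B"
  using star_star[OF n p] by (rule congr_ind_cong_left)

lemma star_flip:
  assumes "int n * int p dvd I - star n p J"
  shows "int n * int p dvd J - star n p I"
proof -
  have "int n * int p dvd star n p I - star n p (star n p J)" by (rule star_cong[OF n p assms])
  from dvd_add[OF this star_star[OF n p, of J]] show ?thesis by (simp add: dvd_diff_commute)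
qed

text \<open>With two nonzero entries per row there are eight products. Two diagonal entries
  contribute nothing, since a chord does not cross itself, and two weighted ones contribute nothing
  by \<open>same_side\<close>. The mixed products carry the orientation of the triangle
  \<open>I\<close>, \<open>J\<close>, \<open>star I\<close> or \<open>I\<close>,
  \<open>star J\<close>, \<open>J\<close>, which is a sign and never zero when the weight is
  nonzero.\<close>

lemma peval_cyc_bracket:
  fixes I J K L :: int
  assumes IJ: "\<not> int n * int p dvd J - I" "\<not> int n * int p dvd J - star n p I"
  defines "F \<equiv> stairs (int n * int p)"
  defines "s1 \<equiv> F (I - J) + F (J - star n p I) + F (star n p I - I)"
    and "s2 \<equiv> F (I - star n p J) + F (star n p J - J) + F (J - I)"
  defines "w1 \<equiv> of_nat (weight n p I)" and "w2 \<equiv> of_nat (weight n p J)"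
  shows "peval (base_point n p) (cyc_bracket n p I J K L) =
      2 * of_int s1 * w1 * (matches n p J (star n p I) K L + matches n p (star n p I) J K L)
    + 2 * of_int s2 * w2 * (matches n p (star n p J) I K L + matches n p I (star n p J) K L)"
    and "weight n p I \<noteq> 0 \<Longrightarrow> s1 = 1 \<or> s1 = -1"
    and "weight n p J \<noteq> 0 \<Longrightarrow> s2 = 1 \<or> s2 = -1"
    and "weight n p I \<noteq> 0 \<Longrightarrow> weight n p J \<noteq> 0 \<Longrightarrow> s2 = - s1"
proof -
  let ?N = "int n * int p"
  let ?I = "star n p I" and ?J = "star n p J"
  have N: "0 < ?N" using n p by simp
  have Fm: "F (- x) = - F x" for x by (simp add: F_def stairs_uminus)
  have Fs: "F (x - y) = - F (y - x)" for x y using Fm[of "y - x"] by simp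
  have F0: "F 0 = 0" by (simp add: F_def)
  have same: "F (I - ?J) - F (J - ?J) + F (J - ?I) - F (I - ?I) = 0"
    if "weight n p I \<noteq> 0" "weight n p J \<noteq> 0"
    unfolding F_def by (rule same_side[OF n p that IJ])
  show s1: "weight n p I \<noteq> 0 \<Longrightarrow> s1 = 1 \<or> s1 = -1"
  proof -
    assume "weight n p I \<noteq> 0"
    then have "s1 \<in> {1, -1}" unfolding s1_def F_def
      using IJ star_not_cong[OF n p] by (intro stairs_triangle N) (auto simp: dvd_diff_commute)
    then show ?thesis by auto
  qed
  show s2: "weight n p J \<noteq> 0 \<Longrightarrow> s2 = 1 \<or> s2 = -1"
  proof -
    assume "weight n p J \<noteq> 0"
    then have "s2 \<in> {1, -1}" unfolding s2_def F_def
      using IJ star_not_cong[OF n p] star_flip[of I J] by (intro stairs_triangle N) (auto simp: dvd_diff_commute)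
    then show ?thesis by auto
  qed
  show "weight n p I \<noteq> 0 \<Longrightarrow> weight n p J \<noteq> 0 \<Longrightarrow> s2 = - s1"
    using same Fs[of I J] Fs[of ?I I] Fs[of ?J J] by (simp add: s1_def s2_def)
  have cyc_ind: "of_int (cyc ?N I J K' L') * (congr_ind n p A K' * congr_ind n p B L') =
      of_int (cyc ?N I J A B) * (congr_ind n p A K' * congr_ind n p B L')" for A B K' L'
  proof (cases "?N dvd K' - A \<and> ?N dvd L' - B")
    case True
    then obtain u v where "K' - A = ?N * u" "L' - B = ?N * v" by (auto elim!: dvdE)
    then have "K' = A + ?N * u" "L' = B + ?N * v" by simp_all
    moreover have "0 < n" using n by simp
    ultimately have "cyc ?N I J K' L' = cyc ?N I J A B" by (simp only: cyc_period[OF _ p])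
    then show ?thesis by simp
  qed (auto simp: congr_ind_def)
  have summand: "peval (base_point n p) (of_int (cyc ?N I J K' L') *
       (sym_gen n p J K' * sym_gen n p I L' - sym_gen n p I K' * sym_gen n p J L')) =
      2 * of_int s1 * w1 * (congr_ind n p J K' * congr_ind n p ?I L' + congr_ind n p ?I K' * congr_ind n p J L')
    + 2 * of_int s2 * w2 * (congr_ind n p ?J K' * congr_ind n p I L' + congr_ind n p I K' * congr_ind n p ?J L')" for K' L'
  proof -
    define c where "c = (of_int (cyc ?N I J K' L') :: complex)"
    have key: "c * (congr_ind n p A K' * congr_ind n p B L') =
        of_int (cyc ?N I J A B) * (congr_ind n p A K' * congr_ind n p B L')" for A B
      unfolding c_def by (rule cyc_ind)
    have vals: "c * (congr_ind n p J K' * congr_ind n p I L') = 0"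
      "c * (congr_ind n p J K' * congr_ind n p ?I L') = of_int s1 * (congr_ind n p J K' * congr_ind n p ?I L')"
      "c * (congr_ind n p ?J K' * congr_ind n p I L') = of_int s2 * (congr_ind n p ?J K' * congr_ind n p I L')"
      "c * (congr_ind n p I K' * congr_ind n p J L') = 0"
      "c * (congr_ind n p I K' * congr_ind n p ?J L') = - (of_int s2 * (congr_ind n p I K' * congr_ind n p ?J L'))"
      "c * (congr_ind n p ?I K' * congr_ind n p J L') = - (of_int s1 * (congr_ind n p ?I K' * congr_ind n p J L'))"
    proof -
      have "cyc ?N I J J I = 0" "cyc ?N I J I J = 0" "cyc ?N I J J ?I = s1" "cyc ?N I J ?J I = s2"
        "cyc ?N I J I ?J = - s2" "cyc ?N I J ?I J = - s1"
        using Fs[of I J] Fs[of ?I I] Fs[of ?J J] F0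
        by (simp_all add: cyc_def F_def[symmetric] s1_def s2_def)
      then show "c * (congr_ind n p J K' * congr_ind n p I L') = 0"
      "c * (congr_ind n p J K' * congr_ind n p ?I L') = of_int s1 * (congr_ind n p J K' * congr_ind n p ?I L')"
      "c * (congr_ind n p ?J K' * congr_ind n p I L') = of_int s2 * (congr_ind n p ?J K' * congr_ind n p I L')"
      "c * (congr_ind n p I K' * congr_ind n p J L') = 0"
      "c * (congr_ind n p I K' * congr_ind n p ?J L') = - (of_int s2 * (congr_ind n p I K' * congr_ind n p ?J L'))"
      "c * (congr_ind n p ?I K' * congr_ind n p J L') = - (of_int s1 * (congr_ind n p ?I K' * congr_ind n p J L'))"
        by (simp_all only: key of_int_minus mult_minus_left of_int_0 mult_zero_left)
    qed
    have far: "w1 * w2 * (c * (congr_ind n p ?J K' * congr_ind n p ?I L')) = 0"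
      "w1 * w2 * (c * (congr_ind n p ?I K' * congr_ind n p ?J L')) = 0"
    proof -
      have "cyc ?N I J ?J ?I = 0 \<and> cyc ?N I J ?I ?J = 0" if "weight n p I \<noteq> 0" "weight n p J \<noteq> 0"
        using same[OF that] by (simp add: cyc_def F_def[symmetric])
      then show "w1 * w2 * (c * (congr_ind n p ?J K' * congr_ind n p ?I L')) = 0"
        "w1 * w2 * (c * (congr_ind n p ?I K' * congr_ind n p ?J L')) = 0"
        unfolding key by (auto simp: w1_def w2_def)
    qed
    have "peval (base_point n p) (of_int k) = of_int k" for k
      using ident.insertion_Cst[of "base_point n p" "of_int k"] by simp
    then have "peval (base_point n p) (of_int (cyc ?N I J K' L') *
       (sym_gen n p J K' * sym_gen n p I L' - sym_gen n p I K' * sym_gen n p J L')) =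
      c * ((2 * congr_ind n p J K' + w2 * congr_ind n p ?J K') * (2 * congr_ind n p I L' + w1 * congr_ind n p ?I L')
        - (2 * congr_ind n p I K' + w1 * congr_ind n p ?I K') * (2 * congr_ind n p J L' + w2 * congr_ind n p ?J L'))"
      by (simp add: peval_base_point[OF n p] w1_def w2_def c_def)
    also have "\<dots> = 4 * (c * (congr_ind n p J K' * congr_ind n p I L')) + 2 * w1 * (c * (congr_ind n p J K' * congr_ind n p ?I L'))
        + 2 * w2 * (c * (congr_ind n p ?J K' * congr_ind n p I L')) + w1 * w2 * (c * (congr_ind n p ?J K' * congr_ind n p ?I L'))
        - 4 * (c * (congr_ind n p I K' * congr_ind n p J L')) - 2 * w2 * (c * (congr_ind n p I K' * congr_ind n p ?J L'))
        - 2 * w1 * (c * (congr_ind n p ?I K' * congr_ind n p J L')) - w1 * w2 * (c * (congr_ind n p ?I K' * congr_ind n p ?J L'))"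
      by (simp add: ring_distribs ac_simps)
    also have "\<dots> = 2 * of_int s1 * w1 * (congr_ind n p J K' * congr_ind n p ?I L' + congr_ind n p ?I K' * congr_ind n p J L')
    + 2 * of_int s2 * w2 * (congr_ind n p ?J K' * congr_ind n p I L' + congr_ind n p I K' * congr_ind n p ?J L')"
      unfolding vals far by (simp add: ring_distribs ac_simps)
    finally show ?thesis .
  qed
  show "peval (base_point n p) (cyc_bracket n p I J K L) =
      2 * of_int s1 * w1 * (matches n p J (star n p I) K L + matches n p (star n p I) J K L)
    + 2 * of_int s2 * w2 * (matches n p (star n p J) I K L + matches n p I (star n p J) K L)"
    unfolding cyc_bracket_def ident.insertion_sum summand matches_def
    by (simp only: sum.distrib sum_distrib_left distrib_left)
qed

lemma matches_weight:
  assumes "matches n p A B C D \<noteq> 0"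
  shows "weight n p A = weight n p C \<and> weight n p B = weight n p D"
proof -
  obtain t where t: "int n * int p dvd C + int n * t - A" "int n * int p dvd D + int n * t - B"
    using matches_nonzeroD[OF assms] by blast
  have "weight n p A = weight n p C" if "int n * int p dvd C + int n * t - A" for A C
  proof -
    have "int n dvd C + int n * t - A" using that by (rule dvd_mult_left)
    then have "(C + int n * t) mod int n = A mod int n" by (simp only: mod_eq_dvd_iff)
    then have "weight n p A = weight n p (C + int n * t)" by (simp add: weight_def)
    then show ?thesis by (simp only: weight_shift[OF n p])
  qed
  then show ?thesis using t by blast
qed

text \<open>Exchanging the chords reverses the crossing number and replaces \<open>t\<close> by
  \<open>- t\<close>. This transfers the invariance in the first chord, as in
  \<open>red_gen_cases\<close>, to the second.\<close>

lemma cyc_bracket_antisym: "cyc_bracket n p K L I J = - cyc_bracket n p I J K L"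
proof -
  have n0: "0 < n" using n by simp
  define f where "f t = of_int (cyc (int n * int p) I J (K + int n * t) (L + int n * t)) *
     (sym_gen n p J (K + int n * t) * sym_gen n p I (L + int n * t)
      - sym_gen n p I (K + int n * t) * sym_gen n p J (L + int n * t))" for t
  have per: "f (t + int p * w) = f t" for t w
  proof -
    have e: "x + int n * (t + int p * w) = (x + int n * t) + int n * int p * w" for x
      by (simp add: algebra_simps)
    show ?thesis unfolding f_def e by (simp only: sym_gen_periodic[OF n0 p] cyc_period[OF n0 p])
  qed
  have sh: "sym_gen n p x (y + int n * t) = sym_gen n p y (x + int n * (- t))" for x y t
  proof -
    have "sym_gen n p x (y + int n * t) = sym_gen n p (x + int n * (- t)) (y + int n * t + int n * (- t))"
      using sym_gen_shift[OF n0 p, of x "- t" "y + int n * t"] by simp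
    then show ?thesis by (simp add: sym_gen_commute[OF n0 p, of y])
  qed
  have cy: "cyc (int n * int p) K L (I + int n * t) (J + int n * t) =
      - cyc (int n * int p) I J (K + int n * (- t)) (L + int n * (- t))" for t
  proof -
    have "stairs (int n * int p) (x - (y + int n * t)) = - stairs (int n * int p) (y - (x + int n * (- t)))" for x y
      using stairs_uminus[of "int n * int p" "y - (x + int n * (- t))"] by (simp add: algebra_simps)
    then show ?thesis by (simp add: cyc_def)
  qed
  have "cyc_bracket n p K L I J = (\<Sum>t\<in>{0..<int p}. - f (- t))"
    unfolding cyc_bracket_def f_def cy
  proof (intro sum.cong refl)
    fix t
    show "of_int (- cyc (int n * int p) I J (K + int n * - t) (L + int n * - t)) *
      (sym_gen n p L (I + int n * t) * sym_gen n p K (J + int n * t) -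
       sym_gen n p K (I + int n * t) * sym_gen n p L (J + int n * t)) =
      - (of_int (cyc (int n * int p) I J (K + int n * - t) (L + int n * - t)) *
       (sym_gen n p J (K + int n * - t) * sym_gen n p I (L + int n * - t) -
        sym_gen n p I (K + int n * - t) * sym_gen n p J (L + int n * - t)))"
      unfolding sh[of L I t] sh[of K J t] sh[of K I t] sh[of L J t] by (simp add: mult.commute)
  qed
  also have "\<dots> = - (\<Sum>t\<in>{0..<int p}. f (- t))" by (simp add: sum_negf)
  also have "(\<Sum>t\<in>{0..<int p}. f (- t)) = (\<Sum>t\<in>{0..<int p}. f t)"
  proof -
    have fm: "f (t mod int p) = f t" for t using per[of "t mod int p" "t div int p"] by simp
    show ?thesis using p fm
      by (intro sum.reindex_bij_witness[where i = "\<lambda>t. (- t) mod int p" and j = "\<lambda>t. (- t) mod int p"])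
         (auto simp: mod_minus_eq)
  qed
  finally show ?thesis by (simp add: cyc_bracket_def f_def)
qed

section \<open>Chords and the generators that represent them\<close>

lemma gens_red_of_chord:
  assumes "\<not> int n * int p dvd L - K"
  shows "\<exists>y\<in>gens_red n p. \<forall>I J. cyc_bracket n p I J (fst (label n y)) (snd (label n y)) = cyc_bracket n p I J K L"
proof -
  have n0: "0 < n" using n by simp
  define i where "i = nat (K mod int n)"
  define j where "j = nat (L mod int n)"
  define e where "e = L div int n - K div int n"
  define r where "r = nat (e mod int p)"
  have ij: "i < n" "j < n" and r: "r < p" "int r = e mod int p"
    using n p by (simp_all add: i_def j_def r_def nat_less_iff)
  have KL: "K = int i + int n * (K div int n)" "L = int j + int n * (L div int n)"
    using n by (simp_all add: i_def j_def)
  have B: "cyc_bracket n p K L = cyc_bracket n p (int i) (int j + int n * int r)"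
  proof (intro ext)
    fix I J
    have "L = (int j + int n * int r + int n * int p * (e div int p)) + int n * (K div int n)"
    proof -
      have "int j + int n * int r + int n * int p * (e div int p) + int n * (K div int n)
          = int j + int n * (int p * (e div int p) + e mod int p) + int n * (K div int n)"
        unfolding r(2) by (simp only: ring_distribs ac_simps)
      also have "\<dots> = int j + int n * (L div int n)"
        unfolding mult_div_mod_eq by (simp add: e_def algebra_simps)
      finally show ?thesis using KL(2) by simp
    qed
    then have "cyc_bracket n p K L I J = cyc_bracket n p (int i + int n * (K div int n))
        ((int j + int n * int r + int n * int p * (e div int p)) + int n * (K div int n)) I J"
      using KL(1) by simp
    then show "cyc_bracket n p K L I J = cyc_bracket n p (int i) (int j + int n * int r) I J"
      by (simp only: cyc_bracket_shift[OF n0 p] cyc_bracket_period[OF n0 p])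
  qed
  have ne: "i \<noteq> j \<or> r \<noteq> 0"
  proof (rule ccontr)
    assume "\<not> ?thesis"
    then have "i = j" "int p dvd e" using r by auto
    then have "int n * int p dvd int n * e" by simp
    moreover have "L - K = int n * e" using KL \<open>i = j\<close> by (simp add: e_def algebra_simps)
    ultimately show False using assms by simp
  qed
  \<comment> \<open>At level 0 a generator has increasing indices, so a descending chord is reversed
    first.\<close>
  obtain k i' j' where g: "(k, i', j') \<in> gens n" "\<not> (i' = j' \<and> p dvd k)"
    "cyc_bracket n p (int i') (int j' + int n * int k) = cyc_bracket n p K L"
  proof (cases "r = 0 \<and> j < i")
    case True
    have "cyc_bracket n p (int j) (int i + int n * int 0) = cyc_bracket n p K L"
      unfolding B using True cyc_bracket_swap[OF n0 p, of "int j" "int i"] by (auto intro!: ext)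
    then show thesis using True ij by (intro that[of 0 j i]) (auto simp: gens_def)
  next
    case False
    then show thesis using ij ne r(1) by (intro that[of r i j]) (auto simp: gens_def B dest: dvd_imp_le)
  qed
  from red_gen_cases[OF n0 p g(1)] obtain r' j' i'' where y: "(r', j', i'') \<in> gens_red n p"
    "\<forall>I J. cyc_bracket n p (int j') (int i'' + int n * int r') I J = cyc_bracket n p K L I J"
    using g(2,3) by auto
  show ?thesis
  proof (intro bexI[OF _ y(1)] allI)
    fix I J
    show "cyc_bracket n p I J (fst (label n (r', j', i''))) (snd (label n (r', j', i''))) = cyc_bracket n p I J K L"
      using y(2) cyc_bracket_antisym[of I J] by (simp add: label_def)
  qed
qed

lemma label_match:
  assumes x: "x \<in> gens_red n p" "y \<in> gens_red n p"
    and m: "matches n p (fst (label n x)) (snd (label n x)) (fst (label n y)) (snd (label n y)) \<noteq> 0"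
  shows "x = y"
proof -
  obtain k i j where xe: "x = (k, i, j)" by (cases x)
  obtain k' i' j' where ye: "y = (k', i', j')" by (cases y)
  have ij: "i < n" "j < n" "i' < n" "j' < n" and k: "2 * k \<le> p" "2 * k' \<le> p"
    using x by (auto simp: xe ye gens_red_def)
  obtain t where "int n * int p dvd int i' + int n * t - int i"
      "int n * int p dvd int j' + int n * int k' + int n * t - (int j + int n * int k)"
    using matches_nonzeroD[OF m] by (auto simp: xe ye label_def)
  then have "int n * int p dvd int i' - int i + int n * t"
      "int n * int p dvd int j' - int j + int n * (int k' + t - int k)"
    by (simp_all add: algebra_simps)
  then have 1: "i' = i" "int p dvd t" "j' = j" "int p dvd int k' + t - int k"
    using ij by (subst (asm) (1 2) dvd_div_mod_iff; simp)+
  have "int p dvd (int k' + t - int k) - t" by (rule dvd_diff[OF 1(4,2)])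
  then have "int p dvd int k' - int k" by simp
  then have "k' = k" using dvd_imp_le_int[of "int k' - int k" "int p"] k p by fastforce
  with 1 show ?thesis by (simp add: xe ye)
qed

text \<open>Reversal negates the level modulo \<open>p\<close>, so the two levels are both 0 or both
  \<open>p / 2\<close>. The order imposed on the indices rules out level 0, and at level
  \<open>p / 2\<close> it leaves only equal indices.\<close>

lemma label_match_swap:
  assumes x: "x \<in> gens_red n p" "y \<in> gens_red n p"
    and m: "matches n p (snd (label n x)) (fst (label n x)) (fst (label n y)) (snd (label n y)) \<noteq> 0"
  shows "x = y \<and> even p"
proof -
  obtain k i j where xe: "x = (k, i, j)" by (cases x)
  obtain k' i' j' where ye: "y = (k', i', j')" by (cases y)
  have ij: "i < n" "j < n" "i' < n" "j' < n" and k: "2 * k \<le> p" "2 * k' \<le> p"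
    and k0: "k = 0 \<Longrightarrow> i < j" "k' = 0 \<Longrightarrow> i' < j'" "2 * k = p \<Longrightarrow> i \<le> j" "2 * k' = p \<Longrightarrow> i' \<le> j'"
    using x by (auto simp: xe ye gens_red_def)
  obtain t where "int n * int p dvd int i' + int n * t - (int j + int n * int k)"
      "int n * int p dvd int j' + int n * int k' + int n * t - int i"
    using matches_nonzeroD[OF m] by (auto simp: xe ye label_def)
  then have "int n * int p dvd int i' - int j + int n * (t - int k)"
      "int n * int p dvd int j' - int i + int n * (int k' + t)"
    by (simp_all add: algebra_simps)
  then have 1: "i' = j" "int p dvd t - int k" "j' = i" "int p dvd int k' + t"
    using ij by (subst (asm) (1 2) dvd_div_mod_iff; simp)+
  have "int p dvd (int k' + t) - (t - int k)" by (rule dvd_diff[OF 1(4,2)])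
  then have "int p dvd int (k' + k)" by simp
  then have "p dvd k' + k" by (simp only: of_nat_dvd_iff)
  then obtain c where c: "k' + k = p * c" by (auto elim: dvdE)
  have "p * c \<le> p * 1" using c k unfolding mult_1_right by linarith
  then have "c = 0 \<or> c = 1" using p by (simp only: mult_le_cancel1) auto
  then show ?thesis
  proof
    assume "c = 1"
    then have "2 * k = p" "2 * k' = p" using c k by auto
    then show ?thesis using k0 1 by (auto simp: xe ye)
  qed (use c k0 1 in auto)
qed

text \<open>Excludes, outside the slice, the two exceptions of \<open>peval_cyc_bracket\<close>:
  degenerate chords and chords from a point to its \<open>star\<close>.\<close>

lemma nonslice_not_cong:
  assumes x: "x \<in> gens_red n p - slice_gens n p"
  shows "\<not> int n * int p dvd snd (label n x) - fst (label n x)"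
    and "\<not> int n * int p dvd snd (label n x) - star n p (fst (label n x))"
proof -
  obtain k i j where xe: "x = (k, i, j)" by (cases x)
  have ij: "i < n" "j < n" and k: "2 * k \<le> p" and k0: "k = 0 \<Longrightarrow> i < j"
    using x by (auto simp: xe gens_red_def)
  show 1: "\<not> int n * int p dvd snd (label n x) - fst (label n x)"
  proof
    assume "int n * int p dvd snd (label n x) - fst (label n x)"
    then have "int n * int p dvd int j - int i + int n * int k" by (simp add: xe label_def algebra_simps)
    then have "j = i" "int p dvd int k" using ij by (subst (asm) dvd_div_mod_iff; simp)+
    then have "j = i" "k = 0" using k p dvd_imp_le[of p k] by auto
    then show False using k0 by simp
  qed
  show "\<not> int n * int p dvd snd (label n x) - star n p (fst (label n x))"
  proof
    assume d: "int n * int p dvd snd (label n x) - star n p (fst (label n x))"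
    show False
    proof (cases "even p")
      case True
      with d have "int n * int p dvd int j - int i + int n * (int k - int (p div 2))"
        by (simp add: xe label_def star_def algebra_simps)
      then have "j = i" using ij by (subst (asm) dvd_div_mod_iff; simp)+
      then show False using x True by (auto simp: xe slice_gens_def)
    next
      case False
      then obtain m where m: "p = 2 * m + 1" by (auto elim: oddE)
      then have pm: "p div 2 = m" by simp
      consider "i < n div 2" | "n div 2 \<le> i" "i < 2 * (n div 2)" | "2 * (n div 2) \<le> i" by linarith
      then show False
      proof cases
        case 1
        have "star n p (int i) = int (i + n div 2) + int n * int m"
          using 1 False ij pm by (simp add: star_def Let_def)
        with d have "int n * int p dvd int j - int (i + n div 2) + int n * (int k - int m)"
          by (simp add: xe label_def algebra_simps)
        moreover have "i + n div 2 < n" using 1 by linarith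
        ultimately have "j = i + n div 2" using ij by (subst (asm) dvd_div_mod_iff; simp)+
        then show False using x False 1 by (auto simp: xe slice_gens_def)
      next
        case 2
        have "star n p (int i) = int (i - n div 2) - int n * int m"
          using 2 False ij pm by (simp add: star_def Let_def of_nat_diff)
        with d have "int n * int p dvd int j - int (i - n div 2) + int n * int (k + m)"
          by (simp add: xe label_def algebra_simps)
        then have "j = i - n div 2" "int p dvd int (k + m)" using ij by (subst (asm) dvd_div_mod_iff; simp)+
        then have j: "j = i - n div 2" and "p dvd k + m" by (simp_all only: of_nat_dvd_iff)
        moreover have "0 < k" using k0 j by (cases "k = 0") auto
        ultimately show False using k m dvd_imp_le[of p "k + m"] by auto
      next
        case 3
        with d False ij have "int n * int p dvd snd (label n x) - fst (label n x)"
          by (simp add: xe label_def star_def Let_def)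
        with 1 show False by blast
      qed
    qed
  qed
qed

text \<open>Equal weights at both ends are the delicate case of \<open>transversal\<close>: for even
  \<open>p\<close> all such chords lie in the slice, for odd \<open>p\<close> only those starting at
  the larger residue of a pair are left outside.\<close>

lemma nonslice_same_weight:
  assumes x: "(k, i, j) \<in> gens_red n p - slice_gens n p" and w: "weight n p (int i) = weight n p (int j + int n * int k)"
  shows "odd p \<and> n div 2 \<le> i \<and> i < 2 * (n div 2) \<and> 0 < k \<and> (j = i \<or> j = i - n div 2)"
proof -
  have ij: "i < n" "j < n" and k0: "k = 0 \<Longrightarrow> i < j"
    using x by (auto simp: gens_red_def)
  have w': "weight n p (int i) = weight n p (int j)" using w by (simp only: weight_shift[OF n p])
  have odd: "odd p"
    using x w' ij by (auto simp: weight_def slice_gens_def)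
  have s: "\<not> (i = j \<and> \<not> (n div 2 \<le> i \<and> i < 2 * (n div 2)))" "\<not> (i < n div 2 \<and> j = i + n div 2)"
    using x odd by (auto simp: slice_gens_def)
  have "n div 2 \<le> i \<and> i < 2 * (n div 2) \<and> (j = i \<or> j = i - n div 2)"
    using w' odd s ij by (auto simp: weight_def Let_def not_less eq_diff_iff split: if_splits)
  moreover from this have "0 < k" using k0 n by (cases "k = 0") auto
  ultimately show ?thesis using odd by simp
qed

text \<open>\<open>star\<close> exchanges the residues of a pair, whereas these chords start at the
  larger one. Residues alone leave open only a reversed match of two chords from the larger to the
  smaller residue; it would make \<open>p\<close> divide \<open>k + k' - 1\<close>, which lies
  strictly between 0 and \<open>p\<close>.\<close>

lemma nonslice_no_star_match:
  assumes x: "(k, i, j) \<in> gens_red n p - slice_gens n p" and wx: "weight n p (int i) = weight n p (int j + int n * int k)"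
    and y: "(k', i', j') \<in> gens_red n p - slice_gens n p" and wy: "weight n p (int i') = weight n p (int j' + int n * int k')"
  shows "matches n p (star n p (int i)) (star n p (int j + int n * int k)) (int i') (int j' + int n * int k') = 0"
    and "matches n p (star n p (int j + int n * int k)) (star n p (int i)) (int i') (int j' + int n * int k') = 0"
proof -
  define h where "h = n div 2"
  have X: "odd p" "h \<le> i" "i < 2 * h" "0 < k" "j = i \<or> j = i - h"
    using nonslice_same_weight[OF x wx] by (simp_all add: h_def)
  have Y: "h \<le> i'" "i' < 2 * h" "0 < k'" "j' = i' \<or> j' = i' - h"
    using nonslice_same_weight[OF y wy] by (simp_all add: h_def)
  obtain m where m: "p = 2 * m + 1" using X(1) by (auto elim: oddE)
  have pm: "p div 2 = m" using m by simp
  have ij: "i < n" "j < n" "i' < n" "j' < n" and k: "k \<le> m" "k' \<le> m"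
    using x y by (auto simp: gens_red_def m)
  have h: "0 < h" using n by (simp add: h_def)
  have I: "star n p (int i) = int (i - h) - int n * int m"
    using X ij by (simp add: star_def pm h_def[symmetric] Let_def of_nat_diff)
  have wst: "weight n p (star n p A) = weight n p A" for A by (rule weight_star[OF n p])
  have wI: "weight n p (int i) = Suc (i - h)" "weight n p (int i') = Suc (i' - h)"
    using X Y ij by (simp_all add: weight_def Let_def h_def[symmetric])
  show "matches n p (star n p (int i)) (star n p (int j + int n * int k)) (int i') (int j' + int n * int k') = 0"
  proof (rule ccontr)
    assume nz: "\<not> ?thesis"
    then obtain t where t: "int n * int p dvd int i' + int n * t - star n p (int i)"
      using matches_nonzeroD by blast
    have "weight n p (int i) = weight n p (int i')"
      using matches_weight[OF nz] by (simp add: wst)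
    then have "i = i'" using wI X Y by simp
    from t have "int n * int p dvd int i' - int (i - h) + int n * (t + int m)" by (simp add: I algebra_simps)
    then have "i' = i - h" using ij by (subst (asm) dvd_div_mod_iff; simp)+
    then show False using \<open>i = i'\<close> h X by simp
  qed
  show "matches n p (star n p (int j + int n * int k)) (star n p (int i)) (int i') (int j' + int n * int k') = 0"
  proof (rule ccontr)
    assume nz: "\<not> ?thesis"
    then obtain t where t: "int n * int p dvd int i' + int n * t - star n p (int j + int n * int k)"
      "int n * int p dvd int j' + int n * int k' + int n * t - star n p (int i)"
      using matches_nonzeroD by blast
    have "weight n p (int j + int n * int k) = weight n p (int i')"
      using matches_weight[OF nz] by (simp add: wst)
    then have "weight n p (int i) = weight n p (int i')" using wx by simp
    then have ii: "i = i'" using wI X Y by simp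
    from t(2) have "int n * int p dvd int j' - int (i - h) + int n * (int k' + t + int m)" by (simp add: I algebra_simps)
    then have j': "j' = i - h" "int p dvd int k' + t + int m" using ij by (subst (asm) dvd_div_mod_iff; simp)+
    from X(5) show False
    proof
      assume "j = i"
      have st: "star n p (int j + int n * int k) = int (i - h) + int n * (int k - int m)"
        unfolding star_shift[OF n p] \<open>j = i\<close> I by (simp add: algebra_simps)
      from t(1) have "int n * int p dvd int i' - int (i - h) + int n * (t - (int k - int m))"
        unfolding st by (simp add: algebra_simps)
      then have "i' = i - h" using ij by (subst (asm) dvd_div_mod_iff; simp)+
      then show False using ii h X by simp
    next
      assume j: "j = i - h"
      then have "j < h" using X by simp
      then have "star n p (int j) = int j + int n * int m + int h"
        using ij X(1) by (simp add: star_def pm h_def[symmetric] Let_def)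
      then have st: "star n p (int j + int n * int k) = int i + int n * (int k + int m)"
        unfolding star_shift[OF n p] using X j by (simp add: of_nat_diff algebra_simps)
      from t(1) have "int n * int p dvd int i' - int i + int n * (t - (int k + int m))"
        unfolding st by (simp add: algebra_simps)
      then have "int p dvd t - (int k + int m)" using ij by (subst (asm) dvd_div_mod_iff; simp)+
      from dvd_diff[OF j'(2) this] have "int p dvd int k' + int k + 2 * int m" by (simp add: algebra_simps)
      moreover have "int k' + int k + 2 * int m = int (k + k' - 1) + int p" using X Y m by (simp add: of_nat_diff)
      ultimately have "int p dvd int (k + k' - 1)" by simp
      then have "p dvd k + k' - 1" by (simp only: of_nat_dvd_iff)
      then show False using X Y k m dvd_imp_le[of p "k + k' - 1"] by simp
    qed
  qed
qed

end

section \<open>Inverting the Poisson tensor transversally to the slice\<close>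

lemma matches_star_eqs:
  assumes "2 \<le> n" "0 < p"
  shows "matches n p A (star n p B) (star n p C) D = matches n p (star n p A) (star n p B) C D"
    and "matches n p (star n p A) B (star n p C) D = matches n p A B C D"
    and "matches n p A (star n p B) C (star n p D) = matches n p A B C D"
    and "matches n p (star n p A) B C (star n p D) = matches n p (star n p A) (star n p B) C D"
  by (simp_all add: matches_def congr_ind_star[OF assms] congr_ind_star_right[OF assms] congr_ind_star_star[OF assms])

context
  fixes n p :: nat
  assumes n: "2 \<le> n" and p: "0 < p"
begin

lemma exists_combination:
  assumes "\<not> int n * int p dvd L1 - K1" "\<not> int n * int p dvd L2 - K2"
  shows "\<exists>c. \<forall>x\<in>gens_red n p.
    (\<Sum>y\<in>gens_red n p. c y * peval f (red p (D_bracket (Var x) (Var y)))) =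
      c1 * peval f (cyc_bracket n p (fst (label n x)) (snd (label n x)) K1 L1)
    + c2 * peval f (cyc_bracket n p (fst (label n x)) (snd (label n x)) K2 L2)"
proof -
  let ?X = "gens_red n p"
  have n0: "0 < n" using n by simp
  obtain y1 where y1: "y1 \<in> ?X"
    "\<And>I J. cyc_bracket n p I J (fst (label n y1)) (snd (label n y1)) = cyc_bracket n p I J K1 L1"
    using gens_red_of_chord[OF n p assms(1)] by blast
  obtain y2 where y2: "y2 \<in> ?X"
    "\<And>I J. cyc_bracket n p I J (fst (label n y2)) (snd (label n y2)) = cyc_bracket n p I J K2 L2"
    using gens_red_of_chord[OF n p assms(2)] by blast
  have br: "red p (D_bracket (Var x) (Var y)) =
      cyc_bracket n p (fst (label n x)) (snd (label n x)) (fst (label n y)) (snd (label n y))"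
    if "x \<in> ?X" "y \<in> ?X" for x y
  proof -
    obtain r j i where x: "x = (r, j, i)" by (cases x)
    obtain s q l where y: "y = (s, q, l)" by (cases y)
    have "(r, j, i) \<in> gens n" "(s, q, l) \<in> gens n" using that gens_red_subset by (auto simp: x y)
    from red_gen_bracket[OF n0 p this] show ?thesis
      by (simp add: x y label_def D_bracket_Var del: gen_bracket.simps)
  qed
  define c where "c y = (if y = y1 then c1 else 0) + (if y = y2 then c2 else 0)" for y
  have "(\<Sum>y\<in>?X. c y * peval f (red p (D_bracket (Var x) (Var y)))) =
      c1 * peval f (cyc_bracket n p (fst (label n x)) (snd (label n x)) K1 L1)
    + c2 * peval f (cyc_bracket n p (fst (label n x)) (snd (label n x)) K2 L2)" if x: "x \<in> ?X" for x
  proof -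
    have "(\<Sum>y\<in>?X. c y * peval f (red p (D_bracket (Var x) (Var y)))) =
       (\<Sum>y\<in>?X. if y = y1 then c1 * peval f (red p (D_bracket (Var x) (Var y))) else 0)
     + (\<Sum>y\<in>?X. if y = y2 then c2 * peval f (red p (D_bracket (Var x) (Var y))) else 0)"
      unfolding sum.distrib[symmetric] by (intro sum.cong refl) (simp add: c_def distrib_right)
    also have "\<dots> = c1 * peval f (red p (D_bracket (Var x) (Var y1))) + c2 * peval f (red p (D_bracket (Var x) (Var y2)))"
      using y1(1) y2(1) finite_gens_red by simp
    finally show ?thesis using br[OF x y1(1)] br[OF x y2(1)] y1(2) y2(2) by simp
  qed
  then show ?thesis by blast
qed

text \<open>The two chords obtained from \<open>x0\<close> by applying \<open>star\<close> to one
  endpoint have brackets that see only \<open>x0\<close> and its image under \<open>star\<close>. If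
  the weights \<open>w\<close>, \<open>v\<close> of the endpoints differ, combining the brackets
  with coefficients \<open>w\<close>, \<open>v\<close> cancels the image. If they agree, the image
  is not represented outside the slice, and one bracket suffices.\<close>

lemma transversal:
  assumes x0: "x0 \<in> gens_red n p - slice_gens n p"
  shows "\<exists>c. \<forall>x\<in>gens_red n p - slice_gens n p.
    (\<Sum>y\<in>gens_red n p. c y * peval (base_point n p) (red p (D_bracket (Var x) (Var y)))) =
      (if x = x0 then 1 else 0)"
proof -
  let ?X = "gens_red n p" and ?L = "slice_gens n p" and ?bp = "base_point n p" and ?N = "int n * int p"
  define I0 where "I0 = fst (label n x0)"
  define J0 where "J0 = snd (label n x0)"
  define w where "w = (of_nat (weight n p I0) :: complex)"
  define v where "v = (of_nat (weight n p J0) :: complex)"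
  have nc0: "\<not> ?N dvd J0 - I0" "\<not> ?N dvd J0 - star n p I0"
    using nonslice_not_cong[OF n p x0] by (simp_all add: I0_def J0_def)
  have nc1: "\<not> ?N dvd star n p J0 - I0"
  proof
    assume "?N dvd star n p J0 - I0"
    then have "?N dvd I0 - star n p J0" by (simp add: dvd_diff_commute)
    from star_flip[OF n p this] nc0 show False by simp
  qed
  define M1 where "M1 x = peval ?bp (cyc_bracket n p (fst (label n x)) (snd (label n x)) (star n p I0) J0)" for x
  define M2 where "M2 x = peval ?bp (cyc_bracket n p (fst (label n x)) (snd (label n x)) I0 (star n p J0))" for x
  \<comment> \<open>\<open>a\<close> and \<open>b\<close> test whether \<open>x\<close> agrees with
    \<open>x0\<close>, directly or reversed; \<open>a'\<close> and \<open>b'\<close> test this for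
    the image of \<open>x\<close> under \<open>star\<close>.\<close>
  define a where "a x = matches n p (fst (label n x)) (snd (label n x)) I0 J0" for x
  define b where "b x = matches n p (snd (label n x)) (fst (label n x)) I0 J0" for x
  define a' where "a' x = matches n p (star n p (fst (label n x))) (star n p (snd (label n x))) I0 J0" for x
  define b' where "b' x = matches n p (star n p (snd (label n x))) (star n p (fst (label n x))) I0 J0" for x
  define wx where "wx x = (of_nat (weight n p (fst (label n x))) :: complex)" for x
  define vx where "vx x = (of_nat (weight n p (snd (label n x))) :: complex)" for x
  have M: "\<exists>s1 s2 :: complex. M1 x = 2 * s1 * wx x * (b' x + a x) + 2 * s2 * vx x * (b x + a' x)
      \<and> M2 x = 2 * s1 * wx x * (b x + a' x) + 2 * s2 * vx x * (b' x + a x)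
      \<and> (wx x \<noteq> 0 \<longrightarrow> s1 \<noteq> 0) \<and> (vx x \<noteq> 0 \<longrightarrow> s2 \<noteq> 0) \<and> (wx x \<noteq> 0 \<longrightarrow> vx x \<noteq> 0 \<longrightarrow> s2 = - s1)"
    if "x \<in> ?X - ?L" for x
  proof -
    let ?I = "fst (label n x)" and ?J = "snd (label n x)"
    note nc = nonslice_not_cong[OF n p that]
    note pb = peval_cyc_bracket[OF n p nc]
    define s1 where "s1 = stairs ?N (?I - ?J) + stairs ?N (?J - star n p ?I) + stairs ?N (star n p ?I - ?I)"
    define s2 where "s2 = stairs ?N (?I - star n p ?J) + stairs ?N (star n p ?J - ?J) + stairs ?N (?J - ?I)"
    note pb = pb[folded s1_def s2_def]
    show ?thesis
    proof (intro exI conjI)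
      show "M1 x = 2 * of_int s1 * wx x * (b' x + a x) + 2 * of_int s2 * vx x * (b x + a' x)"
        unfolding M1_def pb(1) wx_def vx_def a_def b_def a'_def b'_def matches_star_eqs[OF n p] ..
      show "M2 x = 2 * of_int s1 * wx x * (b x + a' x) + 2 * of_int s2 * vx x * (b' x + a x)"
        unfolding M2_def pb(1) wx_def vx_def a_def b_def a'_def b'_def matches_star_eqs[OF n p] ..
    qed (use pb(2,3,4) in \<open>auto simp: wx_def vx_def\<close>)
  qed
  have wt: "a x \<noteq> 0 \<Longrightarrow> wx x = w \<and> vx x = v" "a' x \<noteq> 0 \<Longrightarrow> wx x = w \<and> vx x = v"
    "b x \<noteq> 0 \<Longrightarrow> wx x = v \<and> vx x = w" "b' x \<noteq> 0 \<Longrightarrow> wx x = v \<and> vx x = w" for x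
    unfolding a_def b_def a'_def b'_def wx_def vx_def w_def v_def
    by (drule matches_weight[OF n p], simp add: weight_star[OF n p])+
  have ab: "a x = 0" "b x = 0" if "x \<in> ?X - ?L" "x \<noteq> x0" for x
    using label_match[OF n p, of x x0] label_match_swap[OF n p, of x x0] that x0
    by (auto simp: a_def b_def I0_def J0_def)
  have a0: "a x0 \<noteq> 0" unfolding a_def I0_def J0_def by (rule matches_refl_nonzero[OF n p])
  have "\<exists>c1 c2. (\<forall>x\<in>?X - ?L. x \<noteq> x0 \<longrightarrow> c1 * M1 x + c2 * M2 x = 0) \<and> c1 * M1 x0 + c2 * M2 x0 \<noteq> 0"
  proof (cases "w = v")
    case False
    \<comment> \<open>Weights are natural numbers, so distinct ones have distinct squares. With
      \<open>s2 = - s1\<close> the wanted coefficient \<open>s1 w^2 + s2 v^2\<close> is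
      \<open>s1 (w^2 - v^2)\<close>.\<close>
    have wv: "w\<^sup>2 \<noteq> v\<^sup>2"
      using False unfolding w_def v_def by (metis of_nat_eq_iff of_nat_power power2_eq_imp_eq zero_le)
    have eq: "\<exists>\<kappa>. \<kappa> \<noteq> 0 \<and> w * M1 x + v * M2 x = \<kappa> * (a x + b x)" if x: "x \<in> ?X - ?L" for x
    proof -
      obtain s1 s2 where s: "M1 x = 2 * s1 * wx x * (b' x + a x) + 2 * s2 * vx x * (b x + a' x)"
        "M2 x = 2 * s1 * wx x * (b x + a' x) + 2 * s2 * vx x * (b' x + a x)"
        "wx x \<noteq> 0 \<Longrightarrow> s1 \<noteq> 0" "vx x \<noteq> 0 \<Longrightarrow> s2 \<noteq> 0" "wx x \<noteq> 0 \<Longrightarrow> vx x \<noteq> 0 \<Longrightarrow> s2 = - s1"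
        using M[OF x] by blast
      have nz: "s1 * w\<^sup>2 + s2 * v\<^sup>2 \<noteq> 0" if "wx x = w" "vx x = v"
      proof (cases "w = 0 \<or> v = 0")
        case True
        then show ?thesis using s(3,4) that False by auto
      next
        case f: False
        then have "s2 = - s1" "s1 \<noteq> 0" using s(3,5) that by auto
        then show ?thesis using wv by auto
      qed
      have nz': "s1 * v\<^sup>2 + s2 * w\<^sup>2 \<noteq> 0" if "wx x = v" "vx x = w"
      proof (cases "w = 0 \<or> v = 0")
        case True
        then show ?thesis using s(3,4) that False by auto
      next
        case f: False
        then have "s2 = - s1" "s1 \<noteq> 0" using s(3,5) that by auto
        then show ?thesis using wv by auto
      qed
      \<comment> \<open>The coefficient of the image under \<open>star\<close>: either a weight is
        zero or the two signs are opposite.\<close>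
      have cancel: "w * v * (s1 + s2) = 0" if "wx x = w \<and> vx x = v \<or> wx x = v \<and> vx x = w"
      proof (cases "w = 0 \<or> v = 0")
        case f: False
        then have "wx x \<noteq> 0" "vx x \<noteq> 0" using that by auto
        then have "s2 = - s1" by (rule s(5))
        then show ?thesis by simp
      qed auto
      consider "wx x = w" "vx x = v" | "wx x = v" "vx x = w" | "a x = 0" "a' x = 0" "b x = 0" "b' x = 0"
        using wt[of x] by blast
      then show ?thesis
      proof cases
        case 1
        then have b: "b x = 0" "b' x = 0" using wt(3,4)[of x] False by auto
        have "w * M1 x + v * M2 x = 2 * (s1 * w\<^sup>2 + s2 * v\<^sup>2) * a x + 2 * (w * v * (s1 + s2)) * a' x"
          unfolding s(1,2) 1 b by (simp add: algebra_simps power2_eq_square)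
        also have "\<dots> = 2 * (s1 * w\<^sup>2 + s2 * v\<^sup>2) * (a x + b x)"
          using cancel 1 b by (simp only:) simp
        finally show ?thesis using nz[OF 1] by (metis mult_eq_0_iff zero_neq_numeral)
      next
        case 2
        then have a: "a x = 0" "a' x = 0" using wt(1,2)[of x] False by auto
        have "w * M1 x + v * M2 x = 2 * (s1 * v\<^sup>2 + s2 * w\<^sup>2) * b x + 2 * (w * v * (s1 + s2)) * b' x"
          unfolding s(1,2) 2 a by (simp add: algebra_simps power2_eq_square)
        also have "\<dots> = 2 * (s1 * v\<^sup>2 + s2 * w\<^sup>2) * (a x + b x)"
          using cancel 2 a by (simp only:) simp
        finally show ?thesis using nz'[OF 2] by (metis mult_eq_0_iff zero_neq_numeral)
      next
        case 3
        then show ?thesis using s(1,2) by (intro exI[of _ 1]) simp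
      qed
    qed
    have "b x0 = 0"
      using wt(1,3)[of x0] a0 False by auto
    show ?thesis
    proof (intro exI conjI ballI impI)
      fix x assume x: "x \<in> ?X - ?L" "x \<noteq> x0"
      from eq[OF x(1)] ab[OF x] show "w * M1 x + v * M2 x = 0" by auto
    next
      from eq[OF x0] a0 \<open>b x0 = 0\<close> show "w * M1 x0 + v * M2 x0 \<noteq> 0" by auto
    qed
  next
    case True
    obtain k0 i0 j0 where x0e: "x0 = (k0, i0, j0)" by (cases x0)
    have I0: "I0 = int i0" "J0 = int j0 + int n * int k0" by (simp_all add: I0_def J0_def x0e label_def)
    have w0: "weight n p (int i0) = weight n p (int j0 + int n * int k0)"
      using True by (simp add: w_def v_def I0)
    note ns0 = nonslice_same_weight[OF n p x0[unfolded x0e] w0]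
    have "weight n p (int i0) \<noteq> 0"
      using ns0 x0 by (auto simp: weight_def Let_def x0e gens_red_def)
    then have wnz: "w \<noteq> 0" by (simp add: w_def I0)
    have star0: "a' x = 0" "b' x = 0" if x: "x \<in> ?X - ?L" for x
    proof -
      obtain k i j where xe: "x = (k, i, j)" by (cases x)
      have "a' x = 0 \<and> b' x = 0"
      proof (rule ccontr)
        assume nz: "\<not> ?thesis"
        then have "wx x = vx x" using wt(2,4)[of x] True by auto
        then have wx: "weight n p (int i) = weight n p (int j + int n * int k)"
          by (simp add: wx_def vx_def xe label_def)
        show False
          using nonslice_no_star_match[OF n p x[unfolded xe] wx x0[unfolded x0e] w0] nz
          by (simp add: a'_def b'_def xe label_def I0)
      qed
      then show "a' x = 0" "b' x = 0" by auto
    qed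
    \<comment> \<open>A chord equal to its own reversal would need \<open>p\<close> even, but equal
      weights outside the slice occur only for odd \<open>p\<close>.\<close>
    have b0: "b x0 = 0"
      using label_match_swap[OF n p, of x0 x0] ns0 x0 by (auto simp: b_def I0_def J0_def)
    have "M1 x = 0" if "x \<in> ?X - ?L" "x \<noteq> x0" for x
      using M[OF that(1)] ab[OF that] star0[OF that(1)] by auto
    moreover have "M1 x0 \<noteq> 0"
      using M[OF x0] star0[OF x0] b0 a0 wt(1)[of x0] wnz True by auto
    ultimately show ?thesis by (intro exI[of _ 1] exI[of _ 0]) auto
  qed
  then obtain c1 c2 where c: "\<And>x. x \<in> ?X - ?L \<Longrightarrow> x \<noteq> x0 \<Longrightarrow> c1 * M1 x + c2 * M2 x = 0"
    "c1 * M1 x0 + c2 * M2 x0 \<noteq> 0" by blast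
  define r where "r = c1 * M1 x0 + c2 * M2 x0"
  have "\<not> ?N dvd J0 - star n p I0" "\<not> ?N dvd star n p J0 - I0" using nc0 nc1 by auto
  from exists_combination[OF this, of ?bp "c1 / r" "c2 / r"] obtain e where
    e: "\<And>x. x \<in> ?X \<Longrightarrow> (\<Sum>y\<in>?X. e y * peval ?bp (red p (D_bracket (Var x) (Var y)))) =
      c1 / r * M1 x + c2 / r * M2 x" unfolding M1_def M2_def by blast
  have "c1 / r * M1 x + c2 / r * M2 x = (if x = x0 then 1 else 0)" if "x \<in> ?X - ?L" for x
  proof -
    have "c1 / r * M1 x + c2 / r * M2 x = (c1 * M1 x + c2 * M2 x) / r" by (simp add: add_divide_distrib)
    then show ?thesis using c that by (auto simp: r_def)
  qed
  then show ?thesis using e by (intro exI[of _ e]) auto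
qed

lemma card_alg_indep_central_le:
  assumes "S \<subseteq> center (Dp_bracket p) (Dp_alg n p)" "alg_indep (\<lambda>f. f) S"
  shows "finite S \<and> card S \<le> n * p div 2"
proof -
  have "slice_gens n p \<subseteq> gens_red n p"
    by (auto simp: slice_gens_def)
  then show ?thesis
    using card_alg_indep_center_le[OF finite_gens_red _ transversal, of S] assms
    unfolding Dp_bracket_def Dp_alg_def card_slice_gens by blast
qed

end

section \<open>Prescribing the determinant\<close>

text \<open>The value at \<open>z\<close> is \<open>z (z + 1 / z - s)\<close>: a product of such
  factors corresponds to a polynomial in \<open>z + 1 / z\<close> with the numbers \<open>s\<close>
  as its roots.\<close>

abbreviation quad :: "complex \<Rightarrow> complex poly" where
  "quad s \<equiv> [:1, - s, 1:]"

lemma monic_splits: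
  fixes q :: "complex poly"
  assumes "lead_coeff q = 1" "degree q = d"
  shows "\<exists>s. q = (\<Prod>j<d. [:- s j, 1:])"
proof -
  have "q \<noteq> 0" using assms(1) by auto
  then obtain A where A: "size A = d" "q = (\<Prod>x\<in>#A. [:-x, 1:])"
    using alg_closed_imp_factorization[of q] assms by auto
  obtain xs where xs: "mset xs = A" by (metis ex_mset)
  have len: "length xs = d" using A xs by (metis size_mset)
  have "q = prod_list (map (\<lambda>x. [:- x, 1:]) xs)" using A(2) xs by (metis mset_map prod_mset_prod_list)
  also have "\<dots> = (\<Prod>j<d. [:- (xs ! j), 1:])"
    using len by (simp add: prod.list_conv_set_nth atLeast0LessThan)
  finally show ?thesis by blast
qed

lemma poly_eq_if_eq_nonzero:
  fixes f g :: "complex poly"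
  assumes "\<And>z. z \<noteq> 0 \<Longrightarrow> poly f z = poly g z"
  shows "f = g"
proof -
  have "[:0, 1:] * (f - g) = 0"
    using assms by (subst poly_all_0_iff_0[symmetric]) auto
  then show ?thesis by simp
qed

lemma poly_quad:
  assumes "z \<noteq> 0"
  shows "poly (quad s) z = z * ((1 + z\<^sup>2) / z - s)"
  using assms by (simp add: field_simps power2_eq_square)

lemma poly_prod_quad:
  assumes "z \<noteq> 0"
  shows "poly (\<Prod>j\<in>J. quad (s j)) z = z ^ card J * (\<Prod>j\<in>J. ((1 + z\<^sup>2) / z - s j))"
  by (simp only: poly_prod poly_quad[OF assms] prod.distrib prod_constant)

lemma poly_prod_quad_eq_poly:
  assumes "z \<noteq> 0" "q = (\<Prod>j<d. [:- s j, 1:])"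
  shows "poly (\<Prod>j<d. quad (s j)) z = z ^ d * poly q ((1 + z\<^sup>2) / z)"
  using poly_prod_quad[OF assms(1), of s "{..<d}"] by (simp add: assms(2) poly_prod)

text \<open>A polynomial in \<open>z + 1 / z\<close>, times \<open>z\<^sup>c\<close>: its coefficients are determined recursively.\<close>

lemma prescribe_coeffs_even:
  fixes y :: "nat \<Rightarrow> complex"
  shows "\<exists>s. \<forall>k\<in>{1..c}. coeff (\<Prod>j<c. quad (s j)) k = y k"
proof -
  \<comment> \<open>A triangular system: the summand with index \<open>i\<close> begins with
    \<open>z^i\<close> and coefficient 1, so changing \<open>w i\<close> adjusts coefficient
    \<open>i\<close> without disturbing the lower ones.\<close>
  define S where "S w = (\<Sum>i\<le>c. smult (w i) ([:1, 0, 1:] ^ (c - i) * [:0, 1:] ^ i))" for w :: "nat \<Rightarrow> complex"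
  have low: "coeff ([:1, 0, 1 :: complex:] ^ a * [:0, 1:] ^ i) k = (if k = i then 1 else 0)" if "k \<le> i" for a i k
  proof -
    have "[:0, 1:] ^ i = monom (1 :: complex) i" by (simp add: monom_altdef)
    then have "coeff ([:1, 0, 1:] ^ a * [:0, 1 :: complex:] ^ i) k = (if k < i then 0 else coeff ([:1, 0, 1:] ^ a) (k - i))"
      by (simp add: mult.commute coeff_monom_mult)
    moreover have "coeff ([:1, 0, 1 :: complex:] ^ a) 0 = 1" by (simp add: coeff_0_power)
    ultimately show ?thesis using that by auto
  qed
  have "\<exists>w. w 0 = 1 \<and> (\<forall>k\<in>{1..r}. coeff (S w) k = y k)" if "r \<le> c" for r
    using that
  proof (induction r)
    case 0
    then show ?case by (intro exI[of _ "\<lambda>_. 1"]) simp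
  next
    case (Suc r)
    then obtain w where w: "w 0 = 1" "\<forall>k\<in>{1..r}. coeff (S w) k = y k" by auto
    define e where "e = y (Suc r) - coeff (S w) (Suc r)"
    define w' where "w' = w(Suc r := w (Suc r) + e)"
    have "S w' = S w + smult e ([:1, 0, 1:] ^ (c - Suc r) * [:0, 1:] ^ Suc r)"
    proof -
      have "S w' = (\<Sum>i\<le>c. smult (w i) ([:1, 0, 1:] ^ (c - i) * [:0, 1:] ^ i) +
          (if i = Suc r then smult e ([:1, 0, 1:] ^ (c - i) * [:0, 1:] ^ i) else 0))"
        unfolding S_def by (intro sum.cong refl) (auto simp: w'_def smult_add_left)
      then show ?thesis using Suc.prems by (simp add: S_def sum.distrib)
    qed
    then have "coeff (S w') k = coeff (S w) k + (if k = Suc r then e else 0)" if "k \<le> Suc r" for k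
      by (simp only: coeff_add coeff_smult low[OF that]) simp
    then have "\<forall>k\<in>{1..Suc r}. coeff (S w') k = y k" using w(2) by (auto simp: e_def le_Suc_eq)
    moreover have "w' 0 = 1" using w(1) by (simp add: w'_def)
    ultimately show ?case by blast
  qed
  from this[of c] obtain w where w: "w 0 = 1" "\<forall>k\<in>{1..c}. coeff (S w) k = y k" by auto
  \<comment> \<open>\<open>S w\<close> is \<open>z^c\<close> times the value of \<open>q\<close> at
    \<open>z + 1 / z\<close>. As \<open>w 0 = 1\<close>, \<open>q\<close> is monic of degree
    \<open>c\<close>, and its roots are the required \<open>s j\<close>.\<close>
  define q where "q = (\<Sum>i\<le>c. monom (w i) (c - i))"
  have cq: "coeff q k = (if k \<le> c then w (c - k) else 0)" for k
  proof -
    have "coeff q k = (\<Sum>i\<le>c. if c - i = k then w i else 0)" by (simp add: q_def coeff_sum)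
    also have "\<dots> = (\<Sum>i\<le>c. if k \<le> c \<and> i = c - k then w i else 0)" by (intro sum.cong) auto
    finally show ?thesis by auto
  qed
  have "degree q = c"
    by (rule antisym[OF degree_le le_degree]) (auto simp: cq w)
  then obtain s where s: "q = (\<Prod>j<c. [:- s j, 1:])" using monic_splits[of q c] by (auto simp: cq w)
  have "(\<Prod>j<c. quad (s j)) = S w"
  proof (rule poly_eq_if_eq_nonzero)
    fix z :: complex assume z: "z \<noteq> 0"
    have "poly (\<Prod>j<c. quad (s j)) z = z ^ c * (\<Sum>i\<le>c. w i * ((1 + z\<^sup>2) / z) ^ (c - i))"
      using poly_prod_quad_eq_poly[OF z s] by (simp add: q_def poly_sum poly_monom)
    also have "\<dots> = (\<Sum>i\<le>c. w i * ((1 + z\<^sup>2) ^ (c - i) * z ^ i))"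
      unfolding sum_distrib_left
    proof (intro sum.cong refl)
      fix i assume "i \<in> {..c}"
      then have "z ^ c = z ^ (c - i) * z ^ i" by (simp flip: power_add)
      then show "z ^ c * (w i * ((1 + z\<^sup>2) / z) ^ (c - i)) = w i * ((1 + z\<^sup>2) ^ (c - i) * z ^ i)"
        using z by (simp add: power_divide)
    qed
    also have "\<dots> = poly (S w) z" by (simp add: S_def poly_sum power2_eq_square)
    finally show "poly (\<Prod>j<c. quad (s j)) z = poly (S w) z" .
  qed
  then have "\<forall>k\<in>{1..c}. coeff (\<Prod>j<c. quad (s j)) k = y k" using w(2) by simp
  then show ?thesis by blast
qed

lemma prescribe_coeffs_odd:
  fixes y :: "nat \<Rightarrow> complex"
  shows "\<exists>s. \<forall>k\<in>{1..c}. coeff ([:1, 1:] * (\<Prod>j<c. quad (s j))) k = y k"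
proof -
  \<comment> \<open>The prescribed series, with constant term 1, divided by
    \<open>1 + z\<close>.\<close>
  define y' where "y' = rec_nat (1 :: complex) (\<lambda>k x. y (Suc k) - x)"
  obtain s where s: "\<forall>k\<in>{1..c}. coeff (\<Prod>j<c. quad (s j)) k = y' k"
    using prescribe_coeffs_even by blast
  have "coeff (\<Prod>j<c. quad (s j)) 0 = 1" by (simp add: poly_prod flip: poly_0_coeff_0)
  then have s': "coeff (\<Prod>j<c. quad (s j)) k = y' k" if "k \<le> c" for k
    using s that by (cases k) (auto simp: y'_def)
  have "coeff ([:1, 1:] * (\<Prod>j<c. quad (s j))) k = y k" if kc: "k \<in> {1..c}" for k
  proof -
    obtain k' where k: "k = Suc k'" using kc by (cases k) auto
    have "coeff ([:1, 1:] * (\<Prod>j<c. quad (s j))) k = coeff (\<Prod>j<c. quad (s j)) k + coeff (\<Prod>j<c. quad (s j)) k'"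
      by (simp add: k)
    also have "\<dots> = y' k + y' k'" using kc by (simp add: s' k)
    finally show ?thesis by (simp add: y'_def k)
  qed
  then show ?thesis by blast
qed

section \<open>Palindromic polynomials and block matrices\<close>

definition palindromic :: "nat \<Rightarrow> complex poly \<Rightarrow> bool" where
  "palindromic d f \<longleftrightarrow> degree f = d \<and> coeff f 0 = 1 \<and> reflect_poly f = f"

lemma palindromic_mult: "palindromic d f \<Longrightarrow> palindromic e g \<Longrightarrow> palindromic (d + e) (f * g)"
  by (auto simp: palindromic_def reflect_poly_mult coeff_mult_0 intro!: degree_mult_eq)

lemma palindromic_1: "palindromic 0 1"
  by (simp add: palindromic_def)

lemma palindromic_prod:
  "(\<And>i. i \<in> I \<Longrightarrow> palindromic d (F i)) \<Longrightarrow> palindromic (card I * d) (prod F I)"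
  by (induction I rule: infinite_finite_induct) (auto simp: palindromic_1 intro: palindromic_mult)

lemma palindromic_quad: "palindromic 2 (quad s)"
  by (simp add: palindromic_def reflect_poly_pCons)

lemma palindromic_linear: "palindromic 1 [:1, 1:]"
  by (simp add: palindromic_def reflect_poly_pCons)

lemma palindromic_coeff:
  assumes "palindromic d f" "k \<le> d"
  shows "coeff f (d - k) = coeff f k"
  using assms coeff_reflect_poly[of f k] by (simp add: palindromic_def)

text \<open>Column operations, collected in the unitriangular matrix \<open>E\<close> and using the
  inverse \<open>v i\<close> of \<open>f i\<close>, clear the upper off-diagonal entry of each
  block; a lower triangular matrix is left.\<close>

lemma det_paired:
  fixes f g g' v :: "nat \<Rightarrow> 'a :: comm_ring_1"
  assumes h: "2 * h \<le> n" and v: "\<And>i. i < h \<Longrightarrow> f i * v i = 1"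
  shows "det (mat n n (\<lambda>(i, j). if i = j then f i else if i < h \<and> j = i + h then g i
      else if j < h \<and> i = j + h then g' j else 0)) =
    (\<Prod>i<h. f i * f (i + h) - g i * g' i) * (\<Prod>i\<in>{2*h..<n}. f i)" (is "det ?T = _")
proof -
  define E where "E = mat n n (\<lambda>(i, j). if i = j then 1 else if i < h \<and> j = i + h then - v i * g i else 0)"
  define T where "T = ?T"
  have T: "T \<in> carrier_mat n n" and E: "E \<in> carrier_mat n n" by (simp_all add: T_def E_def)
  have TE: "T * E \<in> carrier_mat n n" by (rule mult_carrier_mat[OF T E])
  have T_entry: "T $$ (i, j) = (if i = j then f i else if i < h \<and> j = i + h then g i
      else if j < h \<and> i = j + h then g' j else 0)" if "i < n" "j < n" for i j
    using that by (simp add: T_def)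
  have "det E = prod_list (diag_mat E)"
    by (rule det_upper_triangular[OF _ E]) (auto simp: E_def)
  also have "\<dots> = 1"
    by (auto simp: diag_mat_def E_def prod.list_conv_set_nth intro!: prod.neutral)
  finally have detE: "det E = 1" .
  define d where "d i = (if h \<le> i \<and> i < 2 * h then f i - g' (i - h) * v (i - h) * g (i - h) else f i)" for i
  have W: "(T * E) $$ (a, b) = T $$ (a, b) +
      (if h \<le> b \<and> b < 2 * h then T $$ (a, b - h) * (- v (b - h) * g (b - h)) else 0)"
    if ab: "a < n" "b < n" for a b
  proof -
    have "(T * E) $$ (a, b) = (\<Sum>c<n. T $$ (a, c) * E $$ (c, b))"
      using ab T E by (simp add: scalar_prod_def atLeast0LessThan)
    also have "\<dots> = (\<Sum>c<n. (if c = b then T $$ (a, b) else 0) +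
        (if h \<le> b \<and> b < 2 * h \<and> c = b - h then T $$ (a, b - h) * (- v (b - h) * g (b - h)) else 0))"
      using ab h by (intro sum.cong refl) (auto simp: E_def)
    also have "\<dots> = T $$ (a, b) +
      (if h \<le> b \<and> b < 2 * h then T $$ (a, b - h) * (- v (b - h) * g (b - h)) else 0)"
      using ab h unfolding sum.distrib by auto
    finally show ?thesis .
  qed
  have upper: "(T * E) $$ (a, b) = 0" if "a < b" "b < n" for a b
  proof -
    have "f a * (v a * g a) = g a" if "a < h" using v[OF that] by (metis mult.assoc mult_1)
    then show ?thesis using that h by (subst W) (auto simp: T_entry)
  qed
  have diag: "(T * E) $$ (a, a) = d a" if "a < n" for a
    using that h by (subst W) (auto simp: T_entry d_def mult.assoc)
  have "det (T * E) = det (transpose_mat (T * E))"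
    by (rule det_transpose[OF TE, symmetric])
  also have "\<dots> = prod_list (diag_mat (transpose_mat (T * E)))"
  proof (rule det_upper_triangular)
    show "transpose_mat (T * E) \<in> carrier_mat n n" using TE by simp
    show "upper_triangular (transpose_mat (T * E))"
    proof (rule upper_triangularI)
      fix i j assume "j < i" "i < dim_row (transpose_mat (T * E))"
      then have "j < i" "i < n" using carrier_matD[OF TE] by (simp_all only: index_transpose_mat)
      then show "transpose_mat (T * E) $$ (i, j) = 0"
        using upper carrier_matD[OF TE] by (subst index_transpose_mat) simp_all
    qed
  qed
  also have "\<dots> = (\<Prod>a<n. d a)"
    using diag carrier_matD[OF TE]
    by (simp add: diag_mat_def prod.list_conv_set_nth atLeast0LessThan del: index_mult_mat)
  also have "{..<n} = {..<h} \<union> {h..<2*h} \<union> {2*h..<n}" using h by auto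
  also have "prod d \<dots> = prod d {..<h} * prod d {h..<2*h} * prod d {2*h..<n}"
    using h by (subst prod.union_disjoint, auto)+
  also have "prod d {h..<2*h} = (\<Prod>i<h. d (i + h))"
    by (rule prod.reindex_bij_witness[where i = "\<lambda>i. i + h" and j = "\<lambda>i. i - h"]) auto
  also have "prod d {..<h} * (\<Prod>i<h. d (i + h)) = (\<Prod>i<h. f i * f (i + h) - g i * g' i)"
    unfolding prod.distrib[symmetric]
  proof (intro prod.cong refl)
    fix i assume "i \<in> {..<h}"
    then have i: "i < h" by simp
    have "f i * (g' i * v i * g i) = (f i * v i) * (g i * g' i)" by (simp add: ac_simps)
    then show "d i * d (i + h) = f i * f (i + h) - g i * g' i"
      using i v[OF i] by (simp add: d_def right_diff_distrib)
  qed
  also have "prod d {2*h..<n} = (\<Prod>i\<in>{2*h..<n}. f i)" by (intro prod.cong) (auto simp: d_def)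
  finally show ?thesis using detE det_mult[OF T E] by (simp add: T_def)
qed

definition block_point :: "nat \<Rightarrow> nat \<Rightarrow> (nat \<Rightarrow> complex poly) \<Rightarrow> (nat \<Rightarrow> complex) \<Rightarrow> gen \<Rightarrow> complex" where
  "block_point p h f \<gamma> x = (case x of (k, i, j) \<Rightarrow>
     if i = j then coeff (f i) k else if Suc (2 * k) = p \<and> i < h \<and> j = i + h then \<gamma> i else 0)"

text \<open>The relations force a transposed entry at level \<open>p - k\<close>: for
  \<open>p = 2 m + 1\<close>, the entry \<open>\<gamma> z^m\<close> above the diagonal comes with
  \<open>\<gamma> z^(m + 1)\<close> below it, so a block has \<open>- \<gamma>^2 z^p\<close> in its
  determinant.\<close>

lemma peval_block_point:
  assumes p: "1 \<le> p" and h: "even p \<Longrightarrow> h = 0" and f: "palindromic p (f i)"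
  shows "Abs_fps (\<lambda>k. peval (block_point p h f \<gamma>) (gp_coeff p k i j)) =
    (if i = j then fps_of_poly (f i) else if i < h \<and> j = i + h then fps_const (\<gamma> i) * fps_X ^ (p div 2)
      else if j < h \<and> i = j + h then fps_const (\<gamma> j) * fps_X ^ Suc (p div 2) else 0)"
proof (rule fps_ext)
  fix k
  let ?b = "block_point p h f \<gamma>"
  have f': "coeff (f i) 0 = 1" "coeff (f i) p = 1" "\<And>k. p < k \<Longrightarrow> coeff (f i) k = 0"
    using f palindromic_coeff[OF f, of 0] by (auto simp: palindromic_def coeff_eq_0)
  have sym: "k \<le> p \<Longrightarrow> coeff (f i) (p - k) = coeff (f i) k" using palindromic_coeff[OF f] by blast
  show "fps_nth (Abs_fps (\<lambda>k. peval ?b (gp_coeff p k i j))) k = fps_nth (if i = j then fps_of_poly (f i)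
      else if i < h \<and> j = i + h then fps_const (\<gamma> i) * fps_X ^ (p div 2)
      else if j < h \<and> i = j + h then fps_const (\<gamma> j) * fps_X ^ Suc (p div 2) else 0) k"
  proof (cases "i = j")
    case True
    then show ?thesis using f' sym p
      by (auto simp: gp_coeff_def A0_def red_gen.simps Let_def block_point_def)
  next
    case False
    show ?thesis
    proof (cases "even p")
      case True
      have "Suc (2 * k) \<noteq> p" for k using True by auto
      then show ?thesis using False h[OF True] by (auto simp: gp_coeff_def A0_def red_gen.simps Let_def block_point_def)
    next
      case odd: False
      then obtain m where m: "p = Suc (2 * m)" by (auto elim: oddE)
      then have pm: "p div 2 = m" by simp
      have "peval ?b (gp_coeff p k i j) = (if i < h \<and> j = i + h then (if k = m then \<gamma> i else 0)
        else if j < h \<and> i = j + h then (if k = Suc m then \<gamma> j else 0) else 0)"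
        using False by (auto simp: gp_coeff_def A0_def red_gen.simps Let_def block_point_def m)
      then show ?thesis using False by (simp add: pm fps_X_power_nth del: power_Suc)
    qed
  qed
qed

text \<open>A product of two palindromic polynomials of odd degree has at least a double zero at -1.
  The off-diagonal term \<open>\<gamma>^2 z^p\<close> lifts this restriction on the determinant of a
  block.\<close>

lemma odd_block:
  fixes s :: "nat \<Rightarrow> complex"
  assumes p: "p = Suc (2 * m)"
  shows "\<exists>\<gamma> f f'. palindromic p f \<and> palindromic p f' \<and> f * f' - monom (\<gamma>\<^sup>2) p = (\<Prod>j<p. quad (s j))"
proof -
  define q where "q = (\<Prod>j<p. [:- s j, 1:])"
  have "lead_coeff q = 1" unfolding q_def lead_coeff_prod by simp
  moreover have "degree q = p" by (simp add: q_def degree_prod_eq_sum_degree)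
  ultimately have q: "degree q = p" "lead_coeff q = 1" by simp_all
  \<comment> \<open>The point \<open>z = -1\<close> is where \<open>z + 1 / z = -2\<close>, and this
    \<open>\<gamma>\<close> makes \<open>Q\<close> vanish at -2. The factor \<open>u + 2\<close> of
    \<open>Q\<close> at \<open>u = z + 1 / z\<close> is \<open>(1 + z)^2 / z\<close> and gives one
    factor \<open>1 + z\<close> to each polynomial; the remaining \<open>2 m\<close> roots are
    shared equally.\<close>
  define \<gamma> where "\<gamma> = csqrt (- poly q (- 2))"
  define Q where "Q = q + [:\<gamma>\<^sup>2:]"
  have Q: "degree Q = p" "lead_coeff Q = 1"
  proof -
    show "degree Q = p" unfolding Q_def using q p by (subst degree_add_eq_left) auto
    then show "lead_coeff Q = 1" using q p by (simp add: Q_def)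
  qed
  have "poly Q (- 2) = 0" by (simp add: Q_def \<gamma>_def)
  then obtain q1 where q1: "Q = [:2, 1:] * q1" by (auto simp: poly_eq_0_iff_dvd elim: dvdE)
  have "q1 \<noteq> 0" using Q q1 p by auto
  then have "degree Q = Suc (degree q1)" unfolding q1 by (subst degree_mult_eq) auto
  then have "degree q1 = 2 * m" "lead_coeff q1 = 1" using Q p lead_coeff_mult[of "[:2, 1:]" q1] by (auto simp: q1)
  then obtain r where r: "q1 = (\<Prod>j<2*m. [:- r j, 1:])" using monic_splits[of q1] by auto
  let ?f = "[:1, 1:] * (\<Prod>j<m. quad (r j))" and ?f' = "[:1, 1:] * (\<Prod>j<m. quad (r (m + j)))"
  have pal: "palindromic p ([:1, 1:] * (\<Prod>j<m. quad (t j)))" for t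
    using palindromic_mult[OF palindromic_linear palindromic_prod[of "{..<m}" 2 "\<lambda>j. quad (t j)"]] palindromic_quad
    by (simp add: p mult.commute)
  have split: "(\<Prod>j<m. quad (r j)) * (\<Prod>j<m. quad (r (m + j))) = (\<Prod>j<2*m. quad (r j))"
  proof -
    have "{..<2*m} = {..<m} \<union> {m..<2*m}" by auto
    then have "(\<Prod>j<2*m. quad (r j)) = (\<Prod>j<m. quad (r j)) * (\<Prod>j\<in>{m..<2*m}. quad (r j))"
      by (simp add: prod.union_disjoint ivl_disj_int)
    also have "(\<Prod>j\<in>{m..<2*m}. quad (r j)) = (\<Prod>j<m. quad (r (m + j)))"
      by (rule prod.reindex_bij_witness[where i = "\<lambda>j. m + j" and j = "\<lambda>j. j - m"]) auto
    finally show ?thesis by simp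
  qed
  have eq: "?f * ?f' - monom (\<gamma>\<^sup>2) p = (\<Prod>j<p. quad (s j))"
  proof (rule poly_eq_if_eq_nonzero)
    fix z :: complex assume z: "z \<noteq> 0"
    let ?s = "(1 + z\<^sup>2) / z"
    have "(x * u) * (x * v) = x\<^sup>2 * (u * v)" for x u v :: "complex poly"
      by (simp only: power2_eq_square ac_simps)
    then have "?f * ?f' = [:1, 1:]\<^sup>2 * (\<Prod>j<2*m. quad (r j))"
      by (simp only: split[symmetric])
    then have "poly (?f * ?f') z = (1 + z)\<^sup>2 * (z ^ (2 * m) * poly q1 ?s)"
      by (simp only: poly_mult poly_power poly_prod_quad_eq_poly[OF z r]) simp
    also have "(1 + z)\<^sup>2 = z * (2 + ?s)" using z by (simp add: field_simps power2_eq_square)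
    also have "z * (2 + ?s) * (z ^ (2 * m) * poly q1 ?s) = z ^ p * poly Q ?s"
    proof -
      have "poly Q x = (2 + x) * poly q1 x" for x by (simp only: q1 poly_mult) simp
      then show ?thesis by (simp only: p power_Suc ac_simps)
    qed
    also have "\<dots> = z ^ p * poly q ?s + \<gamma>\<^sup>2 * z ^ p" by (simp add: Q_def algebra_simps)
    also have "z ^ p * poly q ?s = poly (\<Prod>j<p. quad (s j)) z"
      using poly_prod_quad_eq_poly[OF z q_def] by simp
    finally show "poly (?f * ?f' - monom (\<gamma>\<^sup>2) p) z = poly (\<Prod>j<p. quad (s j)) z"
      by (simp add: poly_monom)
  qed
  show ?thesis
    by (rule exI[of _ \<gamma>], rule exI[of _ ?f], rule exI[of _ ?f'])
       (rule conjI[OF pal[of r] conjI[OF pal[of "\<lambda>j. r (m + j)"] eq]])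
qed

lemma fps_of_poly_unit:
  assumes "palindromic d f"
  shows "fps_of_poly f * inverse (fps_of_poly f) = 1"
proof -
  have "fps_nth (fps_of_poly f) 0 \<noteq> 0" using assms by (simp add: palindromic_def)
  then show ?thesis using inverse_mult_eq_1[of "fps_of_poly f"] by (simp add: mult.commute)
qed

lemma peval_det_coeff_block_point:
  assumes p: "1 \<le> p" and h: "2 * h \<le> n" "even p \<Longrightarrow> h = 0"
    and f: "\<And>i. i < n \<Longrightarrow> palindromic p (f i)"
  shows "peval (block_point p h f \<gamma>) (det_coeff n p k) =
    coeff ((\<Prod>i<h. f i * f (i + h) - monom ((\<gamma> i)\<^sup>2) p) * (\<Prod>i\<in>{2*h..<n}. f i)) k"
proof -
  let ?b = "block_point p h f \<gamma>"
  define \<Phi> where "\<Phi> F = Abs_fps (\<lambda>k. peval ?b (fps_nth F k))" for F :: "gen cpoly fps"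
  have "comm_ring_hom \<Phi>"
    by unfold_locales (auto simp: \<Phi>_def fps_mult_nth ident.insertion_sum intro!: fps_ext)
  then have det: "\<Phi> (det (Gp_fps n p)) = det (map_mat \<Phi> (Gp_fps n p))"
    by (rule comm_ring_hom.hom_det[symmetric])
  let ?m = "p div 2"
  have "map_mat \<Phi> (Gp_fps n p) = mat n n (\<lambda>(i, j). if i = j then fps_of_poly (f i)
      else if i < h \<and> j = i + h then fps_const (\<gamma> i) * fps_X ^ ?m
      else if j < h \<and> i = j + h then fps_const (\<gamma> j) * fps_X ^ Suc ?m else 0)"
    (is "_ = ?T")
  proof (rule eq_matI)
    fix i j assume "i < dim_row ?T" "j < dim_col ?T"
    then have ij: "i < n" "j < n" by simp_all
    have "map_mat \<Phi> (Gp_fps n p) $$ (i, j) = Abs_fps (\<lambda>k. peval ?b (gp_coeff p k i j))"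
      using ij by (simp add: Gp_fps_def \<Phi>_def)
    then show "map_mat \<Phi> (Gp_fps n p) $$ (i, j) = ?T $$ (i, j)"
      using ij peval_block_point[where f = f and i = i and j = j and h = h and \<gamma> = \<gamma>, OF p h(2) f[OF ij(1)]] by simp
  qed (simp_all add: Gp_fps_def)
  then have "\<Phi> (det (Gp_fps n p)) = (\<Prod>i<h. fps_of_poly (f i) * fps_of_poly (f (i + h))
      - (fps_const (\<gamma> i) * fps_X ^ ?m) * (fps_const (\<gamma> i) * fps_X ^ Suc ?m))
      * (\<Prod>i\<in>{2*h..<n}. fps_of_poly (f i))"
    unfolding det using h(1) f
    by (simp only:) (rule det_paired[where v = "\<lambda>i. inverse (fps_of_poly (f i))"], auto intro!: fps_of_poly_unit[of p])
  also have "\<dots> = fps_of_poly ((\<Prod>i<h. f i * f (i + h) - monom ((\<gamma> i)\<^sup>2) p) * (\<Prod>i\<in>{2*h..<n}. f i))"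
  proof -
    have "(fps_const c * fps_X ^ ?m) * (fps_const c * fps_X ^ Suc ?m) = fps_of_poly (monom (c\<^sup>2) p)" if "0 < h" for c :: complex
    proof -
      have "odd p" using h(2) that by auto
      then have "p = ?m + Suc ?m" by presburger
      then have "fps_X ^ p = (fps_X ^ ?m * fps_X ^ Suc ?m :: complex fps)" by (metis power_add)
      moreover have "fps_const (c\<^sup>2) = fps_const c * fps_const c" by (simp add: power2_eq_square)
      ultimately show ?thesis unfolding fps_of_poly_monom by (simp only: ac_simps)
    qed
    then show ?thesis
      unfolding fps_of_poly_mult fps_of_poly_prod fps_of_poly_diff
      by (intro arg_cong2[where f = times] prod.cong refl) auto
  qed
  finally have "fps_nth (\<Phi> (det (Gp_fps n p))) k = coeff ((\<Prod>i<h. f i * f (i + h) - monom ((\<gamma> i)\<^sup>2) p) * (\<Prod>i\<in>{2*h..<n}. f i)) k"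
    by simp
  then show ?thesis by (simp add: \<Phi>_def det_coeff_conv_fps[OF p])
qed

text \<open>By the transposition symmetry of \<open>G\<^sub>p\<close> the determinant is palindromic
  of degree \<open>n p\<close> with constant term 1, so the coefficients from 1 to
  \<open>n p div 2\<close> are the ones that can be free. They are shown to take arbitrary values
  simultaneously.\<close>

lemma alg_indep_det_coeff:
  assumes p: "1 \<le> p"
  shows "alg_indep (det_coeff n p) {1..n * p div 2}"
proof (rule alg_indep_if_surj)
  fix y :: "nat \<Rightarrow> complex"
  show "\<exists>a. \<forall>k\<in>{1..n * p div 2}. peval a (det_coeff n p k) = y k"
  proof (cases "even p")
    case True
    then obtain m where m: "p = 2 * m" by auto
    obtain s where s: "\<forall>k\<in>{1..n*m}. coeff (\<Prod>j<n*m. quad (s j)) k = y k"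
      using prescribe_coeffs_even by blast
    define f where "f i = (\<Prod>j\<in>{i*m..<i*m+m}. quad (s j))" for i
    have "palindromic p (f i)" for i
      using palindromic_prod[of "{i*m..<i*m+m}" 2 "\<lambda>j. quad (s j)"] palindromic_quad
      by (simp add: f_def m mult.commute)
    then have "peval (block_point p 0 f (\<lambda>_. 0)) (det_coeff n p k) = coeff (\<Prod>j<n*m. quad (s j)) k" for k
      using prod.nat_group[of "\<lambda>j. quad (s j)" m n]
      by (subst peval_det_coeff_block_point[OF p]) (simp_all add: f_def atLeast0LessThan)
    then show ?thesis using s by (intro exI[of _ "block_point p 0 f (\<lambda>_. 0)"]) (simp add: m)
  next
    case False
    then obtain m where m: "p = Suc (2 * m)" by (auto elim: oddE)
    define h where "h = n div 2"
    \<comment> \<open>For \<open>n\<close> and \<open>p\<close> odd the palindromic determinant has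
      odd degree and is divisible by \<open>1 + z\<close>; the unpaired last diagonal entry supplies
      this factor.\<close>
    define E where "E = (if even n then 1 else [:1, 1:] :: complex poly)"
    define c where "c = n * p div 2"
    have c: "c = h * p + (if even n then 0 else m)"
    proof (cases "even n")
      case True
      then have "n = 2 * h" by (simp add: h_def)
      then show ?thesis using True by (simp add: c_def)
    next
      case odd: False
      then have "n = Suc (2 * h)" by (simp add: h_def)
      then have "n * p = 2 * (h * p + m) + 1" by (simp add: m)
      then show ?thesis using odd by (simp add: c_def)
    qed
    have "\<exists>s. \<forall>k\<in>{1..c}. coeff (E * (\<Prod>j<c. quad (s j))) k = y k"
      using prescribe_coeffs_even[of c y] prescribe_coeffs_odd[of c y] by (auto simp: E_def)
    then obtain s where s: "\<forall>k\<in>{1..c}. coeff (E * (\<Prod>j<c. quad (s j))) k = y k" by blast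
    define R where "R u t \<longleftrightarrow> palindromic p (fst (snd t)) \<and> palindromic p (snd (snd t)) \<and>
        fst (snd t) * snd (snd t) - monom ((fst t)\<^sup>2) p = (\<Prod>j<p. quad (s (u * p + j)))"
      for u and t :: "complex \<times> complex poly \<times> complex poly"
    have "\<exists>t. R u t" for u
    proof -
      from odd_block[OF m, of "\<lambda>j. s (u * p + j)"] obtain c F F' where
        "palindromic p F" "palindromic p F'" "F * F' - monom (c\<^sup>2) p = (\<Prod>j<p. quad (s (u * p + j)))"
        by (elim exE conjE)
      then have "R u (c, F, F')" by (simp add: R_def)
      then show ?thesis by (rule exI)
    qed
    then have "\<exists>t. \<forall>u. R u (t u)" by (intro choice allI)
    then obtain t where t: "\<forall>u. R u (t u)" by (elim exE)
    define \<gamma> where "\<gamma> u = fst (t u)" for u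
    define F where "F u = fst (snd (t u))" for u
    define F' where "F' u = snd (snd (t u))" for u
    have F: "\<And>u. palindromic p (F u)" "\<And>u. palindromic p (F' u)"
      "\<And>u. F u * F' u - monom ((\<gamma> u)\<^sup>2) p = (\<Prod>j<p. quad (s (u * p + j)))"
      using t by (simp_all only: R_def \<gamma>_def F_def F'_def)
    define f where "f i = (if i < h then F i else if i < 2 * h then F' (i - h)
      else [:1, 1:] * (\<Prod>j\<in>{h*p..<h*p+m}. quad (s j)))" for i
    have "palindromic p ([:1, 1:] * (\<Prod>j\<in>{h*p..<h*p+m}. quad (s j)))"
      using palindromic_mult[OF palindromic_linear palindromic_prod[of "{h*p..<h*p+m}" 2 "\<lambda>j. quad (s j)"]] palindromic_quad
      by (simp add: m mult.commute)
    then have pal: "palindromic p (f i)" for i using F by (simp add: f_def)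
    have "(\<Prod>i<h. f i * f (i + h) - monom ((\<gamma> i)\<^sup>2) p) = (\<Prod>i<h. \<Prod>j<p. quad (s (i * p + j)))"
      using F(3) by (intro prod.cong refl) (simp add: f_def)
    also have "\<dots> = (\<Prod>j<h*p. quad (s j))"
    proof -
      have "(\<Prod>j<p. quad (s (i * p + j))) = (\<Prod>j\<in>{i*p..<i*p+p}. quad (s j))" for i
        by (rule prod.reindex_bij_witness[where i = "\<lambda>j. j - i * p" and j = "\<lambda>j. i * p + j"]) auto
      then show ?thesis using prod.nat_group[of "\<lambda>j. quad (s j)" p h] by simp
    qed
    also have "\<dots> * (\<Prod>i\<in>{2*h..<n}. f i) = E * (\<Prod>j<c. quad (s j))"
    proof (cases "even n")
      case True
      then have "n = 2 * h" by (simp add: h_def)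
      then show ?thesis using True by (simp add: E_def c)
    next
      case odd: False
      then have "n = Suc (2 * h)" by (simp add: h_def)
      then have "{2*h..<n} = {2*h}" by auto
      moreover have "{..<h*p+m} = {..<h*p} \<union> {h*p..<h*p+m}" by auto
      then have "(\<Prod>j<h*p+m. quad (s j)) = (\<Prod>j<h*p. quad (s j)) * (\<Prod>j\<in>{h*p..<h*p+m}. quad (s j))"
        by (simp add: prod.union_disjoint ivl_disj_int)
      ultimately show ?thesis using odd by (simp add: E_def c f_def ac_simps del: mult_pCons_left mult_pCons_right)
    qed
    finally have prod: "(\<Prod>i<h. f i * f (i + h) - monom ((\<gamma> i)\<^sup>2) p) * (\<Prod>i\<in>{2*h..<n}. f i) = E * (\<Prod>j<c. quad (s j))" .
    have "2 * h \<le> n" by (simp add: h_def)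
    then have "peval (block_point p h f \<gamma>) (det_coeff n p k) = coeff (E * (\<Prod>j<c. quad (s j))) k" for k
      using False pal peval_det_coeff_block_point[OF p, of h n f \<gamma> k] by (simp only: prod)
    then show ?thesis using s by (intro exI[of _ "block_point p h f \<gamma>"]) (simp add: c_def)
  qed
qed

section \<open>Braid group transformations\<close>

definition gp_coeff_int :: "nat \<Rightarrow> int \<Rightarrow> nat \<Rightarrow> nat \<Rightarrow> gen cpoly" where
  "gp_coeff_int p k i j = (if k < 0 then 0 else gp_coeff p (nat k) i j)"

text \<open>With entries \<open>b z^e\<close> on the left and \<open>b z^(-e)\<close> in the
  transposed factor, conjugation only shifts levels. Levels are integers, because it must be shown
  that the negative ones drop out.\<close>

definition conj_coeff :: "nat \<Rightarrow> (nat \<Rightarrow> nat \<Rightarrow> gen cpoly) \<Rightarrow> (nat \<Rightarrow> nat \<Rightarrow> int) \<Rightarrow>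
    (int \<Rightarrow> nat \<Rightarrow> nat \<Rightarrow> gen cpoly) \<Rightarrow> int \<Rightarrow> nat \<Rightarrow> nat \<Rightarrow> gen cpoly" where
  "conj_coeff n b e F k i j = (\<Sum>c<n. \<Sum>d<n. b i c * b j d * F (k - e i c + e j d) c d)"

definition laurent_mat :: "nat \<Rightarrow> (nat \<Rightarrow> nat \<Rightarrow> gen cpoly) \<Rightarrow> (nat \<Rightarrow> nat \<Rightarrow> int) \<Rightarrow> gen cpoly fls mat" where
  "laurent_mat n b e = mat n n (\<lambda>(i, j). fls_const (b i j) * fls_X_intpow (e i j))"

lemma nth_conjugation:
  assumes A: "A \<in> carrier_mat n n" and F: "\<And>i j k. i < n \<Longrightarrow> j < n \<Longrightarrow> fls_nth (A $$ (i, j)) k = F k i j"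
    and ij: "i < n" "j < n"
  shows "fls_nth ((laurent_mat n b e * A * transpose_mat (laurent_mat n b (\<lambda>i j. - e i j))) $$ (i, j)) k
    = conj_coeff n b e F k i j"
proof -
  have "(laurent_mat n b e * A * transpose_mat (laurent_mat n b (\<lambda>i j. - e i j))) $$ (i, j) =
    (\<Sum>d<n. (\<Sum>c<n. fls_const (b i c) * fls_X_intpow (e i c) * A $$ (c, d)) *
       (fls_const (b j d) * fls_X_intpow (- e j d)))" (is "?M = _")
    using A ij by (simp add: laurent_mat_def scalar_prod_def atLeast0LessThan)
  also have "\<dots> = (\<Sum>d<n. \<Sum>c<n. fls_const (b i c * b j d) * (fls_X_intpow (e i c) * (fls_X_intpow (- e j d) * A $$ (c, d))))"
    (is "_ = ?S") unfolding sum_distrib_right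
    by (intro sum.cong refl) (simp only: fls_const_mult_const[symmetric] ac_simps)
  finally have conj: "?M = ?S" .
  have "fls_nth ?S k = (\<Sum>d<n. \<Sum>c<n. b i c * b j d * F (k - e i c + e j d) c d)"
    unfolding fls_nth_sum
  proof (intro sum.cong refl)
    fix c d assume "c \<in> {..<n}" "d \<in> {..<n}"
    then have "fls_nth (A $$ (c, d)) (k - e i c + e j d) = F (k - e i c + e j d) c d" using F by simp
    then show "fls_nth (fls_const (b i c * b j d) * (fls_X_intpow (e i c) * (fls_X_intpow (- e j d) * A $$ (c, d)))) k =
        b i c * b j d * F (k - e i c + e j d) c d"
      by (simp only: fls_X_intpow_times_conv_shift fls_mult_const_nth fls_shift_nth) (simp add: algebra_simps)
  qed
  also have "\<dots> = conj_coeff n b e F k i j" unfolding conj_coeff_def by (rule sum.swap)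
  finally show ?thesis by (simp only: conj)
qed

lemma nth_G_mat: "i < n \<Longrightarrow> j < n \<Longrightarrow> fls_nth (G_mat n $$ (i, j)) k = G_int k i j"
  by (simp add: G_mat_def G_int_def cong: if_cong)

lemma nth_Gp_mat: "1 \<le> p \<Longrightarrow> i < n \<Longrightarrow> j < n \<Longrightarrow> fls_nth (Gp_mat n p $$ (i, j)) k = gp_coeff_int p k i j"
  by (simp add: Gp_mat_conv_fps Gp_fps_def gp_coeff_int_def cong: if_cong)

lemma gp_coeff_int_transpose:
  assumes "1 \<le> p"
  shows "gp_coeff_int p (int p - k) j i = gp_coeff_int p k i j"
proof (cases "0 \<le> k \<and> k \<le> int p")
  case True
  then obtain l where k: "k = int l" "l \<le> p" using nonneg_int_cases by (metis of_nat_le_iff)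
  then have pk: "int p - k = int (p - l)" by (simp add: of_nat_diff)
  show ?thesis unfolding pk using k assms red_gen_transpose[of l p i j]
    by (auto simp: gp_coeff_int_def gp_coeff_def simp del: of_nat_diff)
qed (use assms in \<open>auto simp: gp_coeff_int_def gp_coeff_def\<close>)

lemma red_G_int_diff:
  assumes "1 \<le> p"
  shows "red p (G_int k i j) - red p (G_int (k - int p) i j) = gp_coeff_int p k i j"
proof (cases "k < 0")
  case False
  then obtain l where k: "k = int l" using nonneg_int_cases by (metis not_less)
  note gp_coeff_conv_diff[OF assms, of l i j]
  moreover have "G_int (int l - int p) i j = (if l < p then 0 else G_coeff (l - p) i j)"
    by (auto simp: G_int_def nat_diff_distrib)
  ultimately show ?thesis by (auto simp: k gp_coeff_int_def G_int_def split: if_splits)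
qed (use assms in \<open>simp add: gp_coeff_int_def G_int_def\<close>)

lemma red_in_Dp_alg:
  assumes "0 < p" "f \<in> D_alg n"
  shows "red p f \<in> Dp_alg n p"
  unfolding red_def Dp_alg_def
  by (rule subst_in_poly_alg[OF assms(2)[unfolded D_alg_def]])
     (use red_gen_in_Dp_alg[OF assms(1)] in \<open>auto simp: Dp_alg_def\<close>)

lemma subst_subst: "subst \<sigma> (subst \<tau> f) = subst (\<lambda>x. subst \<sigma> (\<tau> x)) f"
  unfolding subst_conv_insertion
  by (rule ring_hom_insertion[OF Cst.coef_hom_axioms Cst.coef_hom_axioms, of _ UNIV]) auto

lemma subst_cong: "f \<in> poly_alg X \<Longrightarrow> (\<And>x. x \<in> X \<Longrightarrow> \<sigma> x = \<tau> x) \<Longrightarrow> subst \<sigma> f = subst \<tau> f"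
  unfolding subst_conv_insertion by (rule insertion_cong[OF Cst.coef_hom_axioms])

lemma conj_coeff_diff:
  "conj_coeff n b e F k i j - conj_coeff n b e F' k i j = conj_coeff n b e (\<lambda>k i j. F k i j - F' k i j) k i j"
  by (simp add: conj_coeff_def right_diff_distrib sum_subtractf)

text \<open>The exponents enter with opposite signs on the two sides, so transposing and replacing
  \<open>k\<close> by \<open>P - k\<close> merely exchanges the two summations.\<close>

lemma conj_coeff_transpose:
  assumes "\<And>k i j. F (P - k) j i = F k i j"
  shows "conj_coeff n b e F (P - k) j i = conj_coeff n b e F k i j"
proof -
  have "conj_coeff n b e F (P - k) j i = (\<Sum>d<n. \<Sum>c<n. b j c * b i d * F (P - k - e j c + e i d) c d)"
    unfolding conj_coeff_def by (rule sum.swap)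
  also have "\<dots> = conj_coeff n b e F k i j"
    unfolding conj_coeff_def
  proof (intro sum.cong refl)
    fix c d
    have "F (P - k - e j d + e i c) d c = F (P - (k - e i c + e j d)) d c" by (simp add: algebra_simps)
    then show "b j d * b i c * F (P - k - e j d + e i c) d c = b i c * b j d * F (k - e i c + e j d) c d"
      by (simp add: assms mult.commute)
  qed
  finally show ?thesis .
qed

text \<open>Conjugation by a matrix with monomial entries descends to the reduction as soon as the conjugate of
  \<open>G\<^sub>p\<close> is again a power series in \<open>\<lambda>\<^sup>-\<^sup>1\<close> with upper unitriangular constant term: the symmetry under
  \<open>\<lambda>\<close> to \<open>\<lambda>\<^sup>-\<^sup>1\<close> and transposition is preserved automatically.\<close>

lemma conjugation_descends:
  fixes n p :: nat and b :: "nat \<Rightarrow> nat \<Rightarrow> gen cpoly" and e :: "nat \<Rightarrow> nat \<Rightarrow> int"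
  assumes p: "1 \<le> p"
    and b: "\<And>i c. i < n \<Longrightarrow> c < n \<Longrightarrow> b i c \<in> D_alg n"
  defines "rb \<equiv> \<lambda>i c. red p (b i c)"
  assumes neg: "\<And>k i j. i < n \<Longrightarrow> j < n \<Longrightarrow> k < 0 \<Longrightarrow> conj_coeff n rb e (gp_coeff_int p) k i j = 0"
    and tri: "\<And>i j. i < n \<Longrightarrow> j < n \<Longrightarrow> j \<le> i \<Longrightarrow> conj_coeff n rb e (gp_coeff_int p) 0 i j = (if i = j then 1 else 0)"
  defines "\<beta> \<equiv> coeff_hom (laurent_mat n b e * G_mat n * transpose_mat (laurent_mat n b (\<lambda>i j. - e i j)))"
  shows "\<exists>\<phi>. induced_on_reduction n p \<beta> \<phi> \<and>
    acts_as \<phi> n (Gp_mat n p) (laurent_mat n rb e * Gp_mat n p * transpose_mat (laurent_mat n rb (\<lambda>i j. - e i j)))"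
proof -
  have p0: "0 < p" using p by simp
  define N where "N = conj_coeff n rb e (gp_coeff_int p)"
  define \<tau> where "\<tau> x = (case x of (k, i, j) \<Rightarrow> fls_nth ((laurent_mat n b e * G_mat n *
     transpose_mat (laurent_mat n b (\<lambda>i j. - e i j))) $$ (i, j)) (int k))" for x :: gen
  define \<rho> where "\<rho> x = red p (\<tau> x)" for x
  define \<rho>z where "\<rho>z = conj_coeff n rb e (\<lambda>k i j. red p (G_int k i j))"
  have \<rho>: "\<rho> (k, i, j) = \<rho>z (int k) i j" if "i < n" "j < n" for k i j
  proof -
    have G_carrier: "G_mat n \<in> carrier_mat n n" by (simp add: G_mat_def)
    have "\<tau> (k, i, j) = conj_coeff n b e G_int (int k) i j"
      unfolding \<tau>_def prod.case by (rule nth_conjugation) (use that G_carrier in \<open>simp_all add: nth_G_mat\<close>)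
    then show ?thesis by (simp add: \<rho>_def \<rho>z_def conj_coeff_def red_sum rb_def)
  qed
  \<comment> \<open>Multiplication by \<open>1 - \<lambda>^(-p)\<close>, read off at level
    \<open>k\<close>: the conjugate of the reduced series is recovered from that of
    \<open>G\<^sub>p\<close> by recursion with step \<open>p\<close>.\<close>
  have step: "\<rho>z k i j = \<rho>z (k - int p) i j + N k i j" for k i j
  proof -
    have "\<rho>z (k - int p) i j = conj_coeff n rb e (\<lambda>k i j. red p (G_int (k - int p) i j)) k i j"
      unfolding \<rho>z_def conj_coeff_def by (intro sum.cong refl) (simp add: algebra_simps)
    then have "\<rho>z k i j - \<rho>z (k - int p) i j = N k i j"
      by (simp only: \<rho>z_def N_def conj_coeff_diff red_G_int_diff[OF p])
    then show ?thesis by (simp add: diff_eq_eq add.commute)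
  qed
  have N_sym: "N (int p - k) j i = N k i j" for k i j
    unfolding N_def by (rule conj_coeff_transpose) (rule gp_coeff_int_transpose[OF p])
  have N_high: "N k i j = 0" if "i < n" "j < n" "int p < k" for k i j
    using neg[of j i "int p - k"] N_sym[of k j i] that by (simp add: N_def)
  \<comment> \<open>At negative levels \<open>N\<close> is zero, so the recursion makes
    \<open>\<rho>z\<close> invariant under lowering the level by \<open>p\<close>; far enough down,
    beyond the exponents bounded by \<open>M\<close>, it is zero because \<open>G_int\<close>
    is.\<close>
  have \<rho>_neg: "\<rho>z k i j = 0" if ij: "i < n" "j < n" and k: "k < 0" for k i j
  proof -
    have shift: "\<rho>z k i j = \<rho>z (k - int p * int w) i j" for w
    proof (induction w)
      case (Suc w)
      have "k - int p * int w < 0" using k by (simp add: add_nonneg_pos less_le_trans[OF k])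
      then have "N (k - int p * int w) i j = 0" using neg ij by (simp add: N_def)
      then show ?case using Suc step[of "k - int p * int w" i j] by (simp add: algebra_simps)
    qed simp
    define M where "M = (\<Sum>c<n. \<Sum>d<n. nat \<bar>e i c\<bar> + nat \<bar>e j d\<bar>)"
    have "\<rho>z (k - int p * int M) i j = 0"
      unfolding \<rho>z_def conj_coeff_def
    proof (intro sum.neutral ballI)
      fix c d assume cd: "c \<in> {..<n}" "d \<in> {..<n}"
      have "nat \<bar>e i c\<bar> + nat \<bar>e j d\<bar> \<le> (\<Sum>d<n. nat \<bar>e i c\<bar> + nat \<bar>e j d\<bar>)"
        using cd by (intro member_le_sum) auto
      also have "\<dots> \<le> M" unfolding M_def using cd by (intro member_le_sum[of c]) auto
      finally have "\<bar>e i c\<bar> + \<bar>e j d\<bar> \<le> int M" by linarith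
      moreover have "1 * int M \<le> int p * int M" using p by (intro mult_right_mono) auto
      ultimately have "k - int p * int M - e i c + e j d < 0" using k by linarith
      then show "rb i c * rb j d * red p (G_int (k - int p * int M - e i c + e j d) c d) = 0"
        by (simp add: G_int_def)
    qed
    then show ?thesis using shift[of M] by simp
  qed
  have \<rho>_low: "\<rho>z k i j = N k i j" if "i < n" "j < n" "k < int p" for k i j
    using step[of k i j] \<rho>_neg[of i j "k - int p"] that by simp
  have \<rho>_p: "\<rho>z (int p) i j = N 0 i j + N 0 j i" if "i < n" "j < n" for i j
    using step[of "int p" i j] \<rho>_low[of i j 0] that p0 N_sym[of 0 i j] by simp
  have \<rho>_per: "\<rho>z (k + int p * int w) i j = \<rho>z k i j" if "i < n" "j < n" "0 < k" for k w i j
  proof (induction w)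
    case (Suc w)
    have "0 < k + int (p * w)" using that by linarith
    then have "int p < k + int p * int (Suc w)" by (simp add: distrib_left)
    then show ?case using Suc step[of "k + int p * int (Suc w)" i j] N_high[of i j] that by (simp add: algebra_simps)
  qed simp
  \<comment> \<open>The relations are respected: a generator and its reduced representative have the
    same image. This is what lets the transformation descend.\<close>
  have compat: "subst \<rho> (red_gen p x) = \<rho> x" if x: "x \<in> gens n" for x
  proof -
    obtain k i j where xe: "x = (k, i, j)" by (cases x)
    have ij: "i < n" "j < n" and k0: "k = 0 \<Longrightarrow> i < j" using x by (auto simp: xe gens_def)
    have sV: "subst \<rho> (Var y) = \<rho> y" for y by (simp add: subst_conv_insertion)
    define r where "r = k mod p"
    have kr: "int k = int r + int p * int (k div p)" unfolding r_def
      by (metis mod_mult_div_eq of_nat_add of_nat_mult)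
    have r: "r < p" using p0 by (simp add: r_def)
    show ?thesis
    proof (cases "r = 0")
      case False
      have "\<rho> x = N (int r) i j"
        unfolding xe \<rho>[OF ij] kr using False r ij by (simp add: \<rho>_per \<rho>_low)
      moreover have "\<rho> (r, i, j) = N (int r) i j" using ij r by (simp add: \<rho> \<rho>_low)
      moreover have "\<rho> (p - r, j, i) = N (int r) i j"
        using ij r False N_sym[of "int r" j i] by (simp add: \<rho> \<rho>_low of_nat_diff)
      ultimately show ?thesis using False
        by (simp add: xe red_gen.simps Let_def r_def[symmetric] sV)
    next
      case True
      show ?thesis
      proof (cases "k = 0")
        case True
        then show ?thesis using k0 by (simp add: xe red_gen.simps sV)
      next
        case False
        then have "0 < k div p" using kr True p0 by (metis add.left_neutral bot_nat_0.not_eq_extremum mult_zero_right of_nat_0 of_nat_0_less_iff of_nat_eq_0_iff)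
        then have "int k = int p + int p * int (k div p - 1)" using kr True by (simp add: of_nat_diff right_diff_distrib)
        then have "\<rho> x = N 0 i j + N 0 j i"
          unfolding xe \<rho>[OF ij] using \<rho>_per[OF ij, of "int p" "k div p - 1"] \<rho>_p[OF ij] p0 by simp
        moreover have "\<rho> (0, c, d) = N 0 c d" if "c < n" "d < n" for c d using that p0 by (simp add: \<rho> \<rho>_low)
        moreover have "N 0 c d = 0" if "d < c" "c < n" for c d using tri[of c d] that by (simp add: N_def)
        moreover have "N 0 i i = 1" using tri[of i i] ij by (simp add: N_def)
        moreover have "subst \<rho> 2 = 2" by (metis Cst.insertion_Cst Cst_numeral subst_conv_insertion)
        ultimately show ?thesis using True ij
          by (cases i j rule: linorder_cases)
             (simp_all add: xe red_gen.simps Let_def r_def[symmetric] sV min_def max_def)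
      qed
    qed
  qed
  define \<phi> where "\<phi> = subst \<rho>"
  have \<beta>: "\<beta> f = subst \<tau> f" for f unfolding \<beta>_def coeff_hom_def \<tau>_def ..
  have red_\<beta>: "red p (\<beta> f) = \<phi> f" for f
    unfolding \<beta> red_def subst_subst \<phi>_def \<rho>_def ..
  have "\<rho> x \<in> Dp_alg n p" if "x \<in> gens_red n p" for x
  proof -
    obtain k i j where xe: "x = (k, i, j)" by (cases x)
    have ij: "i < n" "j < n" using that by (auto simp: xe gens_red_def)
    have "red p (G_int k c d) \<in> Dp_alg n p" if "c < n" "d < n" for k c d
      using red_G_coeff_in_Dp_alg[OF p0 that, of "nat k"] by (simp add: G_int_def Dp_alg_def)
    then show ?thesis
      unfolding xe \<rho>[OF ij] \<rho>z_def conj_coeff_def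
      using red_in_Dp_alg[OF p0 b] ij unfolding rb_def Dp_alg_def
      by (intro poly_alg_sum poly_alg_mult) auto
  qed
  then have into: "\<phi> f \<in> Dp_alg n p" if "f \<in> Dp_alg n p" for f
    using that unfolding \<phi>_def Dp_alg_def by (intro subst_in_poly_alg) auto
  have "induced_on_reduction n p \<beta> \<phi>"
    unfolding induced_on_reduction_def
  proof (intro conjI ballI)
    show "alg_hom (Dp_alg n p) (Dp_alg n p) \<phi>"
      unfolding alg_hom_def using into by (auto simp: \<phi>_def subst_conv_insertion)
    fix f assume "f \<in> D_alg n"
    then have "subst (\<lambda>x. subst \<rho> (red_gen p x)) f = subst \<rho> f"
      unfolding D_alg_def by (rule subst_cong) (rule compat)
    then show "\<phi> (red p f) = red p (\<beta> f)"
      unfolding red_\<beta> by (simp add: \<phi>_def red_def subst_subst)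
  qed
  moreover have "acts_as \<phi> n (Gp_mat n p) (laurent_mat n rb e * Gp_mat n p * transpose_mat (laurent_mat n rb (\<lambda>i j. - e i j)))"
    unfolding acts_as_def
  proof (intro allI impI)
    fix i j k assume ij: "i < n" "j < n"
    have Gp_carrier: "Gp_mat n p \<in> carrier_mat n n" by (simp add: Gp_mat_def)
    have "fls_nth ((laurent_mat n rb e * Gp_mat n p * transpose_mat (laurent_mat n rb (\<lambda>i j. - e i j))) $$ (i, j)) k = N k i j"
      unfolding N_def by (rule nth_conjugation) (use ij Gp_carrier in \<open>simp_all add: nth_Gp_mat[OF p]\<close>)
    moreover have "\<phi> (gp_coeff_int p k i j) = N k i j"
    proof -
      have \<phi>s: "\<phi> 0 = 0" "\<phi> 1 = 1" "\<phi> (Var y) = \<rho> y" for y by (simp_all add: \<phi>_def subst_conv_insertion)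
      have A: "\<phi> (A0 c d) = N 0 c d" if "c < n" "d < n" for c d
        using that tri[of c d] p0 by (auto simp: A0_def \<phi>s \<rho> \<rho>_low N_def[symmetric])
      consider "k < 0" | "k = 0" | "0 < k" "k < int p" | "k = int p" | "int p < k" by linarith
      then show ?thesis
      proof cases
        case 1
        then show ?thesis using neg ij by (simp add: gp_coeff_int_def \<phi>s N_def)
      next
        case 2
        then show ?thesis using A ij by (simp add: gp_coeff_int_def gp_coeff_def)
      next
        case 3
        then obtain l where l: "k = int l" "0 < l" "l < p" by (metis of_nat_0_less_iff of_nat_less_iff zero_less_imp_eq_int)
        then have "(l, i, j) \<in> gens n" using ij by (auto simp: gens_def)
        then have "\<phi> (red_gen p (l, i, j)) = \<rho> (l, i, j)" unfolding \<phi>_def by (rule compat)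
        then show ?thesis using l ij by (simp add: gp_coeff_int_def gp_coeff_def \<rho> \<rho>_low)
      next
        case 4
        then show ?thesis using A[of j i] ij p0 N_sym[of 0 i j] by (simp add: gp_coeff_int_def gp_coeff_def)
      next
        case 5
        then show ?thesis using N_high[OF ij 5] by (simp add: gp_coeff_int_def gp_coeff_def \<phi>s nat_less_iff)
      qed
    qed
    ultimately show "\<phi> (fls_nth (Gp_mat n p $$ (i, j)) k) =
        fls_nth ((laurent_mat n rb e * Gp_mat n p * transpose_mat (laurent_mat n rb (\<lambda>i j. - e i j))) $$ (i, j)) k"
      using nth_Gp_mat[OF p ij] by simp
  qed
  ultimately show ?thesis by blast
qed

section \<open>The braid matrices\<close>

definition braid_entry :: "nat \<Rightarrow> gen cpoly \<Rightarrow> nat \<Rightarrow> nat \<Rightarrow> gen cpoly" where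
  "braid_entry i g a c = (if a = i then (if c = i then g else 0) + (if c = Suc i then - 1 else 0)
     else if a = Suc i then (if c = i then 1 else 0) else (if c = a then 1 else 0))"

definition braid_last_entry :: "nat \<Rightarrow> gen cpoly \<Rightarrow> nat \<Rightarrow> nat \<Rightarrow> gen cpoly" where
  "braid_last_entry n g a c = (if a = 0 then (if c = n - 1 then 1 else 0)
     else if a = n - 1 then (if c = n - 1 then g else 0) + (if c = 0 then - 1 else 0)
     else (if c = a then 1 else 0))"

text \<open>Exponents of \<open>\<lambda>\<^sup>-\<^sup>1\<close>, so the entry
  \<open>\<lambda>\<close> has exponent -1.\<close>

definition braid_last_exp :: "nat \<Rightarrow> nat \<Rightarrow> nat \<Rightarrow> int" where
  "braid_last_exp n a c = (if a = 0 \<and> c = n - 1 then - 1 else if a = n - 1 \<and> c = 0 then 1 else 0)"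

lemma red_braid_entry: "red p (braid_entry i g a c) = braid_entry i (red p g) a c"
  by (simp add: braid_entry_def)

lemma red_braid_last_entry: "red p (braid_last_entry n g a c) = braid_last_entry n (red p g) a c"
  by (simp add: braid_last_entry_def)

lemma fls_const_uminus_one: "fls_const (- 1 :: gen cpoly) = - 1"
  by (rule fls_eqI) simp

lemma braid_mat_conv_laurent:
  "braid_mat n i g = laurent_mat n (braid_entry i g) (\<lambda>_ _. 0)"
  by (rule eq_matI) (auto simp: braid_mat_def laurent_mat_def braid_entry_def fls_const_uminus_one)

lemma braid_mat_last_conv_laurent:
  assumes "2 \<le> n"
  shows "braid_mat_last n g fls_X_inv fls_X = laurent_mat n (braid_last_entry n g) (braid_last_exp n)"
    and "braid_mat_last n g fls_X fls_X_inv =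
      laurent_mat n (braid_last_entry n g) (\<lambda>i j. - braid_last_exp n i j)"
  by (rule eq_matI, use assms in \<open>auto simp: braid_mat_last_def laurent_mat_def braid_last_entry_def
    braid_last_exp_def fls_const_uminus_one fls_X_conv_shift_1 fls_X_inv_conv_shift_1\<close>)+

lemma sum_braid_entry:
  assumes "Suc i < n" "a < n"
  shows "(\<Sum>c<n. braid_entry i g a c * F c) = (if a = i then g * F i - F (Suc i) else if a = Suc i then F i else F a)"
proof -
  have *: "(if P then x else 0) * y = (if P then x * y else 0)" for P and x y :: "gen cpoly" by simp
  show ?thesis using assms by (simp add: braid_entry_def distrib_right sum.distrib * del: mult_minus1)
qed

lemma sum_braid_last_entry:
  assumes "2 \<le> n" "a < n"
  shows "(\<Sum>c<n. braid_last_entry n g a c * F (braid_last_exp n a c) c) =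
    (if a = 0 then F (- 1) (n - 1) else if a = n - 1 then g * F 0 (n - 1) - F 1 0 else F 0 a)"
proof -
  have *: "(if P then x else 0) * y = (if P then x * y else 0)" for P and x y :: "gen cpoly" by simp
  have "(\<Sum>c<n. braid_last_entry n g a c * F (braid_last_exp n a c) c) = (\<Sum>c<n.
    (if a = 0 then (if c = n - 1 then F (- 1) (n - 1) else 0)
     else if a = n - 1 then (if c = n - 1 then g * F 0 (n - 1) else 0) + (if c = 0 then - F 1 0 else 0)
     else (if c = a then F 0 a else 0)))"
    using assms by (intro sum.cong refl) (auto simp: braid_last_entry_def braid_last_exp_def)
  also have "\<dots> = (if a = 0 then F (- 1) (n - 1) else if a = n - 1 then g * F 0 (n - 1) - F 1 0 else F 0 a)"
    using assms by (simp add: sum.distrib)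
  finally show ?thesis .
qed

lemma conj_coeff_nested:
  "conj_coeff n b e F k i j = (\<Sum>c<n. b i c * (\<Sum>d<n. b j d * F (k - e i c + e j d) c d))"
  by (simp add: conj_coeff_def sum_distrib_left mult.assoc)

lemma gp_coeff_int_simps:
  "k < 0 \<Longrightarrow> gp_coeff_int p k i j = 0"
  "1 \<le> p \<Longrightarrow> j < i \<Longrightarrow> gp_coeff_int p 0 i j = 0"
  "1 \<le> p \<Longrightarrow> gp_coeff_int p 0 i i = 1"
  by (simp_all add: gp_coeff_int_def gp_coeff_def A0_def)

lemma gp_coeff_int_corner:
  assumes "1 \<le> p" "2 \<le> n"
  shows "gp_coeff_int p 1 (n - 1) 0 = red p (Var (1, n - 1, 0))"
  using assms by (auto simp: gp_coeff_int_def gp_coeff_def A0_def red_gen.simps)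

text \<open>Levels are not shifted, so only the triangular shape of the new constant term is at
  stake. Its entry at \<open>(Suc i, i)\<close> is \<open>g - A0 i (Suc i)\<close>, which vanishes
  by the choice of \<open>g\<close> in the braid matrix.\<close>

lemma braid_descends:
  assumes p: "1 \<le> p" and i: "Suc i < n"
  shows "\<exists>\<phi>. induced_on_reduction n p (braid n i) \<phi> \<and>
    (let B = braid_mat n i (red p (Var (0, i, Suc i)))
     in acts_as \<phi> n (Gp_mat n p) (B * Gp_mat n p * transpose_mat B))"
proof -
  define g :: "gen cpoly" where "g = Var (0, i, Suc i)"
  have g: "red p g = g" "A0 i (Suc i) = g" by (simp_all add: g_def red_gen.simps A0_def)
  have conj: "conj_coeff n (\<lambda>a c. red p (braid_entry i g a c)) (\<lambda>_ _. 0) (gp_coeff_int p) k a b =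
    (if a = i then g * (if b = i then g * gp_coeff_int p k i i - gp_coeff_int p k i (Suc i) else if b = Suc i then gp_coeff_int p k i i else gp_coeff_int p k i b)
       - (if b = i then g * gp_coeff_int p k (Suc i) i - gp_coeff_int p k (Suc i) (Suc i) else if b = Suc i then gp_coeff_int p k (Suc i) i else gp_coeff_int p k (Suc i) b)
     else if a = Suc i then (if b = i then g * gp_coeff_int p k i i - gp_coeff_int p k i (Suc i) else if b = Suc i then gp_coeff_int p k i i else gp_coeff_int p k i b)
     else (if b = i then g * gp_coeff_int p k a i - gp_coeff_int p k a (Suc i) else if b = Suc i then gp_coeff_int p k a i else gp_coeff_int p k a b))"
    if "a < n" "b < n" for a b k
    unfolding red_braid_entry g conj_coeff_nested diff_0_right add_0_right
    by (simp only: sum_braid_entry[OF i] that)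
  have "\<exists>\<phi>. induced_on_reduction n p (coeff_hom (laurent_mat n (braid_entry i g) (\<lambda>_ _. 0) * G_mat n *
        transpose_mat (laurent_mat n (braid_entry i g) (\<lambda>_ _. - 0)))) \<phi> \<and>
      acts_as \<phi> n (Gp_mat n p) (laurent_mat n (\<lambda>a c. red p (braid_entry i g a c)) (\<lambda>_ _. 0) * Gp_mat n p *
        transpose_mat (laurent_mat n (\<lambda>a c. red p (braid_entry i g a c)) (\<lambda>_ _. - 0)))"
  proof (rule conjugation_descends[OF p])
    fix a c assume "a < n" "c < n"
    show "braid_entry i g a c \<in> D_alg n"
      unfolding D_alg_def braid_entry_def g_def using i
      by (auto intro!: poly_alg_Var poly_alg_add poly_alg_uminus simp: gens_def)
  next
    fix k :: int and a b assume "a < n" "b < n" "k < 0"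
    then show "conj_coeff n (\<lambda>a c. red p (braid_entry i g a c)) (\<lambda>_ _. 0) (gp_coeff_int p) k a b = 0"
      by (simp add: conj gp_coeff_int_simps)
  next
    fix a b assume "a < n" "b < n" "b \<le> a"
    then show "conj_coeff n (\<lambda>a c. red p (braid_entry i g a c)) (\<lambda>_ _. 0) (gp_coeff_int p) 0 a b = (if a = b then 1 else 0)"
      using g(2) p by (subst conj) (auto simp: gp_coeff_int_def gp_coeff_def A0_def)
  qed
  then show ?thesis
    by (simp add: braid_def Let_def braid_mat_conv_laurent red_braid_entry g_def)
qed

text \<open>The danger is positive powers of \<open>\<lambda>\<close>, which the corner exponents
  could produce at position \<open>(0, n - 1)\<close>. The coefficient of \<open>\<lambda>\<close>
  there is \<open>h\<close> minus the reduction of \<open>G^(1)_{n,1}\<close>, zero by the choice of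
  the entry \<open>h\<close>; that of \<open>\<lambda>^2\<close> is, up to sign, the lower left
  corner of \<open>A0\<close>, zero by triangularity.\<close>

lemma braid_last_descends:
  assumes p: "1 \<le> p" and n: "2 \<le> n"
  shows "\<exists>\<phi>. induced_on_reduction n p (braid_last n) \<phi> \<and>
    (let g = red p (Var (1, n - 1, 0))
     in acts_as \<phi> n (Gp_mat n p)
          (braid_mat_last n g fls_X_inv fls_X * Gp_mat n p * transpose_mat (braid_mat_last n g fls_X fls_X_inv)))"
proof -
  define g :: "gen cpoly" where "g = Var (1, n - 1, 0)"
  define h where "h = red p g"
  have h: "gp_coeff_int p 1 (n - 1) 0 = h" using gp_coeff_int_corner[OF p n] by (simp only: h_def g_def)
  define row where "row b k c = (if b = 0 then gp_coeff_int p (k - 1) c (n - 1)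
    else if b = n - 1 then h * gp_coeff_int p k c (n - 1) - gp_coeff_int p (k + 1) c 0 else gp_coeff_int p k c b)" for b k c
  have row: "(\<Sum>d<n. braid_last_entry n h b d * gp_coeff_int p (k + braid_last_exp n b d) c d) = row b k c" if "b < n" for b k c
    using sum_braid_last_entry[OF n that, of h "\<lambda>\<epsilon> d. gp_coeff_int p (k + \<epsilon>) c d"] by (simp add: row_def)
  have conj: "conj_coeff n (\<lambda>a c. red p (braid_last_entry n g a c)) (braid_last_exp n) (gp_coeff_int p) k a b =
    (if a = 0 then row b (k + 1) (n - 1) else if a = n - 1 then h * row b k (n - 1) - row b (k - 1) 0 else row b k a)"
    if "a < n" "b < n" for a b k
    using sum_braid_last_entry[OF n that(1), of h "\<lambda>\<epsilon> c. row b (k - \<epsilon>) c"]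
    by (simp add: red_braid_last_entry h_def[symmetric] conj_coeff_nested row[OF that(2)])
  have "\<exists>\<phi>. induced_on_reduction n p (coeff_hom (laurent_mat n (braid_last_entry n g) (braid_last_exp n) * G_mat n *
        transpose_mat (laurent_mat n (braid_last_entry n g) (\<lambda>a c. - braid_last_exp n a c)))) \<phi> \<and>
      acts_as \<phi> n (Gp_mat n p) (laurent_mat n (\<lambda>a c. red p (braid_last_entry n g a c)) (braid_last_exp n) * Gp_mat n p *
        transpose_mat (laurent_mat n (\<lambda>a c. red p (braid_last_entry n g a c)) (\<lambda>a c. - braid_last_exp n a c)))"
  proof (rule conjugation_descends[OF p])
    fix a c assume "a < n" "c < n"
    show "braid_last_entry n g a c \<in> D_alg n"
      unfolding D_alg_def braid_last_entry_def g_def using n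
      by (auto intro!: poly_alg_Var poly_alg_add poly_alg_uminus simp: gens_def)
  next
    fix k :: int and a b assume ab: "a < n" "b < n" and "k < 0"
    then consider "k = - 1" | "k = - 2" | "k < - 2" by linarith
    then show "conj_coeff n (\<lambda>a c. red p (braid_last_entry n g a c)) (braid_last_exp n) (gp_coeff_int p) k a b = 0"
      using ab p n by cases (auto simp: conj row_def gp_coeff_int_simps h simp del: One_nat_def)
  next
    fix a b assume "a < n" "b < n" "b \<le> a"
    then show "conj_coeff n (\<lambda>a c. red p (braid_last_entry n g a c)) (braid_last_exp n) (gp_coeff_int p) 0 a b
        = (if a = b then 1 else 0)"
      using p n by (auto simp: conj row_def gp_coeff_int_simps h simp del: One_nat_def)
  qed
  then show ?thesis
    by (simp add: braid_last_def Let_def braid_mat_last_conv_laurent[OF n] red_braid_last_entry g_def)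
qed

theorem proposition7p1:
  fixes n p :: nat
  assumes "2 \<le> n" and "1 \<le> p"
  shows
    "(\<forall>i. Suc i < n \<longrightarrow> (\<exists>\<phi>. induced_on_reduction n p (braid n i) \<phi> \<and>
        (let B = braid_mat n i (red p (Var (0, i, Suc i)))
         in acts_as \<phi> n (Gp_mat n p) (B * Gp_mat n p * transpose_mat B)))) \<and>
     (\<exists>\<phi>. induced_on_reduction n p (braid_last n) \<phi> \<and>
        (let g = red p (Var (1, n - 1, 0))
         in acts_as \<phi> n (Gp_mat n p)
              (braid_mat_last n g fls_X_inv fls_X * Gp_mat n p *
                 transpose_mat (braid_mat_last n g fls_X fls_X_inv)))) \<and>
     (\<forall>k. det_coeff n p k \<in> center (Dp_bracket p) (Dp_alg n p)) \<and>
     alg_indep (det_coeff n p) {1..n * p div 2} \<and>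
     (\<forall>S. S \<subseteq> center (Dp_bracket p) (Dp_alg n p) \<and> alg_indep (\<lambda>f. f) S \<longrightarrow>
        finite S \<and> card S \<le> n * p div 2)"
proof (intro conjI allI impI)
  have p: "0 < p" using assms(2) by simp
  show "\<exists>\<phi>. induced_on_reduction n p (braid n i) \<phi> \<and>
      (let B = braid_mat n i (red p (Var (0, i, Suc i)))
       in acts_as \<phi> n (Gp_mat n p) (B * Gp_mat n p * transpose_mat B))" if "Suc i < n" for i
    using braid_descends[OF assms(2) that] .
  show "\<exists>\<phi>. induced_on_reduction n p (braid_last n) \<phi> \<and>
      (let g = red p (Var (1, n - 1, 0))
       in acts_as \<phi> n (Gp_mat n p)
            (braid_mat_last n g fls_X_inv fls_X * Gp_mat n p *
               transpose_mat (braid_mat_last n g fls_X fls_X_inv)))"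
    using braid_last_descends[OF assms(2,1)] .
  show "det_coeff n p k \<in> center (Dp_bracket p) (Dp_alg n p)" for k
    using det_coeff_central[of n p k] assms by simp
  show "alg_indep (det_coeff n p) {1..n * p div 2}"
    using alg_indep_det_coeff[OF assms(2)] .
  fix S assume "S \<subseteq> center (Dp_bracket p) (Dp_alg n p) \<and> alg_indep (\<lambda>f. f) S"
  then show "finite S" "card S \<le> n * p div 2"
    using card_alg_indep_central_le[OF assms(1) p, of S] by blast+
qed

end
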